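(* Let $n\ge 2$ and let $\Omega\subset\mathbb{R}^n$ be a domain. Then the following statements hold. (1) Let $m\in\mathbb{R}\setminus\{0\}$, let $\varphi=|x|^m$, and assume $\Omega\subset\mathbb{R}^n\setminus\{0\}$. For every $f\in L^2_\varphi(\Omega,\mathbb{R}_n)$ satisfying $\int_\Omega\frac{|f|^2}{|x|^{m-2}}e^{-\varphi}\,dV<\infty$ there exists $u\in L^2_\varphi(\Omega,\mathbb{R}_n)$ such that $Du=f$ in $\Omega$ and $$\|u\|_\varphi^2\le\int_\Omega\frac{|f|^2}{m^2|x|^{m-2}}e^{-\varphi}\,dV .$$ In particular, for $\varphi=|x|^2$, every $f\in L^2_\varphi(\Omega,\mathbb{R}_n)$ admits a solution $u\in L^2_\varphi(\Omega,\mathbb{R}_n)$ of $Du=f$ with $\|u\|_\varphi^2\le\frac14\|f\|_\varphi^2$; and, if $\Omega=\mathbb{R}^n\setminus\{0\}$, the constant $1/4$ is sharp, i.e. there is no constant $C<1/4$ such that for every $f\in L^2_\varphi(\Omega,\mathbb{R}_n)$ there exists $u\in L^2_\varphi(\Omega,\mathbb{R}_n)$ with $Du=f$ and $\|u\|_\varphi^2\le C\|f\|_\varphi^2$. (2) Let $\varphi=x_1^2$. For every $f\in L^2_\varphi(\Omega,\mathbb{R}_n)$ there exists a solution $u\in L^2_\varphi(\Omega,\mathbb{R}_n)$ of $Du=f$ in $\Omega$ such that $$\|u\|_\varphi^2\le\frac12\|f\|_\varphi^2 .$$ (3) There exists $\varepsilon>0$, depending only on $n$, such that the following holds. Let $\varphi=\sum_{i=1}^n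 a_ix_i^2$ with real numbers $a_i$ satisfying $|a_i-1|<\varepsilon$ for $i=1,\dots,n$, and assume $\Omega\subset\mathbb{R}^n\setminus\overline{B(0,1)}$. Then for every $f\in L^2_\varphi(\Omega,\mathbb{R}_n)$ there exists a solution $u\in L^2_\varphi(\Omega,\mathbb{R}_n)$ of $Du=f$ in $\Omega$ such that $$\|u\|_\varphi^2\le\frac13\|f\|_\varphi^2 .$$
   Context: $\mathbb{R}_n$ is the real Clifford algebra: the associative unital $\mathbb{R}$-algebra generated by $e_1,\dots,e_n$ with $e_j^2=-1$ and $e_je_k+e_ke_j=0$ for $j\ne k$. It has real dimension $2^n$, with basis $e_A=e_{j_1}\cdots e_{j_\ell}$ for $A=\{j_1<\dots<j_\ell\}\subset\{1,\dots,n\}$, $e_\emptyset=1$. For $f=\sum_A f_Ae_A$ put $|f|^2=\sum_A f_A^2$, and $\langle f,g\rangle=\sum_A f_Ag_A$. The Dirac operator is $Du=\sum_{j=1}^n e_j\,\partial_ju$. For a real continuous weight $\varphi$ on $\Omega$, $L^2_\varphi(\Omega,\mathbb{R}_n)$ is the space of measurable $u:\Omega\to\mathbb{R}_n$ with $\|u\|_\varphi^2=\int_\Omega|u|^2e^{-\varphi}\,dV<\infty$, where $dV$ is Lebesgue measure. For $u\in L^2_\varphi$, the equation $Du=f$ is understood in the sense of distributions: $\int_\Omega\langle f,v\rangle\,dV=\int_\Omega\langle u,Dv\rangle\,dV$ for all $v\in C_c^\infty(\Omega,\mathbb{R}_n)$. A domain is a nonempty connected open set; $B(0,1)$ is the open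 Euclidean unit ball. *)

theory Defs
  imports "HOL-Analysis.Analysis"
begin

section \<open>The real Clifford algebra\<close>

text \<open>The generators are indexed by a finite linearly ordered type \<open>'n\<close> with \<open>CARD('n) = n\<close>. The
  coordinates of an element are its coefficients \<open>f\<^sub>A\<close> with respect to the basis \<open>e\<^sub>A\<close>, so
  the Euclidean \<^const>\<open>norm\<close> and \<^const>\<open>inner\<close> of this type are the Clifford norm and inner product.
  The algebra product is \<open>\<odot>\<close> below and not the library's componentwise product on vectors.\<close>

type_synonym 'n clifford = "real ^ ('n set)"

definition cl_basis :: "'n::{finite,linorder} set \<Rightarrow> 'n clifford" where
  "cl_basis A = axis A 1"

definition cl_one :: "'n::{finite,linorder} clifford" where
  "cl_one = cl_basis {}"

definition cl_gen :: "'n::{finite,linorder} \<Rightarrow> 'n clifford" where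
  "cl_gen j = cl_basis {j}"

text \<open>Sorting \<open>e\<^sub>A e\<^sub>B\<close> costs one sign for each pair \<open>(i, j)\<close> in \<open>A \<times> B\<close> with \<open>j < i\<close>
  (anticommutation) and one for each pair with \<open>i = j\<close> (squares equal \<open>-1\<close>).\<close>

definition cl_sign :: "'n::{finite,linorder} set \<Rightarrow> 'n set \<Rightarrow> real" where
  "cl_sign A B = (\<Prod>i\<in>A. \<Prod>j\<in>B. if j \<le> i then -1 else 1)"

definition cl_mult :: "'n::{finite,linorder} clifford \<Rightarrow> 'n clifford \<Rightarrow> 'n clifford"
    (infixl "\<odot>" 70) where
  "x \<odot> y = (\<Sum>A\<in>UNIV. \<Sum>B\<in>UNIV. (x $ A * y $ B * cl_sign A B) *\<^sub>R cl_basis (sym_diff A B))"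

text \<open>The following lemmas confirm that this is the Clifford algebra: a bilinear, associative and
  unital product satisfying the defining relations, in which \<open>e\<^sub>A\<close> is the ordered product
  of the generators indexed by \<open>A\<close>.\<close>

lemma cl_expand: "x = (\<Sum>A\<in>UNIV. (x $ A) *\<^sub>R cl_basis A)"
  by (simp add: vec_eq_iff cl_basis_def axis_def if_distrib cong: if_cong)

lemma cl_mult_basis: "cl_basis A \<odot> cl_basis B = cl_sign A B *\<^sub>R cl_basis (sym_diff A B)"
proof -
  have "cl_basis A \<odot> cl_basis B =
    (\<Sum>A'\<in>UNIV. \<Sum>B'\<in>UNIV. if A' = A then (if B' = B then cl_sign A B *\<^sub>R cl_basis (sym_diff A B) else 0) else 0)"
    unfolding cl_mult_def
    by (intro sum.cong refl) (auto simp: cl_basis_def axis_def)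
  also have "\<dots> = (\<Sum>A'\<in>UNIV. if A' = A then cl_sign A B *\<^sub>R cl_basis (sym_diff A B) else 0)"
    by (intro sum.cong refl) simp
  finally show ?thesis by simp
qed

lemma bilinear_cl_mult: "bilinear (\<odot>)"
  unfolding bilinear_def
  by (intro conjI allI linearI)
     (simp_all add: cl_mult_def distrib_left distrib_right scaleR_left.add sum.distrib
        scaleR_sum_right mult_ac)

lemma prod_sym_diff:
  fixes g :: "'a \<Rightarrow> real"
  assumes "finite A" "finite B" and g: "\<And>x. g x * g x = 1"
  shows "prod g (sym_diff A B) = prod g A * prod g B"
proof -
  have A: "prod g A = prod g (A - B) * prod g (A \<inter> B)"
    using prod.Int_Diff[OF assms(1), of g B] by (simp add: mult.commute)
  have B: "prod g B = prod g (B - A) * prod g (A \<inter> B)"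
    using prod.Int_Diff[OF assms(2), of g A] by (simp add: mult.commute Int_commute)
  have 1: "prod g (A \<inter> B) * prod g (A \<inter> B) = 1"
    by (simp add: prod.distrib[symmetric] g)
  have "prod g (sym_diff A B) = prod g (A - B) * prod g (B - A)"
    using assms by (intro prod.union_disjoint) auto
  also have "\<dots> = prod g (A - B) * prod g (B - A) * (prod g (A \<inter> B) * prod g (A \<inter> B))"
    by (simp add: 1)
  finally show ?thesis by (simp add: A B mult_ac)
qed

lemma cl_sign_sym_diff_left: "cl_sign (sym_diff A B) C = cl_sign A C * cl_sign B C"
  unfolding cl_sign_def
  by (rule prod_sym_diff) (auto simp: prod.distrib[symmetric] intro!: prod.neutral)

lemma cl_sign_sym_diff_right: "cl_sign A (sym_diff B C) = cl_sign A B * cl_sign A C"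
  unfolding cl_sign_def prod.distrib[symmetric]
  by (intro prod.cong refl prod_sym_diff) auto

lemma cl_mult_assoc: "(x \<odot> y) \<odot> z = x \<odot> (y \<odot> z)"
proof -
  have basis: "(cl_basis A \<odot> cl_basis B) \<odot> cl_basis C = cl_basis A \<odot> (cl_basis B \<odot> cl_basis C)"
    for A B C :: "'a set"
  proof -
    have "sym_diff (sym_diff A B) C = sym_diff A (sym_diff B C)" by blast
    then show ?thesis
      by (simp add: cl_mult_basis bilinear_lmul[OF bilinear_cl_mult] bilinear_rmul[OF bilinear_cl_mult]
          cl_sign_sym_diff_left cl_sign_sym_diff_right)
  qed
  note lin = bilinear_lmul[OF bilinear_cl_mult] bilinear_rmul[OF bilinear_cl_mult]
  note suml = linear_sum[OF bilinear_cl_mult[unfolded bilinear_def, THEN conjunct2, rule_format]]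
  note sumr = linear_sum[OF bilinear_cl_mult[unfolded bilinear_def, THEN conjunct1, rule_format]]
  define t where "t A = (x $ A) *\<^sub>R cl_basis A" for A
  define s where "s A = (y $ A) *\<^sub>R cl_basis A" for A
  define r where "r A = (z $ A) *\<^sub>R cl_basis A" for A
  have x: "x = sum t UNIV" and y: "y = sum s UNIV" and z: "z = sum r UNIV"
    unfolding t_def s_def r_def by (rule cl_expand)+
  have "(t A \<odot> s B) \<odot> r C = t A \<odot> (s B \<odot> r C)" for A B C
    by (simp add: t_def s_def r_def lin basis)
  then show ?thesis
    unfolding x y z by (simp add: suml sumr)
qed

lemma cl_mult_one_left: "cl_one \<odot> x = x"
proof -
  have "cl_one \<odot> x = (\<Sum>A\<in>UNIV. cl_one \<odot> ((x $ A) *\<^sub>R cl_basis A))"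
    using linear_sum[OF bilinear_cl_mult[unfolded bilinear_def, THEN conjunct1, rule_format]]
    by (subst cl_expand[of x]) blast
  also have "\<dots> = (\<Sum>A\<in>UNIV. (x $ A) *\<^sub>R cl_basis A)"
    by (simp add: bilinear_rmul[OF bilinear_cl_mult] cl_one_def cl_mult_basis cl_sign_def)
  finally show ?thesis using cl_expand[of x] by simp
qed

lemma cl_mult_one_right: "x \<odot> cl_one = x"
proof -
  have "x \<odot> cl_one = (\<Sum>A\<in>UNIV. ((x $ A) *\<^sub>R cl_basis A) \<odot> cl_one)"
    using linear_sum[OF bilinear_cl_mult[unfolded bilinear_def, THEN conjunct2, rule_format]]
    by (subst cl_expand[of x]) blast
  also have "\<dots> = (\<Sum>A\<in>UNIV. (x $ A) *\<^sub>R cl_basis A)"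
    by (simp add: bilinear_lmul[OF bilinear_cl_mult] cl_one_def cl_mult_basis cl_sign_def)
  finally show ?thesis using cl_expand[of x] by simp
qed

lemma cl_gen_square: "cl_gen j \<odot> cl_gen j = - cl_one"
  by (simp add: cl_gen_def cl_one_def cl_mult_basis cl_sign_def)

lemma cl_gen_anticommute: "j \<noteq> k \<Longrightarrow> cl_gen j \<odot> cl_gen k + cl_gen k \<odot> cl_gen j = 0"
proof -
  assume "j \<noteq> k"
  moreover have "sym_diff {j} {k} = sym_diff {k} {j}" by blast
  ultimately show ?thesis
    by (auto simp: cl_gen_def cl_mult_basis cl_sign_def)
qed

lemma cl_basis_eq_prod:
  "cl_basis A = foldr (\<lambda>j x. cl_gen j \<odot> x) (sorted_list_of_set A) cl_one"
proof -
  have "sorted_wrt (<) xs \<Longrightarrow> cl_basis (set xs) = foldr (\<lambda>j x. cl_gen j \<odot> x) xs cl_one"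
    for xs :: "'a list"
  proof (induction xs)
    case Nil
    then show ?case by (simp add: cl_one_def)
  next
    case (Cons a xs)
    then have less: "\<forall>b\<in>set xs. a < b" by simp
    then have "cl_sign {a} (set xs) = 1"
      by (auto simp: cl_sign_def intro!: prod.neutral)
    moreover have "sym_diff {a} (set xs) = insert a (set xs)" using less by auto
    ultimately have "cl_basis (set (a # xs)) = cl_gen a \<odot> cl_basis (set xs)"
      by (simp add: cl_gen_def cl_mult_basis)
    then show ?case using Cons by simp
  qed
  from this[of "sorted_list_of_set A"] show ?thesis by simp
qed


section \<open>The Dirac operator and test functions\<close>

text \<open>The same type as \<open>real ^ 'n\<close>; the infix notation would force the sort of \<open>'n\<close> to be repeated at
  each occurrence.\<close>

type_synonym 'n point = "(real, 'n) vec"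

definition partial_deriv :: "'n::finite \<Rightarrow> (real^'n \<Rightarrow> 'b::real_normed_vector) \<Rightarrow> real^'n \<Rightarrow> 'b" where
  "partial_deriv j v x = frechet_derivative v (at x) (axis j 1)"

definition dirac ::
    "('n::{finite,linorder} point \<Rightarrow> 'n clifford) \<Rightarrow> 'n point \<Rightarrow> 'n clifford" where
  "dirac v x = (\<Sum>j\<in>UNIV. cl_gen j \<odot> partial_deriv j v x)"

primrec C_diff :: "nat \<Rightarrow> (real^'n::finite \<Rightarrow> 'b::real_normed_vector) \<Rightarrow> bool" where
  "C_diff 0 v \<longleftrightarrow> continuous_on UNIV v"
| "C_diff (Suc k) v \<longleftrightarrow> v differentiable_on UNIV \<and> (\<forall>j. C_diff k (partial_deriv j v))"

text \<open>Elements of \<open>C\<^sub>c\<^sup>\<infinity>(\<Omega>)\<close> are identified with their extensions by zero to the whole space.\<close>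

definition test_functions :: "(real^'n::finite) set \<Rightarrow> (real^'n \<Rightarrow> 'b::real_normed_vector) set" where
  "test_functions \<Omega> = {v. (\<forall>k. C_diff k v) \<and>
     compact (closure {x. v x \<noteq> 0}) \<and> closure {x. v x \<noteq> 0} \<subseteq> \<Omega>}"


section \<open>Weighted spaces and distributional solutions\<close>

text \<open>Functions on \<open>\<Omega>\<close> are total functions of which only the values on \<open>\<Omega>\<close> matter.\<close>

definition is_domain :: "'a::topological_space set \<Rightarrow> bool" where
  "is_domain \<Omega> \<longleftrightarrow> open \<Omega> \<and> connected \<Omega> \<and> \<Omega> \<noteq> {}"

definition weighted_L2 ::
    "('n::{finite,linorder} point \<Rightarrow> real) \<Rightarrow> ('n point) set \<Rightarrow> ('n point \<Rightarrow> 'n clifford) set" where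
  "weighted_L2 \<phi> \<Omega> = {u. u \<in> borel_measurable (lebesgue_on \<Omega>) \<and>
     integrable (lebesgue_on \<Omega>) (\<lambda>x. (norm (u x))\<^sup>2 * exp (- \<phi> x))}"

definition weighted_norm ::
    "('n::{finite,linorder} point \<Rightarrow> real) \<Rightarrow> ('n point) set \<Rightarrow> ('n point \<Rightarrow> 'n clifford) \<Rightarrow> real" where
  "weighted_norm \<phi> \<Omega> u = sqrt (\<integral>x. (norm (u x))\<^sup>2 * exp (- \<phi> x) \<partial>lebesgue_on \<Omega>)"

text \<open>Used only for \<open>u\<close> and \<open>f\<close> in a weighted space with weight continuous on \<open>\<Omega>\<close>. These are locally
  square integrable, so both integrands below are integrable.\<close>

definition dirac_eq ::
    "('n::{finite,linorder} point) set \<Rightarrow> ('n point \<Rightarrow> 'n clifford) \<Rightarrow> ('n point \<Rightarrow> 'n clifford) \<Rightarrow> bool" where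
  "dirac_eq \<Omega> u f \<longleftrightarrow> (\<forall>v\<in>test_functions \<Omega>.
     (\<integral>x. f x \<bullet> v x \<partial>lebesgue_on \<Omega>) = (\<integral>x. u x \<bullet> dirac v x \<partial>lebesgue_on \<Omega>))"

definition first_index :: "'n::{finite,linorder}" where
  "first_index = Min UNIV"

end

theory Submission
  imports Defs "HOL-Probability.Distributions"
begin

text \<open>Each existence claim is dual to an estimate for test functions. Multiplication by a generator is
skew, hence \<open>D\<close> is formally self-adjoint, and \<open>u\<close> solves \<open>Du = f\<close> precisely when pairing with \<open>u\<close>
represents the functional \<open>Dv \<mapsto> \<integral>\<langle>f, v\<rangle>\<close>. If
  \<open>\<integral> w |v|\<^sup>2 e\<^sup>\<phi> \<le> \<integral> |Dv|\<^sup>2 e\<^sup>\<phi>\<close>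
for all test functions \<open>v\<close>, the Cauchy--Schwarz inequality bounds this functional, and the Riesz
representation in \<open>L\<^sup>2\<close> yields a solution with \<open>\<parallel>u\<parallel>\<^sup>2 \<le> \<integral> |f|\<^sup>2 w\<^sup>-\<^sup>1 e\<^sup>-\<^sup>\<phi>\<close>
(\<open>dirac_solution_of_estimate\<close>). So the weights \<open>w = m\<^sup>2|x|\<^sup>m\<^sup>-\<^sup>2\<close>, \<open>2\<close> and \<open>3\<close> have to be established.

All three estimates come from one identity (\<open>dirac_weighted_identity\<close>). Let \<open>y\<close> be a vector field,
read as a Clifford vector, let \<open>g\<close> be a positive function whose gradient is parallel to \<open>y\<close>, and
let \<open>g \<beta> = div (g y)\<close>. For \<open>y = b + Ax\<close> with \<open>A\<close> a multiple of the identity,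
  \<open>\<integral> g |y|\<^sup>2 |Dv|\<^sup>2 = \<integral> g |y Dv + 2 \<partial>\<^sub>y v + \<beta> v|\<^sup>2 + \<integral> g (\<partial>\<^sub>y \<beta>) |v|\<^sup>2\<close>.
Indeed \<open>y Dv = S - \<partial>\<^sub>y v\<close>, where \<open>S\<close> collects the products \<open>y\<^sub>j e\<^sub>j e\<^sub>k \<partial>\<^sub>k v\<close> with \<open>j \<noteq> k\<close>. The
square on the right differs from \<open>|y|\<^sup>2|Dv|\<^sup>2\<close> by terms of lower order and by \<open>4\<langle>S, \<partial>\<^sub>y v\<rangle>\<close>. The
latter is quadratic in first derivatives, but since \<open>e\<^sub>j e\<^sub>k\<close> is skew it integrates by parts to a
term with a single derivative (\<open>spin_pair_by_parts\<close>), and the choice of \<open>\<beta>\<close> cancels that term.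
Dropping the square gives the estimates:
\<^item> \<open>\<phi> = |x|\<^sup>m\<close>: take \<open>y = x\<close>, \<open>g = e\<^sup>\<phi>/|x|\<^sup>2\<close>, so that \<open>\<beta> = m|x|\<^sup>m + n - 2\<close> and
  \<open>\<partial>\<^sub>y \<beta> = m\<^sup>2|x|\<^sup>m\<close>. The square is then a multiple of \<open>|D(e\<^sup>\<phi> x v/|x|\<^sup>2)|\<^sup>2\<close>.
\<^item> \<open>\<phi> = x\<^sub>1\<^sup>2\<close>: take \<open>y = e\<^sub>1\<close>, \<open>g = e\<^sup>\<phi>\<close>, so that \<open>\<beta> = 2x\<^sub>1\<close> and \<open>\<partial>\<^sub>y \<beta> = 2\<close>.
\<^item> \<open>\<phi> = \<Sum>a\<^sub>i x\<^sub>i\<^sup>2\<close>: take \<open>y = (a\<^sub>i x\<^sub>i)\<close>, \<open>g = e\<^sup>\<phi>/\<phi>\<close>. Now \<open>A\<close> is not scalar and leaves an error of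
  size \<open>\<epsilon> |v| |\<nabla>v| e\<^sup>\<phi>/|x|\<close>. Outside the unit ball a second integration by parts bounds
  \<open>\<integral> |\<nabla>v|\<^sup>2 e\<^sup>\<phi>/|x|\<^sup>2\<close> by \<open>\<integral> |Dv|\<^sup>2 e\<^sup>\<phi>\<close> and \<open>\<integral> |v|\<^sup>2 e\<^sup>\<phi>\<close>, and for small \<open>\<epsilon>\<close> the isotropic constant
  \<open>4\<close> drops at most to \<open>3\<close>.

For sharpness the square in the first case has to be small. It vanishes for \<open>v = x exp(-|x|\<^sup>2)\<close>, which is
not compactly supported away from the origin. Multiplying by smooth radial cutoffs \<open>\<chi>(|x|\<^sup>2)\<close> turns
the square into a multiple of \<open>(|x|\<^sup>2 \<chi>'(|x|\<^sup>2))\<^sup>2 exp(-|x|\<^sup>2)\<close>, which is bounded uniformly by a Gaussian and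
tends to zero as the cutoffs open up. Testing \<open>Du = f\<close> with \<open>f = e\<^sup>\<phi> v\<close> against \<open>v\<close> then forces every
admissible constant to be at least \<open>1/4\<close>.\<close>

section \<open>Calculus of first partial derivatives and integration by parts\<close>

text \<open>Continuous differentiability on an open set with the partial derivatives as explicit data: the
weights occurring below are singular at the origin, and their partial derivatives enter the
integrands.\<close>

definition C1_partials ::
    "(real^'n::finite) set \<Rightarrow> (real^'n \<Rightarrow> 'b::real_normed_vector) \<Rightarrow> ('n \<Rightarrow> real^'n \<Rightarrow> 'b) \<Rightarrow> bool" where
  "C1_partials \<Omega> F D \<longleftrightarrow>
     (\<forall>x\<in>\<Omega>. (F has_derivative (\<lambda>h. \<Sum>j\<in>UNIV. h $ j *\<^sub>R D j x)) (at x)) \<and>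
     (\<forall>j. continuous_on \<Omega> (D j))"

lemma C1_partialsD:
  assumes "C1_partials \<Omega> F D"
  shows "x \<in> \<Omega> \<Longrightarrow> (F has_derivative (\<lambda>h. \<Sum>j\<in>UNIV. h $ j *\<^sub>R D j x)) (at x)"
    and "continuous_on \<Omega> (D j)"
    and "continuous_on \<Omega> F"
  using assms unfolding C1_partials_def
  by (auto intro!: continuous_at_imp_continuous_on has_derivative_continuous)

lemma C1_partials_const: "C1_partials \<Omega> (\<lambda>x. c) (\<lambda>j x. 0)"
  by (simp add: C1_partials_def)

lemma C1_partials_coord: "C1_partials \<Omega> (\<lambda>x. x $ i) (\<lambda>j x. if j = i then 1 else 0)"
proof -
  have "(\<lambda>h. h $ i) = (\<lambda>h::real^'a. \<Sum>j\<in>UNIV. h $ j *\<^sub>R (if j = i then 1 else 0))"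
    by (simp add: if_distrib cong: if_cong)
  moreover have "((\<lambda>x. x $ i) has_derivative (\<lambda>h. h $ i)) (at x)" for x :: "real^'a"
    by (rule bounded_linear_imp_has_derivative[OF bounded_linear_vec_nth])
  ultimately show ?thesis by (simp add: C1_partials_def)
qed

lemma C1_partials_add:
  assumes "C1_partials \<Omega> F D" "C1_partials \<Omega> G E"
  shows "C1_partials \<Omega> (\<lambda>x. F x + G x) (\<lambda>j x. D j x + E j x)"
  using assms unfolding C1_partials_def
  by (auto intro!: continuous_intros derivative_eq_intros simp: scaleR_add_right sum.distrib)

text \<open>The Leibniz rule in the generality that covers products of scalars as well as inner products of
Clifford-valued functions.\<close>

lemma C1_partials_bilinear:
  assumes B: "bounded_bilinear B" and F: "C1_partials \<Omega> F D" and G: "C1_partials \<Omega> G E"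
  shows "C1_partials \<Omega> (\<lambda>x. B (F x) (G x)) (\<lambda>j x. B (D j x) (G x) + B (F x) (E j x))"
proof -
  interpret bounded_bilinear B by fact
  have "((\<lambda>x. B (F x) (G x)) has_derivative
      (\<lambda>h. \<Sum>j\<in>UNIV. h $ j *\<^sub>R (B (D j x) (G x) + B (F x) (E j x)))) (at x)" if "x \<in> \<Omega>" for x
    by (rule has_derivative_eq_rhs[OF FDERIV[OF C1_partialsD(1)[OF F that] C1_partialsD(1)[OF G that]]])
       (simp add: fun_eq_iff sum_left sum_right scaleR_left scaleR_right scaleR_add_right
          sum.distrib add.commute)
  moreover have "continuous_on \<Omega> (\<lambda>x. B (D j x) (G x) + B (F x) (E j x))" for j
    using F G by (intro continuous_intros continuous_on C1_partialsD)
  ultimately show ?thesis by (simp add: C1_partials_def)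
qed

lemmas C1_partials_mult = C1_partials_bilinear[OF bounded_bilinear_mult]
lemmas C1_partials_inner = C1_partials_bilinear[OF bounded_bilinear_inner]

lemma C1_partials_linear:
  assumes L: "bounded_linear L" and F: "C1_partials \<Omega> F D"
  shows "C1_partials \<Omega> (\<lambda>x. L (F x)) (\<lambda>j x. L (D j x))"
proof -
  interpret bounded_linear L by fact
  have "((\<lambda>x. L (F x)) has_derivative (\<lambda>h. \<Sum>j\<in>UNIV. h $ j *\<^sub>R L (D j x))) (at x)"
    if "x \<in> \<Omega>" for x
    by (rule has_derivative_eq_rhs[OF has_derivative[OF C1_partialsD(1)[OF F that]]])
       (simp add: fun_eq_iff sum scaleR)
  moreover have "continuous_on \<Omega> (\<lambda>x. L (D j x))" for j
    using F by (intro continuous_on C1_partialsD)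
  ultimately show ?thesis by (simp add: C1_partials_def)
qed

lemma C1_partials_chain:
  fixes F :: "real^'n::finite \<Rightarrow> real"
  assumes F: "C1_partials \<Omega> F D"
    and h: "\<And>x. x \<in> \<Omega> \<Longrightarrow> (h has_real_derivative h' (F x)) (at (F x))"
    and c: "continuous_on \<Omega> (\<lambda>x. h' (F x))"
  shows "C1_partials \<Omega> (\<lambda>x. h (F x)) (\<lambda>j x. h' (F x) * D j x)"
proof -
  have "((\<lambda>x. h (F x)) has_derivative (\<lambda>t. \<Sum>j\<in>UNIV. t $ j *\<^sub>R (h' (F x) * D j x))) (at x)"
    if x: "x \<in> \<Omega>" for x
    by (rule has_derivative_eq_rhs[OF has_derivative_compose[OF C1_partialsD(1)[OF F x]
          h[OF x, unfolded has_field_derivative_def]]])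
       (simp add: fun_eq_iff sum_distrib_left mult_ac)
  then show ?thesis using F c
    by (auto simp: C1_partials_def intro!: continuous_intros)
qed

lemma C1_partials_cong:
  assumes F: "C1_partials \<Omega> F D" and "open \<Omega>" "\<And>x. x \<in> \<Omega> \<Longrightarrow> F x = G x"
    and D: "\<And>j x. x \<in> \<Omega> \<Longrightarrow> D j x = E j x"
  shows "C1_partials \<Omega> G E"
proof -
  have "continuous_on \<Omega> (E j)" for j
    using C1_partialsD(2)[OF F, of j] D by (simp cong: continuous_on_cong)
  moreover have "(G has_derivative (\<lambda>h. \<Sum>j\<in>UNIV. h $ j *\<^sub>R E j x)) (at x)" if x: "x \<in> \<Omega>" for x
  proof (rule has_derivative_transform_within_open[where f=F and s=\<Omega>])
    show "(F has_derivative (\<lambda>h. \<Sum>j\<in>UNIV. h $ j *\<^sub>R E j x)) (at x)"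
      using C1_partialsD(1)[OF F x] by (simp only: D[OF x])
  qed (fact assms x)+
  ultimately show ?thesis by (simp add: C1_partials_def)
qed

lemma C1_partials_subset: "C1_partials \<Omega> F D \<Longrightarrow> S \<subseteq> \<Omega> \<Longrightarrow> C1_partials S F D"
  by (auto simp: C1_partials_def intro: continuous_on_subset)

lemma integrable_compact_support:
  fixes F :: "'a::euclidean_space \<Rightarrow> 'b::euclidean_space"
  assumes "open \<Omega>" "compact K" "K \<subseteq> \<Omega>" "continuous_on \<Omega> F" and 0: "\<And>x. x \<in> \<Omega> - K \<Longrightarrow> F x = 0"
  shows "integrable (lebesgue_on \<Omega>) F"
proof -
  have "integrable lborel (\<lambda>x. indicator K x *\<^sub>R F x)"
    using assms by (intro borel_integrable_compact) (auto intro: continuous_on_subset)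
  then have "integrable lebesgue (\<lambda>x. indicator K x *\<^sub>R F x)"
    by (subst integrable_completion) auto
  moreover have "(\<lambda>x. indicator K x *\<^sub>R F x) = (\<lambda>x. if x \<in> \<Omega> then F x else 0)"
    using 0 \<open>K \<subseteq> \<Omega>\<close> by (auto simp: indicator_def fun_eq_iff)
  ultimately show ?thesis
    using \<open>open \<Omega>\<close> by (simp add: Lebesgue_Measure.integrable_restrict_UNIV)
qed

lemma lborel_integral_translate:
  fixes F :: "'a::euclidean_space \<Rightarrow> real"
  assumes "F \<in> borel_measurable borel"
  shows "(\<integral>x. F (x + c) \<partial>lborel) = (\<integral>x. F x \<partial>lborel)"
proof -
  have "(\<integral>x. F x \<partial>lborel) = (\<integral>x. F x \<partial>distr lborel borel ((+) c))"
    by (simp add: lborel_distr_plus)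
  also have "\<dots> = (\<integral>x. F (c + x) \<partial>lborel)"
    using assms by (subst integral_distr) auto
  finally show ?thesis by (simp add: add.commute)
qed

lemma C1_partials_line:
  fixes F :: "real^'n::finite \<Rightarrow> real"
  assumes "C1_partials UNIV F D"
  shows "((\<lambda>t. F (x + t *\<^sub>R axis j 1)) has_real_derivative D j (x + t *\<^sub>R axis j 1)) (at t)"
proof -
  have d: "((\<lambda>t. x + t *\<^sub>R axis j 1) has_derivative (\<lambda>s. s *\<^sub>R axis j 1)) (at t)"
    by (auto intro!: derivative_eq_intros)
  have "(\<Sum>i\<in>UNIV. (s *\<^sub>R axis j 1) $ i *\<^sub>R D i z) = D j z * s" for s z
  proof -
    have "(\<Sum>i\<in>UNIV. (s *\<^sub>R axis j 1) $ i *\<^sub>R D i z) = (\<Sum>i\<in>UNIV. if i = j then s * D j z else 0)"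
      by (intro sum.cong) (auto simp: axis_def)
    then show ?thesis by simp
  qed
  with has_derivative_compose[OF d C1_partialsD(1)[OF assms UNIV_I]]
  show ?thesis by (simp only: has_field_derivative_def)
qed

text \<open>By translation invariance the difference quotients of \<open>F\<close> in direction \<open>j\<close> have integral zero. They
are bounded by the maximum of the partial derivative and live in a fixed ball, so dominated
convergence passes to the limit.\<close>

lemma integral_partial_eq_0_UNIV:
  fixes F :: "real^'n::finite \<Rightarrow> real"
  assumes F: "C1_partials UNIV F D" and K: "compact K" and 0: "\<And>x. x \<notin> K \<Longrightarrow> F x = 0"
    and D0: "\<And>x. x \<notin> K \<Longrightarrow> D j x = 0"
  shows "(\<integral>x. D j x \<partial>lborel) = 0"
proof -
  define e :: "real^'n" where "e = axis j 1"
  have cF: "continuous_on UNIV F" and cD: "continuous_on UNIV (D j)"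
    using C1_partialsD[OF F] by auto
  have mF [measurable]: "F \<in> borel_measurable borel" and mD [measurable]: "D j \<in> borel_measurable borel"
    using cF cD by (auto intro: borel_measurable_continuous_onI)
  have iF: "integrable lborel F"
  proof -
    have "integrable lborel (\<lambda>x. indicator K x *\<^sub>R F x)"
      using K continuous_on_subset[OF cF subset_UNIV] by (intro borel_integrable_compact)
    moreover have "(\<lambda>x. indicator K x *\<^sub>R F x) = F" using 0 by (auto simp: indicator_def fun_eq_iff)
    ultimately show ?thesis by simp
  qed
  have line: "((\<lambda>t. F (x + t *\<^sub>R e)) has_real_derivative D j (x + t *\<^sub>R e)) (at t)" for x t
    unfolding e_def by (rule C1_partials_line[OF F])
  define q where "q n x = (F (x + (1 / real (Suc n)) *\<^sub>R e) - F x) * real (Suc n)" for n x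
  obtain B where B: "\<And>x. \<bar>D j x\<bar> \<le> B" "B \<ge> 0"
  proof -
    have "compact (D j ` K)" using K continuous_on_subset[OF cD subset_UNIV] by (intro compact_continuous_image)
    then obtain b where "\<And>x. x \<in> K \<Longrightarrow> norm (D j x) \<le> b"
      by (meson bounded_iff compact_imp_bounded imageI)
    then have "\<bar>D j x\<bar> \<le> max b 0" for x
      using D0[of x] by (cases "x \<in> K") (auto simp: max_def, fastforce)
    then show ?thesis using that[of "max b 0"] by auto
  qed
  obtain R where R: "\<And>x. x \<in> K \<Longrightarrow> norm x \<le> R"
    using K by (meson bounded_iff compact_imp_bounded)
  have ne: "norm e = 1" by (simp add: e_def)
  have qb: "norm (q n x) \<le> indicator (cball 0 (R + 1)) x *\<^sub>R B" for n x
  proof (cases "x \<in> cball 0 (R + 1)")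
    case True
    have "(1::real) / real (Suc n) > 0" by simp
    from MVT2[OF this, of "\<lambda>t. F (x + t *\<^sub>R e)" "\<lambda>t. D j (x + t *\<^sub>R e)"] line
    obtain z where "F (x + (1 / real (Suc n)) *\<^sub>R e) - F x = 1 / real (Suc n) * D j (x + z *\<^sub>R e)"
      by auto
    then have "q n x = D j (x + z *\<^sub>R e)" by (simp add: q_def del: of_nat_Suc)
    then show ?thesis using True B by simp
  next
    case False
    have "norm x \<le> norm (x + (1 / real (Suc n)) *\<^sub>R e) + 1 / real (Suc n)"
      using norm_triangle_ineq4[of "x + (1 / real (Suc n)) *\<^sub>R e" "(1 / real (Suc n)) *\<^sub>R e"] ne by simp
    moreover have "1 / real (Suc n) \<le> 1" by simp
    moreover have "norm x > R + 1" using False by simp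
    ultimately have "norm (x + (1 / real (Suc n)) *\<^sub>R e) > R" "norm x > R" by linarith+
    then have "x \<notin> K" "x + (1 / real (Suc n)) *\<^sub>R e \<notin> K" using R not_le by blast+
    then show ?thesis using False by (simp add: q_def 0)
  qed
  have lim: "(\<lambda>n. q n x) \<longlonglongrightarrow> D j x" for x
  proof -
    have "((\<lambda>h. (F (x + h *\<^sub>R e) - F x) / h) \<longlongrightarrow> D j x) (at 0)"
      using line[of x 0] by (simp add: has_field_derivative_iff)
    moreover have "filterlim (\<lambda>n. 1 / real (Suc n)) (at 0) sequentially"
      by (auto simp: filterlim_at intro!: LIMSEQ_Suc[OF lim_1_over_n, simplified])
    ultimately have "(\<lambda>n. (F (x + (1 / real (Suc n)) *\<^sub>R e) - F x) / (1 / real (Suc n))) \<longlonglongrightarrow> D j x"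
      by (rule filterlim_compose)
    then show ?thesis unfolding q_def by (simp add: divide_inverse del: of_nat_Suc)
  qed
  have "(\<lambda>n. \<integral>x. q n x \<partial>lborel) \<longlonglongrightarrow> (\<integral>x. D j x \<partial>lborel)"
  proof (rule integral_dominated_convergence[where w="\<lambda>x. indicator (cball 0 (R + 1)) x *\<^sub>R B"])
    show "integrable lborel (\<lambda>x::real^'n. indicator (cball 0 (R + 1)) x *\<^sub>R B)"
      by (intro borel_integrable_compact) auto
    show "q n \<in> borel_measurable lborel" for n unfolding q_def by measurable
  qed (use lim qb in auto)
  moreover have "(\<integral>x. q n x \<partial>lborel) = 0" for n
  proof -
    have i: "integrable lborel (\<lambda>x. F (x + (1 / real (Suc n)) *\<^sub>R e))"
    proof -
      have "integrable (distr lborel borel ((+) ((1 / real (Suc n)) *\<^sub>R e))) F"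
        using iF by (simp only: lborel_distr_plus)
      then show ?thesis by (subst (asm) integrable_distr_eq) (auto simp: add.commute)
    qed
    show ?thesis unfolding q_def using i iF
      by (simp add: lborel_integral_translate del: of_nat_Suc)
  qed
  ultimately show ?thesis by (simp add: LIMSEQ_const_iff)
qed

text \<open>A function on \<open>\<Omega>\<close> with compact support in \<open>\<Omega>\<close> extends by zero to the whole space without losing
regularity, because \<open>\<Omega>\<close> and the complement of the support are open and cover everything.\<close>

lemma integral_partial_eq_0:
  fixes F :: "real^'n::finite \<Rightarrow> real"
  assumes F: "C1_partials \<Omega> F D" and \<Omega>: "open \<Omega>" and K: "compact K" "K \<subseteq> \<Omega>"
    and 0: "\<And>x. x \<in> \<Omega> - K \<Longrightarrow> F x = 0"
  shows "integrable (lebesgue_on \<Omega>) (D j)" "(\<integral>x. D j x \<partial>lebesgue_on \<Omega>) = 0"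
proof -
  have oK: "open (- K)" using K by (simp add: compact_imp_closed open_Compl)
  have D0: "D i x = 0" if "x \<in> \<Omega> - K" for i x
  proof -
    have "(F has_derivative (\<lambda>h. 0)) (at x)"
    proof (rule has_derivative_transform_within_open[where f="\<lambda>x. 0" and s="\<Omega> - K"])
      show "open (\<Omega> - K)" using \<Omega> K by (simp add: compact_imp_closed open_Diff)
      show "0 = F y" if "y \<in> \<Omega> - K" for y using 0[OF that] by simp
    qed (fact that has_derivative_const)+
    from has_derivative_unique[OF this C1_partialsD(1)[OF F DiffD1[OF that]]]
    have "(\<Sum>j\<in>UNIV. axis i 1 $ j *\<^sub>R D j x) = 0" by (auto dest: fun_cong[where x="axis i 1"])
    moreover have "(\<Sum>j\<in>UNIV. axis i 1 $ j *\<^sub>R D j x) = (\<Sum>j\<in>UNIV. if j = i then D i x else 0)"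
      by (intro sum.cong) (auto simp: axis_def)
    ultimately show ?thesis by simp
  qed
  show "integrable (lebesgue_on \<Omega>) (D j)"
    by (rule integrable_compact_support[OF \<Omega> K]) (use C1_partialsD[OF F] D0 in auto)
  define F' where "F' x = (if x \<in> \<Omega> then F x else 0)" for x
  define D' where "D' i x = (if x \<in> \<Omega> then D i x else 0)" for i x
  have UN: "\<Omega> \<union> - K = UNIV" using K by auto
  have "C1_partials \<Omega> F' D'"
    by (rule C1_partials_cong[OF F \<Omega>]) (auto simp: F'_def D'_def)
  moreover have "C1_partials (- K) F' D'"
    by (rule C1_partials_cong[OF C1_partials_const oK, of 0])
       (use 0 D0 in \<open>auto simp: F'_def D'_def\<close>)
  ultimately have "C1_partials (\<Omega> \<union> - K) F' D'"
    unfolding C1_partials_def using \<Omega> oK continuous_on_open_Un by blast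
  then have C: "C1_partials UNIV F' D'" unfolding UN .
  have "(\<integral>x. D' j x \<partial>lborel) = 0"
    by (rule integral_partial_eq_0_UNIV[OF C K(1)]) (use 0 D0 in \<open>auto simp: F'_def D'_def\<close>)
  moreover have "D' j \<in> borel_measurable borel"
    using C1_partialsD(2)[OF C] by (intro borel_measurable_continuous_onI)
  ultimately have "(\<integral>x. D' j x \<partial>lebesgue) = 0"
    by (subst integral_completion) auto
  then show "(\<integral>x. D j x \<partial>lebesgue_on \<Omega>) = 0"
    unfolding D'_def using \<Omega> by (simp add: Lebesgue_Measure.integral_restrict_UNIV)
qed


text \<open>Two applications of the mean value theorem, first in direction \<open>k\<close> and then in direction \<open>j\<close>. The
second difference is symmetric in \<open>j\<close> and \<open>k\<close>, and this forces the mixed partial derivatives to agree.\<close>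

lemma second_difference_mvt:
  fixes u :: "real^'n::finite \<Rightarrow> real"
  assumes u: "C1_partials UNIV u D" and D: "C1_partials UNIV (D k) E" and h: "h > 0"
  obtains p where "norm (p - x) \<le> 2 * h"
    "u (x + h *\<^sub>R axis j 1 + h *\<^sub>R axis k 1) - u (x + h *\<^sub>R axis j 1) - u (x + h *\<^sub>R axis k 1) + u x
      = h * (h * E j p)"
proof -
  have "\<exists>s>0. s < h \<and> (u ((x + h *\<^sub>R axis j 1) + h *\<^sub>R axis k 1) - u (x + h *\<^sub>R axis k 1))
      - (u ((x + h *\<^sub>R axis j 1) + 0 *\<^sub>R axis k 1) - u (x + 0 *\<^sub>R axis k 1))
      = (h - 0) * (D k ((x + h *\<^sub>R axis j 1) + s *\<^sub>R axis k 1) - D k (x + s *\<^sub>R axis k 1))"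
    by (rule MVT2[OF h]) (intro DERIV_diff C1_partials_line[OF u])
  then obtain s where s: "0 < s" "s < h" and
    1: "u (x + h *\<^sub>R axis j 1 + h *\<^sub>R axis k 1) - u (x + h *\<^sub>R axis j 1) - u (x + h *\<^sub>R axis k 1) + u x
      = h * (D k (x + s *\<^sub>R axis k 1 + h *\<^sub>R axis j 1) - D k (x + s *\<^sub>R axis k 1))"
    by (auto simp: algebra_simps)
  have "\<exists>r>0. r < h \<and> D k ((x + s *\<^sub>R axis k 1) + h *\<^sub>R axis j 1) - D k ((x + s *\<^sub>R axis k 1) + 0 *\<^sub>R axis j 1)
      = (h - 0) * E j ((x + s *\<^sub>R axis k 1) + r *\<^sub>R axis j 1)"
    by (rule MVT2[OF h]) (intro C1_partials_line[OF D])
  then obtain r where r: "0 < r" "r < h" and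
    2: "D k (x + s *\<^sub>R axis k 1 + h *\<^sub>R axis j 1) - D k (x + s *\<^sub>R axis k 1)
       = h * E j (x + s *\<^sub>R axis k 1 + r *\<^sub>R axis j 1)" by auto
  show ?thesis
  proof (rule that)
    have "norm (s *\<^sub>R axis k (1::real) + r *\<^sub>R axis j 1) \<le> s + r"
      by (rule order_trans[OF norm_triangle_ineq]) (use r s in simp)
    then show "norm ((x + s *\<^sub>R axis k 1 + r *\<^sub>R axis j 1) - x) \<le> 2 * h"
      using r s by (simp add: add.assoc)
  qed (use 1 2 in simp)
qed

lemma mixed_partials_eq_real:
  fixes u :: "real^'n::finite \<Rightarrow> real"
  assumes u: "C1_partials UNIV u D" and D: "\<And>k. C1_partials UNIV (D k) (\<lambda>j. E j k)"
  shows "E j k x = E k j x"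
proof -
  have "\<exists>p q. norm (p - x) \<le> 2 / Suc n \<and> norm (q - x) \<le> 2 / Suc n \<and> E j k p = E k j q" for n :: nat
  proof -
    have h: "1 / real (Suc n) > 0" by simp
    obtain p where p: "norm (p - x) \<le> 2 * (1 / real (Suc n))"
      "u (x + (1 / real (Suc n)) *\<^sub>R axis j 1 + (1 / real (Suc n)) *\<^sub>R axis k 1)
        - u (x + (1 / real (Suc n)) *\<^sub>R axis j 1) - u (x + (1 / real (Suc n)) *\<^sub>R axis k 1) + u x
        = (1 / real (Suc n)) * ((1 / real (Suc n)) * E j k p)"
      by (rule second_difference_mvt[OF u D h])
    obtain q where q: "norm (q - x) \<le> 2 * (1 / real (Suc n))"
      "u (x + (1 / real (Suc n)) *\<^sub>R axis k 1 + (1 / real (Suc n)) *\<^sub>R axis j 1)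
        - u (x + (1 / real (Suc n)) *\<^sub>R axis k 1) - u (x + (1 / real (Suc n)) *\<^sub>R axis j 1) + u x
        = (1 / real (Suc n)) * ((1 / real (Suc n)) * E k j q)"
      by (rule second_difference_mvt[OF u D h])
    have c: "x + (1 / real (Suc n)) *\<^sub>R axis j 1 + (1 / real (Suc n)) *\<^sub>R axis k 1
        = x + (1 / real (Suc n)) *\<^sub>R axis k 1 + (1 / real (Suc n)) *\<^sub>R axis j 1"
      by (simp add: add_ac)
    with p(2) q(2)[folded c] have "(1 / real (Suc n)) * ((1 / real (Suc n)) * E j k p)
       = (1 / real (Suc n)) * ((1 / real (Suc n)) * E k j q)" by linarith
    then have "E j k p = E k j q" by simp
    with p(1) q(1) show ?thesis by (intro exI[of _ p] exI[of _ q]) simp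
  qed
  then obtain p q where pq: "\<And>n. norm (p n - x) \<le> 2 / real (Suc n)" "\<And>n. norm (q n - x) \<le> 2 / real (Suc n)"
    "\<And>n. E j k (p n) = E k j (q n)" by metis
  have l: "(\<lambda>n. 2 / real (Suc n)) \<longlonglongrightarrow> 0"
    using tendsto_mult_right_zero[OF LIMSEQ_Suc[OF lim_1_over_n], of 2] by simp
  have "(\<lambda>n. p n - x) \<longlonglongrightarrow> 0" "(\<lambda>n. q n - x) \<longlonglongrightarrow> 0"
    using pq(1,2) by (auto intro!: Lim_null_comparison[OF _ l] always_eventually simp del: of_nat_Suc)
  then have "p \<longlonglongrightarrow> x" "q \<longlonglongrightarrow> x"
    by (auto dest: LIM_zero_cancel)
  moreover have "isCont (E j k) x" "isCont (E k j) x"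
    using C1_partialsD(2)[OF D] by (simp_all add: continuous_on_eq_continuous_at)
  ultimately have "(\<lambda>n. E j k (p n)) \<longlonglongrightarrow> E j k x" "(\<lambda>n. E k j (q n)) \<longlonglongrightarrow> E k j x"
    by (auto intro: isCont_tendsto_compose)
  then show ?thesis unfolding pq using LIMSEQ_unique by blast
qed

lemma mixed_partials_eq:
  fixes u :: "real^'n::finite \<Rightarrow> 'b::euclidean_space"
  assumes u: "C1_partials UNIV u D" and D: "\<And>k. C1_partials UNIV (D k) (\<lambda>j. E j k)"
  shows "E j k x = E k j x"
proof (rule euclidean_eqI)
  fix b :: 'b assume "b \<in> Basis"
  show "E j k x \<bullet> b = E k j x \<bullet> b"
    by (rule mixed_partials_eq_real[of "\<lambda>x. u x \<bullet> b" "\<lambda>j x. D j x \<bullet> b" "\<lambda>j k x. E j k x \<bullet> b"])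
       (intro C1_partials_linear[OF bounded_linear_inner_left] u D)+
qed

section \<open>Left multiplication by Clifford vectors\<close>

lemma bounded_linear_cl_gen_mult: "bounded_linear (\<lambda>x. cl_gen j \<odot> x)"
  using bilinear_cl_mult unfolding bilinear_def linear_conv_bounded_linear by blast

lemmas cl_gen_add = linear_add[OF bounded_linear.linear[OF bounded_linear_cl_gen_mult]]
lemmas cl_gen_scaleR = linear_scale[OF bounded_linear.linear[OF bounded_linear_cl_gen_mult]]
lemmas cl_gen_sum = linear_sum[OF bounded_linear.linear[OF bounded_linear_cl_gen_mult]]

lemma cl_gen_mult_nth:
  "(cl_gen j \<odot> x) $ C = cl_sign {j} (sym_diff {j} C) * x $ sym_diff {j} C"
proof -
  have "(cl_gen j \<odot> x) $ C =
    (\<Sum>A\<in>UNIV. \<Sum>B\<in>UNIV. if A = {j} then (if B = sym_diff {j} C then cl_sign {j} B * x $ B else 0) else 0)"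
    unfolding cl_mult_def sum_component
    by (intro sum.cong refl) (auto simp: cl_gen_def cl_basis_def axis_def)
  also have "\<dots> = (\<Sum>A\<in>UNIV. if A = {j} then cl_sign {j} (sym_diff {j} C) * x $ sym_diff {j} C else 0)"
    by (intro sum.cong refl) simp
  finally show ?thesis by simp
qed

text \<open>Multiplication by \<open>e\<^sub>j\<close> permutes the basis up to sign by the involution \<open>C \<mapsto> {j} \<triangle> C\<close>, and
\<open>e\<^sub>j\<^sup>2 = -1\<close> makes the signs at the two ends of each pair opposite.\<close>

lemma cl_gen_skew: "(cl_gen j \<odot> x) \<bullet> y = - (x \<bullet> (cl_gen j \<odot> y))"
proof -
  have s: "cl_sign {j} (sym_diff {j} C) = - cl_sign {j} C" for C
    unfolding cl_sign_sym_diff_right by (simp add: cl_sign_def)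
  have inv: "sym_diff {j} (sym_diff {j} C) = C" for C by auto
  have "(cl_gen j \<odot> x) \<bullet> y = (\<Sum>C\<in>UNIV. cl_sign {j} (sym_diff {j} C) * x $ sym_diff {j} C * y $ C)"
    by (simp add: inner_vec_def cl_gen_mult_nth)
  also have "\<dots> = (\<Sum>C\<in>UNIV. cl_sign {j} C * x $ C * y $ sym_diff {j} C)"
    by (rule sum.reindex_bij_witness[of _ "sym_diff {j}" "sym_diff {j}"]) (simp_all only: inv UNIV_I)
  also have "\<dots> = - (x \<bullet> (cl_gen j \<odot> y))"
    by (simp add: inner_vec_def cl_gen_mult_nth s sum_negf[symmetric] mult_ac)
  finally show ?thesis .
qed

lemma cl_gen_square_mult: "cl_gen j \<odot> (cl_gen j \<odot> x) = - x"
  by (simp add: cl_mult_assoc[symmetric] cl_gen_square bilinear_lneg[OF bilinear_cl_mult] cl_mult_one_left)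

lemma cl_gen_anticommute_mult:
  assumes "j \<noteq> k"
  shows "cl_gen j \<odot> (cl_gen k \<odot> x) = - (cl_gen k \<odot> (cl_gen j \<odot> x))"
proof -
  have "cl_gen j \<odot> cl_gen k = - (cl_gen k \<odot> cl_gen j)"
    using cl_gen_anticommute[OF assms] by (simp add: eq_neg_iff_add_eq_0)
  then show ?thesis by (simp add: cl_mult_assoc[symmetric] bilinear_lneg[OF bilinear_cl_mult])
qed

lemma cl_gen_inner_cl_gen: "(cl_gen j \<odot> x) \<bullet> (cl_gen k \<odot> y) = - (x \<bullet> (cl_gen j \<odot> (cl_gen k \<odot> y)))"
  by (rule cl_gen_skew)

lemma norm_cl_gen_mult: "norm (cl_gen j \<odot> x) = norm x"
  by (simp add: norm_eq_sqrt_inner cl_gen_inner_cl_gen cl_gen_square_mult)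

abbreviation cl_pair :: "'n::{finite,linorder} \<Rightarrow> 'n \<Rightarrow> 'n clifford \<Rightarrow> 'n clifford" where
  "cl_pair j k w \<equiv> cl_gen j \<odot> (cl_gen k \<odot> w)"

text \<open>Skewness of the bivectors \<open>e\<^sub>j e\<^sub>k\<close> is what lets terms quadratic in first derivatives be integrated
by parts.\<close>

lemma cl_pair_skew:
  assumes "j \<noteq> k"
  shows "(cl_pair j k x) \<bullet> y = - (x \<bullet> (cl_pair j k y))"
  by (simp add: cl_gen_skew cl_gen_anticommute_mult[OF assms, of y])

definition vec_mult :: "('n::{finite,linorder} \<Rightarrow> real) \<Rightarrow> 'n clifford \<Rightarrow> 'n clifford" where
  "vec_mult y w = (\<Sum>j\<in>UNIV. y j *\<^sub>R (cl_gen j \<odot> w))"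

lemma sum_pair_antisym:
  fixes s :: "'n::finite \<Rightarrow> 'n \<Rightarrow> real"
  assumes "\<And>j k. j \<noteq> k \<Longrightarrow> s j k = - s k j"
  shows "(\<Sum>j\<in>UNIV. \<Sum>k\<in>-{j}. s j k) = 0"
proof -
  define t where "t j k = (if j \<noteq> k then s j k else 0)" for j k
  have eq: "(\<Sum>k\<in>-{j}. s j k) = (\<Sum>k\<in>UNIV. t j k)" for j
    by (rule sum.mono_neutral_cong_left) (auto simp: t_def)
  have t: "t j k = - t k j" for j k
    by (cases "j = k") (simp_all add: t_def assms[of j k])
  have "(\<Sum>j\<in>UNIV. \<Sum>k\<in>UNIV. t j k) = (\<Sum>k\<in>UNIV. \<Sum>j\<in>UNIV. t j k)"
    by (rule sum.swap)
  also have "\<dots> = (\<Sum>k\<in>UNIV. \<Sum>j\<in>UNIV. - t k j)"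
    by (intro sum.cong refl) (rule t)
  also have "\<dots> = - (\<Sum>k\<in>UNIV. \<Sum>j\<in>UNIV. t k j)"
    by (simp add: sum_negf)
  finally show ?thesis unfolding eq by simp
qed

text \<open>The mixed terms are antisymmetric in the two indices.\<close>

lemma norm_vec_mult: "(norm (vec_mult y w))\<^sup>2 = (\<Sum>j\<in>UNIV. (y j)\<^sup>2) * (norm w)\<^sup>2"
proof -
  have "(norm (vec_mult y w))\<^sup>2 = (\<Sum>j\<in>UNIV. \<Sum>k\<in>UNIV. y j * y k * ((cl_gen j \<odot> w) \<bullet> (cl_gen k \<odot> w)))"
    by (simp add: vec_mult_def power2_norm_eq_inner inner_sum_left inner_sum_right sum_distrib_left
        mult_ac inner_commute)
  also have "\<dots> = (\<Sum>j\<in>UNIV. (y j)\<^sup>2 * (norm w)\<^sup>2 + (\<Sum>k\<in>-{j}. y j * y k * ((cl_gen j \<odot> w) \<bullet> (cl_gen k \<odot> w))))"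
  proof (rule sum.cong[OF refl])
    fix j
    have "y j * y j * ((cl_gen j \<odot> w) \<bullet> (cl_gen j \<odot> w)) = (y j)\<^sup>2 * (norm w)\<^sup>2"
      by (simp add: power2_norm_eq_inner[symmetric] norm_cl_gen_mult power2_eq_square)
    then show "(\<Sum>k\<in>UNIV. y j * y k * ((cl_gen j \<odot> w) \<bullet> (cl_gen k \<odot> w)))
        = (y j)\<^sup>2 * (norm w)\<^sup>2 + (\<Sum>k\<in>-{j}. y j * y k * ((cl_gen j \<odot> w) \<bullet> (cl_gen k \<odot> w)))"
      by (simp add: sum.remove[of UNIV j] Compl_eq_Diff_UNIV)
  qed
  finally have "(norm (vec_mult y w))\<^sup>2 = \<dots>" .
  moreover have "(\<Sum>j\<in>UNIV. \<Sum>k\<in>-{j}. y j * y k * ((cl_gen j \<odot> w) \<bullet> (cl_gen k \<odot> w))) = 0"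
  proof (rule sum_pair_antisym)
    fix j k :: 'a assume "j \<noteq> k"
    then have "(cl_gen j \<odot> w) \<bullet> (cl_gen k \<odot> w) = - ((cl_gen k \<odot> w) \<bullet> (cl_gen j \<odot> w))"
      by (simp add: cl_gen_inner_cl_gen cl_gen_anticommute_mult[of j k w])
    then show "y j * y k * ((cl_gen j \<odot> w) \<bullet> (cl_gen k \<odot> w)) = - (y k * y j * ((cl_gen k \<odot> w) \<bullet> (cl_gen j \<odot> w)))"
      by simp
  qed
  ultimately show ?thesis by (simp add: sum.distrib sum_distrib_right)
qed


text \<open>The bivector part of the product of the vector \<open>y\<close> with the gradient \<open>d\<close>; for \<open>y = x\<close> this is the
angular part of the Dirac operator.\<close>

definition spin_part ::
    "('n::{finite,linorder} \<Rightarrow> real) \<Rightarrow> ('n \<Rightarrow> 'n clifford) \<Rightarrow> 'n clifford" where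
  "spin_part y d = (\<Sum>j\<in>UNIV. \<Sum>k\<in>-{j}. y j *\<^sub>R (cl_pair j k (d k)))"

lemma vec_mult_dirac:
  "vec_mult y (\<Sum>k\<in>UNIV. cl_gen k \<odot> d k) = spin_part y d - (\<Sum>j\<in>UNIV. y j *\<^sub>R d j)"
proof -
  have "vec_mult y (\<Sum>k\<in>UNIV. cl_gen k \<odot> d k)
      = (\<Sum>j\<in>UNIV. \<Sum>k\<in>UNIV. y j *\<^sub>R (cl_pair j k (d k)))"
    by (simp add: vec_mult_def cl_gen_sum scaleR_sum_right)
  also have "\<dots> = (\<Sum>j\<in>UNIV. y j *\<^sub>R (cl_pair j j (d j)) +
      (\<Sum>k\<in>-{j}. y j *\<^sub>R (cl_pair j k (d k))))"
    by (intro sum.cong refl, subst sum.remove[of UNIV]) (auto simp: Compl_eq_Diff_UNIV)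
  also have "\<dots> = spin_part y d - (\<Sum>j\<in>UNIV. y j *\<^sub>R d j)"
    by (simp add: cl_gen_square_mult spin_part_def sum_subtractf)
  finally show ?thesis .
qed

text \<open>From \<open>y Dv = S - \<partial>\<^sub>y v\<close> the terms \<open>4|\<partial>\<^sub>y v|\<^sup>2\<close> cancel when the square is expanded, so the coefficient
\<open>2\<close> in front of \<open>\<partial>\<^sub>y v\<close> leaves only the mixed term \<open>4\<langle>S, \<partial>\<^sub>y v\<rangle>\<close> in second order.\<close>

lemma completed_square:
  fixes y :: "'n::{finite,linorder} \<Rightarrow> real" and d :: "'n \<Rightarrow> 'n clifford"
  defines "Dv \<equiv> (\<Sum>k\<in>UNIV. cl_gen k \<odot> d k)" and "dy \<equiv> (\<Sum>j\<in>UNIV. y j *\<^sub>R d j)"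
  shows "(norm (vec_mult y Dv + 2 *\<^sub>R dy + b *\<^sub>R v))\<^sup>2 =
    (\<Sum>j\<in>UNIV. (y j)\<^sup>2) * (norm Dv)\<^sup>2 + 4 * (spin_part y d \<bullet> dy) + b\<^sup>2 * (norm v)\<^sup>2
      + 2 * b * (dy \<bullet> v) + 2 * b * (spin_part y d \<bullet> v)"
proof -
  define S where "S = spin_part y d"
  have V: "vec_mult y Dv = S - dy" unfolding Dv_def dy_def S_def by (rule vec_mult_dirac)
  have "(norm (vec_mult y Dv))\<^sup>2 = (\<Sum>j\<in>UNIV. (y j)\<^sup>2) * (norm Dv)\<^sup>2" by (rule norm_vec_mult)
  then have "(\<Sum>j\<in>UNIV. (y j)\<^sup>2) * (norm Dv)\<^sup>2 = S \<bullet> S - 2 * (S \<bullet> dy) + dy \<bullet> dy"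
    unfolding V by (simp add: power2_norm_eq_inner algebra_simps inner_commute)
  then show ?thesis unfolding V S_def[symmetric]
    by (simp only: power2_norm_eq_inner) (simp add: algebra_simps inner_commute power2_eq_square)
qed

text \<open>The algebra behind the weighted identity at one point. Here \<open>d\<close> stands for the gradient of \<open>v\<close>, \<open>\<mu> y\<close>
for the gradient of \<open>g\<close>, \<open>a\<^sub>j\<close> for \<open>\<partial>\<^sub>j y\<^sub>j\<close> and \<open>b\<close> for the gradient of \<open>\<beta>\<close>; consequently \<open>Gd l j i\<close> is
\<open>\<partial>\<^sub>i (g y\<^sub>l y\<^sub>j)\<close> and \<open>Bd l i\<close> is \<open>\<partial>\<^sub>i (g \<beta> y\<^sub>l)\<close>. Every summand on the right is an integrand with vanishing
integral: the first kind by \<open>spin_pair_by_parts\<close>, the second by \<open>square_by_parts\<close>. The hypothesis on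
\<open>\<beta>\<close> is \<open>g \<beta> = div (g y)\<close>.\<close>

lemma dirac_identity_pointwise:
  fixes y a b :: "'n::{finite,linorder} \<Rightarrow> real" and d :: "'n \<Rightarrow> 'n clifford" and v :: "'n clifford"
    and g \<mu> \<beta> :: real
  defines "Dv \<equiv> (\<Sum>k\<in>UNIV. cl_gen k \<odot> d k)" and "dy \<equiv> (\<Sum>j\<in>UNIV. y j *\<^sub>R d j)"
  defines "Gd \<equiv> (\<lambda>l j i. \<mu> * y i * y l * y j + g * (if i = l then a l else 0) * y j
      + g * y l * (if i = j then a j else 0))"
    and "Bd \<equiv> (\<lambda>l i. \<mu> * y i * \<beta> * y l + g * b i * y l + g * \<beta> * (if i = l then a l else 0))"
  assumes \<beta>: "g * \<beta> = \<mu> * (\<Sum>j\<in>UNIV. (y j)\<^sup>2) + g * (\<Sum>j\<in>UNIV. a j)"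
  shows "g * (\<Sum>j\<in>UNIV. (y j)\<^sup>2) * (norm Dv)\<^sup>2
      - g * (norm (vec_mult y Dv + 2 *\<^sub>R dy + \<beta> *\<^sub>R v))\<^sup>2
      - g * (\<Sum>j\<in>UNIV. b j * y j) * (norm v)\<^sup>2
      + 2 * g * (\<Sum>j\<in>UNIV. \<Sum>k\<in>-{j}. (a k - a j) * y j * (v \<bullet> (cl_pair j k (d k))))
    = - 2 * (\<Sum>j\<in>UNIV. \<Sum>k\<in>-{j}. \<Sum>l\<in>UNIV.
          2 * (g * y l * y j) * (d l \<bullet> (cl_pair j k (d k)))
          + Gd l j l * (v \<bullet> (cl_pair j k (d k)))
          - Gd l j k * (v \<bullet> (cl_pair j k (d l))))
      - (\<Sum>l\<in>UNIV. 2 * (g * \<beta> * y l) * (d l \<bullet> v) + Bd l l * (norm v)\<^sup>2)"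
proof -
  define Y where "Y = (\<Sum>j\<in>UNIV. (y j)\<^sup>2)"
  define T where "T = (\<Sum>j\<in>UNIV. a j)"
  define S where "S = spin_part y d"
  define e where "e j k w = cl_pair j k w" for j k and w :: "'n clifford"
  have e_sum: "e j k (sum f A) = (\<Sum>i\<in>A. e j k (f i))" for j k A and f :: "'n \<Rightarrow> 'n clifford"
    by (simp add: e_def cl_gen_sum)
  have e_scale: "e j k (r *\<^sub>R w) = r *\<^sub>R e j k w" for j k r w
    by (simp add: e_def cl_gen_scaleR)
  have S: "S \<bullet> w = (\<Sum>j\<in>UNIV. \<Sum>k\<in>-{j}. y j * (w \<bullet> e j k (d k)))" for w
    by (simp add: S_def spin_part_def inner_sum_left inner_sum_right e_def inner_commute)
  have inner: "(\<Sum>l\<in>UNIV. 2 * (g * y l * y j) * (d l \<bullet> e j k (d k))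
          + Gd l j l * (v \<bullet> e j k (d k)) - Gd l j k * (v \<bullet> e j k (d l)))
      = 2 * g * (y j * (dy \<bullet> e j k (d k))) + g * \<beta> * (y j * (v \<bullet> e j k (d k)))
        - g * ((a k - a j) * y j * (v \<bullet> e j k (d k))) - \<mu> * (y k * y j * (v \<bullet> e j k dy))"
    if "k \<noteq> j" for j k
  proof -
    have 1: "(\<Sum>l\<in>UNIV. 2 * (g * y l * y j) * (d l \<bullet> e j k (d k))) = 2 * g * (y j * (dy \<bullet> e j k (d k)))"
      by (simp add: dy_def inner_sum_left sum_distrib_left mult_ac)
    have "(\<Sum>l\<in>UNIV. Gd l j l) = (\<mu> * Y + g * T) * y j + g * a j * y j"
    proof -
      have "(\<Sum>l\<in>UNIV. Gd l j l) = (\<Sum>l\<in>UNIV. \<mu> * (y l)\<^sup>2 * y j) + (\<Sum>l\<in>UNIV. g * a l * y j)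
          + (\<Sum>l\<in>UNIV. if l = j then g * y j * a j else 0)"
        unfolding Gd_def sum.distrib[symmetric]
        by (intro sum.cong refl) (simp add: power2_eq_square)
      then show ?thesis
        by (simp add: Y_def T_def sum_distrib_left sum_distrib_right algebra_simps)
    qed
    also have "\<dots> = (g * \<beta> + g * a j) * y j"
      by (simp only: \<beta> Y_def T_def distrib_right)
    finally have 2: "(\<Sum>l\<in>UNIV. Gd l j l * (v \<bullet> e j k (d k))) = (g * \<beta> + g * a j) * y j * (v \<bullet> e j k (d k))"
      by (simp only: sum_distrib_right[symmetric])
    have "(\<Sum>l\<in>UNIV. Gd l j k * (v \<bullet> e j k (d l)))
        = (\<Sum>l\<in>UNIV. \<mu> * (y k * y j) * (y l * (v \<bullet> e j k (d l))))
          + (\<Sum>l\<in>UNIV. if l = k then g * a k * y j * (v \<bullet> e j k (d k)) else 0)"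
      unfolding sum.distrib[symmetric]
      by (intro sum.cong refl) (use that in \<open>auto simp: Gd_def algebra_simps\<close>)
    also have "(\<Sum>l\<in>UNIV. \<mu> * (y k * y j) * (y l * (v \<bullet> e j k (d l)))) = \<mu> * (y k * y j * (v \<bullet> e j k dy))"
      by (simp add: dy_def e_sum e_scale inner_sum_right sum_distrib_left mult_ac)
    finally have 3: "(\<Sum>l\<in>UNIV. Gd l j k * (v \<bullet> e j k (d l)))
        = \<mu> * (y k * y j * (v \<bullet> e j k dy)) + g * a k * y j * (v \<bullet> e j k (d k))" by simp
    show ?thesis unfolding sum.distrib sum_subtractf 1 2 3 by (simp add: algebra_simps)
  qed
  \<comment> \<open>The gradient of \<open>g\<close> is parallel to \<open>y\<close>, so its contribution is antisymmetric.\<close>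
  have anti: "(\<Sum>j\<in>UNIV. \<Sum>k\<in>-{j}. y k * y j * (v \<bullet> e j k dy)) = 0"
  proof (rule sum_pair_antisym)
    fix j k :: 'n assume "j \<noteq> k"
    then have "e j k dy = - e k j dy" unfolding e_def by (rule cl_gen_anticommute_mult)
    then show "y k * y j * (v \<bullet> e j k dy) = - (y j * y k * (v \<bullet> e k j dy))"
      by simp
  qed
  have sum1: "(\<Sum>j\<in>UNIV. \<Sum>k\<in>-{j}. \<Sum>l\<in>UNIV. 2 * (g * y l * y j) * (d l \<bullet> e j k (d k))
          + Gd l j l * (v \<bullet> e j k (d k)) - Gd l j k * (v \<bullet> e j k (d l)))
      = 2 * g * (S \<bullet> dy) + g * \<beta> * (S \<bullet> v)
        - g * (\<Sum>j\<in>UNIV. \<Sum>k\<in>-{j}. (a k - a j) * y j * (v \<bullet> e j k (d k)))" (is "?L = _")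
  proof -
    have "?L = (\<Sum>j\<in>UNIV. \<Sum>k\<in>-{j}. 2 * g * (y j * (dy \<bullet> e j k (d k))) + g * \<beta> * (y j * (v \<bullet> e j k (d k)))
        - g * ((a k - a j) * y j * (v \<bullet> e j k (d k))) - \<mu> * (y k * y j * (v \<bullet> e j k dy)))"
      by (intro sum.cong refl) (rule inner, simp)
    then show ?thesis
      unfolding sum.distrib sum_subtractf sum_distrib_left[symmetric] anti S by simp
  qed
  have sum2: "(\<Sum>l\<in>UNIV. 2 * (g * \<beta> * y l) * (d l \<bullet> v) + Bd l l * (norm v)\<^sup>2)
      = 2 * g * \<beta> * (dy \<bullet> v) + (g * \<beta>\<^sup>2 + g * (\<Sum>j\<in>UNIV. b j * y j)) * (norm v)\<^sup>2"
  proof -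
    have "(\<Sum>l\<in>UNIV. Bd l l) = (\<Sum>l\<in>UNIV. \<beta> * (\<mu> * (y l)\<^sup>2)) + (\<Sum>l\<in>UNIV. g * (b l * y l)) + (\<Sum>l\<in>UNIV. \<beta> * (g * a l))"
      unfolding Bd_def sum.distrib[symmetric]
      by (intro sum.cong refl) (simp add: power2_eq_square algebra_simps)
    also have "\<dots> = \<beta> * (\<mu> * Y + g * T) + g * (\<Sum>j\<in>UNIV. b j * y j)"
      by (simp add: Y_def T_def sum_distrib_left algebra_simps)
    also have "\<dots> = g * \<beta>\<^sup>2 + g * (\<Sum>j\<in>UNIV. b j * y j)"
      using \<beta> by (simp add: Y_def T_def power2_eq_square)
    finally show ?thesis
      by (simp add: sum.distrib sum_distrib_right[symmetric] dy_def inner_sum_left sum_distrib_left mult_ac)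
  qed
  show ?thesis
    unfolding e_def[symmetric] sum1 sum2 completed_square[of y d \<beta> v, folded Dv_def dy_def, folded S_def]
    by (simp add: algebra_simps)
qed

section \<open>The weighted identity for the Dirac operator\<close>

lemma C_diff_SucD: "C_diff (Suc k) v \<Longrightarrow> C_diff k v"
proof (induction k arbitrary: v)
  case 0
  then show ?case by (simp add: differentiable_imp_continuous_on)
next
  case (Suc k)
  then show ?case by simp
qed

lemma smooth_partial: "\<forall>k. C_diff k v \<Longrightarrow> \<forall>k. C_diff k (partial_deriv j v)"
  by (metis C_diff.simps(2))

lemma smooth_C1_partials:
  assumes "\<forall>k. C_diff k v"
  shows "C1_partials UNIV v (\<lambda>j. partial_deriv j v)"
proof -
  have "(v has_derivative (\<lambda>h. \<Sum>j\<in>UNIV. h $ j *\<^sub>R partial_deriv j v x)) (at x)" for x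
  proof -
    have "v differentiable (at x)"
      using assms[rule_format, of "Suc 0"] by (simp add: differentiable_on_def)
    then have d: "(v has_derivative frechet_derivative v (at x)) (at x)"
      by (simp add: frechet_derivative_works)
    then interpret bounded_linear "frechet_derivative v (at x)" by (rule has_derivative_bounded_linear)
    have "frechet_derivative v (at x) h = (\<Sum>j\<in>UNIV. h $ j *\<^sub>R partial_deriv j v x)" for h
    proof -
      have "h = (\<Sum>j\<in>UNIV. h $ j *\<^sub>R axis j 1)"
        by (simp only: scalar_mult_eq_scaleR[symmetric] basis_expansion)
      then have "frechet_derivative v (at x) h = frechet_derivative v (at x) (\<Sum>j\<in>UNIV. h $ j *\<^sub>R axis j 1)"
        by simp
      then show ?thesis by (simp add: sum scaleR partial_deriv_def)
    qed
    then have "frechet_derivative v (at x) = (\<lambda>h. \<Sum>j\<in>UNIV. h $ j *\<^sub>R partial_deriv j v x)" by blast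
    with d show ?thesis by simp
  qed
  moreover have "continuous_on UNIV (partial_deriv j v)" for j
    using smooth_partial[OF assms, of j] by (metis C_diff.simps(1))
  ultimately show ?thesis by (simp add: C1_partials_def)
qed

lemma partial_deriv_unique:
  assumes "(v has_derivative (\<lambda>h. \<Sum>j\<in>UNIV. h $ j *\<^sub>R D j)) (at x)"
  shows "partial_deriv i v x = D i"
proof -
  have "partial_deriv i v x = (\<Sum>j\<in>UNIV. axis i 1 $ j *\<^sub>R D j)"
    by (simp add: partial_deriv_def frechet_derivative_at[OF assms, symmetric])
  also have "\<dots> = (\<Sum>j\<in>UNIV. if j = i then D i else 0)"
    by (intro sum.cong) (auto simp: axis_def)
  finally show ?thesis by simp
qed

lemma test_functionsD:
  assumes "v \<in> test_functions \<Omega>"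
  shows "C1_partials UNIV v (\<lambda>j. partial_deriv j v)"
    and "C1_partials UNIV (partial_deriv k v) (\<lambda>j. partial_deriv j (partial_deriv k v))"
  using assms smooth_partial by (auto simp: test_functions_def intro!: smooth_C1_partials)

lemma test_functions_support:
  assumes "v \<in> test_functions \<Omega>"
  obtains K where "compact K" "K \<subseteq> \<Omega>" "\<And>x. x \<notin> K \<Longrightarrow> v x = 0"
    "\<And>x j. x \<notin> K \<Longrightarrow> partial_deriv j v x = 0"
proof
  define K where "K = closure {x. v x \<noteq> 0}"
  show "compact (closure {x. v x \<noteq> 0})" "closure {x. v x \<noteq> 0} \<subseteq> \<Omega>"
    using assms by (auto simp: test_functions_def)
  show 0: "v x = 0" if "x \<notin> closure {x. v x \<noteq> 0}" for x
    using that closure_subset[of "{x. v x \<noteq> 0}"] by auto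
  show "partial_deriv j v x = 0" if x: "x \<notin> closure {x. v x \<noteq> 0}" for x j
  proof (rule partial_deriv_unique)
    have "(v has_derivative (\<lambda>h. 0)) (at x)"
    proof (rule has_derivative_transform_within_open[where f="\<lambda>x. 0" and s="- closure {x. v x \<noteq> 0}"])
      show "0 = v z" if "z \<in> - closure {x. v x \<noteq> 0}" for z using 0[of z] that by simp
    qed (use x in auto)
    then show "(v has_derivative (\<lambda>h. \<Sum>j\<in>UNIV. h $ j *\<^sub>R 0)) (at x)" by simp
  qed
qed

lemma has_bochner_integral_partial_0:
  fixes F :: "real^'n::finite \<Rightarrow> real"
  assumes "C1_partials \<Omega> F D" "open \<Omega>" "compact K" "K \<subseteq> \<Omega>" "\<And>x. x \<in> \<Omega> - K \<Longrightarrow> F x = 0"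
  shows "has_bochner_integral (lebesgue_on \<Omega>) (D j) 0"
  using integral_partial_eq_0[OF assms] by (simp add: has_bochner_integral_iff)

text \<open>Integrating \<open>\<partial>\<^sub>l (G \<langle>v, e\<^sub>j e\<^sub>k \<partial>\<^sub>k v\<rangle>) - \<partial>\<^sub>k (G \<langle>v, e\<^sub>j e\<^sub>k \<partial>\<^sub>l v\<rangle>)\<close>: the second derivatives of \<open>v\<close> cancel by
symmetry, while by skewness of \<open>e\<^sub>j e\<^sub>k\<close> the two terms quadratic in first derivatives coincide.\<close>

lemma spin_pair_by_parts:
  fixes v :: "'n::{finite,linorder} point \<Rightarrow> 'n clifford"
  assumes v: "v \<in> test_functions \<Omega>" and \<Omega>: "open \<Omega>" and G: "C1_partials \<Omega> G \<gamma>" and jk: "j \<noteq> k"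
  shows "has_bochner_integral (lebesgue_on \<Omega>) (\<lambda>x.
      2 * G x * (partial_deriv l v x \<bullet> (cl_pair j k (partial_deriv k v x)))
      + \<gamma> l x * (v x \<bullet> (cl_pair j k (partial_deriv k v x)))
      - \<gamma> k x * (v x \<bullet> (cl_pair j k (partial_deriv l v x)))) 0"
proof -
  define e where "e w = cl_pair j k w" for w :: "'n clifford"
  have e: "bounded_linear e" unfolding e_def
    by (rule bounded_linear_compose[OF bounded_linear_cl_gen_mult bounded_linear_cl_gen_mult])
  have skew: "e a \<bullet> b = - (a \<bullet> e b)" for a b unfolding e_def by (rule cl_pair_skew[OF jk])
  obtain K where K: "compact K" "K \<subseteq> \<Omega>" and 0: "\<And>x. x \<notin> K \<Longrightarrow> v x = 0"
    using test_functions_support[OF v] by metis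
  note C1 = C1_partials_subset[OF test_functionsD(1)[OF v] subset_UNIV]
  note C2 = C1_partials_subset[OF test_functionsD(2)[OF v] subset_UNIV]
  define D where "D i m x = \<gamma> i x * (v x \<bullet> e (partial_deriv m v x)) + G x * (partial_deriv i v x \<bullet> e (partial_deriv m v x)
      + v x \<bullet> e (partial_deriv i (partial_deriv m v) x))" for i m x
  have null: "has_bochner_integral (lebesgue_on \<Omega>) (D i m) 0" for i m
  proof (rule has_bochner_integral_partial_0[OF _ \<Omega> K, where D="\<lambda>i. D i m"])
    show "C1_partials \<Omega> (\<lambda>x. G x * (v x \<bullet> e (partial_deriv m v x))) (\<lambda>i. D i m)"
      unfolding D_def
      by (intro C1_partials_mult[OF G] C1_partials_inner[OF C1] C1_partials_linear[OF e] C2)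
  qed (simp add: 0)
  have "has_bochner_integral (lebesgue_on \<Omega>) (\<lambda>x. D l k x - D k l x) (0 - 0)"
    by (rule has_bochner_integral_diff[OF null null])
  moreover have "partial_deriv l (partial_deriv k v) x = partial_deriv k (partial_deriv l v) x" for x
    by (rule mixed_partials_eq[OF test_functionsD(1)[OF v] test_functionsD(2)[OF v]])
  moreover have "partial_deriv k v x \<bullet> e (partial_deriv l v x) = - (partial_deriv l v x \<bullet> e (partial_deriv k v x))" for x
    using skew[of "partial_deriv k v x" "partial_deriv l v x"] by (simp add: inner_commute)
  ultimately show ?thesis
    unfolding D_def e_def[symmetric] by (simp add: algebra_simps)
qed

lemma square_by_parts:
  fixes v :: "'n::{finite,linorder} point \<Rightarrow> 'n clifford"
  assumes v: "v \<in> test_functions \<Omega>" and \<Omega>: "open \<Omega>" and G: "C1_partials \<Omega> G \<gamma>"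
  shows "has_bochner_integral (lebesgue_on \<Omega>) (\<lambda>x.
      2 * G x * (partial_deriv l v x \<bullet> v x) + \<gamma> l x * (norm (v x))\<^sup>2) 0"
proof -
  obtain K where K: "compact K" "K \<subseteq> \<Omega>" and 0: "\<And>x. x \<notin> K \<Longrightarrow> v x = 0"
    using test_functions_support[OF v] by metis
  note C1 = C1_partials_subset[OF test_functionsD(1)[OF v] subset_UNIV]
  have "has_bochner_integral (lebesgue_on \<Omega>)
     (\<lambda>x. \<gamma> l x * (v x \<bullet> v x) + G x * (partial_deriv l v x \<bullet> v x + v x \<bullet> partial_deriv l v x)) 0"
    by (rule has_bochner_integral_partial_0[OF C1_partials_mult[OF G C1_partials_inner[OF C1 C1]] \<Omega> K])
       (simp add: 0)
  then show ?thesis by (simp add: power2_norm_eq_inner inner_commute algebra_simps)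
qed

text \<open>The vector field is \<open>y\<^sub>j = b\<^sub>j + a\<^sub>j x\<^sub>j\<close>, and the gradient of \<open>g\<close> is required to be parallel to \<open>y\<close> since
otherwise a term \<open>\<nabla>g \<and> y\<close> would couple \<open>v\<close> to \<open>\<partial>\<^sub>y v\<close>. The last sum measures how far the field is
from being conformal; it disappears when all \<open>a\<^sub>j\<close> agree.\<close>

theorem dirac_weighted_identity:
  fixes v :: "'n::{finite,linorder} point \<Rightarrow> 'n clifford"
    and y :: "'n \<Rightarrow> 'n point \<Rightarrow> real" and a :: "'n \<Rightarrow> real"
  assumes v: "v \<in> test_functions \<Omega>" and \<Omega>: "open \<Omega>"
    and y: "\<And>j. C1_partials \<Omega> (y j) (\<lambda>i x. if i = j then a j else 0)"
    and g: "C1_partials \<Omega> g (\<lambda>i x. \<mu> x * y i x)"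
    and \<beta>: "C1_partials \<Omega> \<beta> b"
    and rel: "\<And>x. x \<in> \<Omega> \<Longrightarrow> g x * \<beta> x = \<mu> x * (\<Sum>j\<in>UNIV. (y j x)\<^sup>2) + g x * (\<Sum>j\<in>UNIV. a j)"
  shows "has_bochner_integral (lebesgue_on \<Omega>) (\<lambda>x.
      g x * (\<Sum>j\<in>UNIV. (y j x)\<^sup>2) * (norm (dirac v x))\<^sup>2
      - g x * (norm (vec_mult (\<lambda>j. y j x) (dirac v x)
           + 2 *\<^sub>R (\<Sum>j\<in>UNIV. y j x *\<^sub>R partial_deriv j v x) + \<beta> x *\<^sub>R v x))\<^sup>2
      - g x * (\<Sum>j\<in>UNIV. b j x * y j x) * (norm (v x))\<^sup>2
      + 2 * g x * (\<Sum>j\<in>UNIV. \<Sum>k\<in>-{j}. (a k - a j) * y j x *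
            (v x \<bullet> (cl_pair j k (partial_deriv k v x))))) 0"
    (is "has_bochner_integral _ ?R 0")
proof -
  define Gd where "Gd l j i x = \<mu> x * y i x * y l x * y j x + g x * (if i = l then a l else 0) * y j x
      + g x * y l x * (if i = j then a j else 0)" for l j i x
  define Bd where "Bd l i x = \<mu> x * y i x * \<beta> x * y l x + g x * b i x * y l x
      + g x * \<beta> x * (if i = l then a l else 0)" for l i x
  have G: "C1_partials \<Omega> (\<lambda>x. g x * y l x * y j x) (Gd l j)" for l j
    by (rule C1_partials_cong[OF C1_partials_mult[OF C1_partials_mult[OF g y] y] \<Omega>])
       (auto simp: Gd_def algebra_simps)
  have B: "C1_partials \<Omega> (\<lambda>x. g x * \<beta> x * y l x) (Bd l)" for l
    by (rule C1_partials_cong[OF C1_partials_mult[OF C1_partials_mult[OF g \<beta>] y] \<Omega>])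
       (auto simp: Bd_def algebra_simps)
  define X where "X x = - 2 * (\<Sum>j\<in>UNIV. \<Sum>k\<in>-{j}. \<Sum>l\<in>UNIV.
          2 * (g x * y l x * y j x) * (partial_deriv l v x \<bullet> (cl_pair j k (partial_deriv k v x)))
          + Gd l j l x * (v x \<bullet> (cl_pair j k (partial_deriv k v x)))
          - Gd l j k x * (v x \<bullet> (cl_pair j k (partial_deriv l v x))))
      - (\<Sum>l\<in>UNIV. 2 * (g x * \<beta> x * y l x) * (partial_deriv l v x \<bullet> v x) + Bd l l x * (norm (v x))\<^sup>2)" for x
  have "has_bochner_integral (lebesgue_on \<Omega>) X
      (- 2 * (\<Sum>j\<in>(UNIV::'n set). \<Sum>k\<in>-{j}. \<Sum>l\<in>(UNIV::'n set). 0) - (\<Sum>l\<in>(UNIV::'n set). 0))"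
    unfolding X_def
    by (intro has_bochner_integral_diff has_bochner_integral_mult_right has_bochner_integral_sum
          spin_pair_by_parts[OF v \<Omega> G] square_by_parts[OF v \<Omega> B]) auto
  then have X: "has_bochner_integral (lebesgue_on \<Omega>) X 0" by simp
  show ?thesis
  proof (rule iffD2[OF has_bochner_integral_cong[OF refl _ refl] X])
    fix x assume "x \<in> space (lebesgue_on \<Omega>)"
    then have "x \<in> \<Omega>" by simp
    from dirac_identity_pointwise[OF rel[OF this], of "\<lambda>k. partial_deriv k v x" "v x" "\<lambda>j. b j x",
        folded dirac_def]
    show "?R x = X x" unfolding X_def Gd_def Bd_def by simp
  qed
qed

section \<open>Representation of bounded functionals on square integrable functions\<close>

lemma integrable_inner_L2:
  fixes f g :: "'a \<Rightarrow> 'b::euclidean_space"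
  assumes [measurable]: "f \<in> borel_measurable M" "g \<in> borel_measurable M"
    and i: "integrable M (\<lambda>x. (norm (f x))\<^sup>2)" "integrable M (\<lambda>x. (norm (g x))\<^sup>2)"
  shows "integrable M (\<lambda>x. f x \<bullet> g x)"
proof (rule Bochner_Integration.integrable_bound[OF Bochner_Integration.integrable_add[OF i]])
  have "norm (f x \<bullet> g x) \<le> norm ((norm (f x))\<^sup>2 + (norm (g x))\<^sup>2)" for x
  proof -
    have "\<bar>f x \<bullet> g x\<bar> \<le> norm (f x) * norm (g x)" by (rule Cauchy_Schwarz_ineq2)
    moreover have "2 * (norm (f x) * norm (g x)) \<le> (norm (f x))\<^sup>2 + (norm (g x))\<^sup>2"
      using sum_squares_bound[of "norm (f x)" "norm (g x)"] by simp
    moreover have "0 \<le> norm (f x) * norm (g x)" by simp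
    ultimately show ?thesis by simp
  qed
  then show "AE x in M. norm (f x \<bullet> g x) \<le> norm ((norm (f x))\<^sup>2 + (norm (g x))\<^sup>2)" by simp
qed measurable

lemma integrable_combination_L2:
  fixes f g :: "'a \<Rightarrow> 'b::euclidean_space"
  assumes m: "f \<in> borel_measurable M" "g \<in> borel_measurable M"
    and i: "integrable M (\<lambda>x. (norm (f x))\<^sup>2)" "integrable M (\<lambda>x. (norm (g x))\<^sup>2)"
  shows "integrable M (\<lambda>x. (norm (f x + c *\<^sub>R g x))\<^sup>2)"
    and "(\<integral>x. (norm (f x + c *\<^sub>R g x))\<^sup>2 \<partial>M) =
      (\<integral>x. (norm (f x))\<^sup>2 \<partial>M) + 2 * c * (\<integral>x. f x \<bullet> g x \<partial>M) + c\<^sup>2 * (\<integral>x. (norm (g x))\<^sup>2 \<partial>M)"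
proof -
  have eq: "(norm (f x + c *\<^sub>R g x))\<^sup>2 = (norm (f x))\<^sup>2 + 2 * c * (f x \<bullet> g x) + c\<^sup>2 * (norm (g x))\<^sup>2" for x
    by (simp only: power2_norm_eq_inner) (simp add: algebra_simps inner_commute power2_eq_square)
  note k = integrable_inner_L2[OF m i]
  show "integrable M (\<lambda>x. (norm (f x + c *\<^sub>R g x))\<^sup>2)"
    unfolding eq using i k by simp
  show "(\<integral>x. (norm (f x + c *\<^sub>R g x))\<^sup>2 \<partial>M) =
      (\<integral>x. (norm (f x))\<^sup>2 \<partial>M) + 2 * c * (\<integral>x. f x \<bullet> g x \<partial>M) + c\<^sup>2 * (\<integral>x. (norm (g x))\<^sup>2 \<partial>M)"
    unfolding eq using i k by simp
qed

text \<open>The discriminant criterion, including the degenerate case of an affine function.\<close>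

lemma quadratic_nonneg_imp:
  fixes a b c :: real
  assumes "\<And>t. 0 \<le> a + 2 * t * b + t\<^sup>2 * c" "a \<ge> 0" "c \<ge> 0"
  shows "b\<^sup>2 \<le> a * c"
proof (cases "c = 0")
  case True
  have "b = 0"
  proof (rule ccontr)
    assume "b \<noteq> 0"
    with assms(1)[of "- (a + 1) / (2 * b)"] True show False by (simp add: field_simps)
  qed
  then show ?thesis using True by simp
next
  case False
  then have "c > 0" using assms by simp
  then show ?thesis
    using assms(1)[of "- b / c"] by (simp add: field_simps power2_eq_square)
qed

lemma Cauchy_Schwarz_L2:
  fixes f g :: "'a \<Rightarrow> 'b::euclidean_space"
  assumes m: "f \<in> borel_measurable M" "g \<in> borel_measurable M"
    and i: "integrable M (\<lambda>x. (norm (f x))\<^sup>2)" "integrable M (\<lambda>x. (norm (g x))\<^sup>2)"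
  shows "(\<integral>x. f x \<bullet> g x \<partial>M)\<^sup>2 \<le> (\<integral>x. (norm (f x))\<^sup>2 \<partial>M) * (\<integral>x. (norm (g x))\<^sup>2 \<partial>M)"
proof (rule quadratic_nonneg_imp)
  fix t
  have "0 \<le> (\<integral>x. (norm (f x + t *\<^sub>R g x))\<^sup>2 \<partial>M)" by simp
  then show "0 \<le> (\<integral>x. (norm (f x))\<^sup>2 \<partial>M) + 2 * t * (\<integral>x. f x \<bullet> g x \<partial>M) + t\<^sup>2 * (\<integral>x. (norm (g x))\<^sup>2 \<partial>M)"
    unfolding integrable_combination_L2(2)[OF m i] .
qed simp_all

text \<open>The Riesz--Fischer argument. The rapid convergence makes \<open>\<Sum> 2\<^sup>n |w\<^sub>n\<^sub>+\<^sub>1 - w\<^sub>n|\<^sup>2\<close> integrable, so almost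
everywhere the increments decay geometrically and the sequence converges; Fatou's lemma transfers
the distance bounds to the limit.\<close>

lemma L2_complete:
  fixes w :: "nat \<Rightarrow> 'a \<Rightarrow> 'b::euclidean_space"
  assumes m [measurable]: "\<And>n. w n \<in> borel_measurable M"
    and i: "\<And>n. integrable M (\<lambda>x. (norm (w n x))\<^sup>2)"
    and cauchy: "\<And>m n. n \<le> m \<Longrightarrow> (\<integral>x. (norm (w m x - w n x))\<^sup>2 \<partial>M) \<le> (1/4)^n"
  obtains u where "u \<in> borel_measurable M" "integrable M (\<lambda>x. (norm (u x))\<^sup>2)"
    "\<And>n. integrable M (\<lambda>x. (norm (u x - w n x))\<^sup>2)"
    "\<And>n. (\<integral>x. (norm (u x - w n x))\<^sup>2 \<partial>M) \<le> (1/4)^n"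
proof -
  have idiff: "integrable M (\<lambda>x. (norm (w m x - w n x))\<^sup>2)" for m n
    using integrable_combination_L2(1)[of "w m" M "w n" "-1"] m i by simp
  have nn: "(\<integral>\<^sup>+x. ennreal ((norm (w m x - w n x))\<^sup>2) \<partial>M) \<le> ennreal ((1/4)^n)" if "n \<le> m" for m n
    using cauchy[OF that] idiff by (subst nn_integral_eq_integral) (auto intro: ennreal_leI)
  have "(\<integral>\<^sup>+x. (\<Sum>n. ennreal (2^n) * ennreal ((norm (w (Suc n) x - w n x))\<^sup>2)) \<partial>M)
      = (\<Sum>n. ennreal (2^n) * (\<integral>\<^sup>+x. ennreal ((norm (w (Suc n) x - w n x))\<^sup>2) \<partial>M))"
    by (subst nn_integral_suminf) (auto simp: nn_integral_cmult)
  also have "\<dots> \<le> (\<Sum>n. ennreal ((1/2)^n))"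
  proof (rule suminf_le)
    fix n
    have "ennreal (2^n) * (\<integral>\<^sup>+x. ennreal ((norm (w (Suc n) x - w n x))\<^sup>2) \<partial>M)
        \<le> ennreal (2^n) * ennreal ((1/4)^n)"
      by (intro mult_left_mono nn) auto
    also have "\<dots> = ennreal ((1/2)^n)"
      by (simp add: ennreal_mult[symmetric] power_mult_distrib[symmetric])
    finally show "ennreal (2^n) * (\<integral>\<^sup>+x. ennreal ((norm (w (Suc n) x - w n x))\<^sup>2) \<partial>M) \<le> ennreal ((1/2)^n)" .
  qed auto
  also have "\<dots> = ennreal (\<Sum>n. (1/2)^n)"
    by (intro suminf_ennreal2 summable_geometric) auto
  also have "\<dots> < \<infinity>" by simp
  finally have "AE x in M. (\<Sum>n. ennreal (2^n) * ennreal ((norm (w (Suc n) x - w n x))\<^sup>2)) \<noteq> \<infinity>"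
    by (intro nn_integral_PInf_AE) auto
  then have conv: "AE x in M. convergent (\<lambda>n. w n x)"
  proof eventually_elim
    case (elim x)
    define g where "g n = 2^n * (norm (w (Suc n) x - w n x))\<^sup>2" for n
    have "(\<Sum>n. ennreal (g n)) \<noteq> top"
      using elim by (simp add: g_def ennreal_mult)
    then have "summable g" by (intro summable_suminf_not_top) (auto simp: g_def)
    then have "Bseq g" by (intro convergent_imp_Bseq convergentI) (rule summable_LIMSEQ_zero)
    then obtain C where C: "0 < C" "\<And>n. norm (g n) \<le> C" by (rule BseqE) blast
    have "norm (w (Suc n) x - w n x) \<le> sqrt C * (sqrt (1/2))^n" for n
    proof (rule power2_le_imp_le)
      have "(sqrt C * (sqrt (1/2))^n)\<^sup>2 = C * (1/2)^n"
        using C(1) by (simp add: power_mult_distrib real_sqrt_power[symmetric])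
      also have "\<dots> \<ge> (norm (w (Suc n) x - w n x))\<^sup>2"
        using C(2)[of n] by (simp add: g_def power_divide field_simps)
      finally show "(norm (w (Suc n) x - w n x))\<^sup>2 \<le> (sqrt C * (sqrt (1/2))^n)\<^sup>2" .
    qed (use C(1) in simp)
    moreover have sum: "summable (\<lambda>n. sqrt C * (sqrt (1/2))^n)"
      by (intro summable_mult summable_geometric) (simp add: real_sqrt_divide)
    ultimately have "summable (\<lambda>n. w (Suc n) x - w n x)"
      by (intro summable_comparison_test'[OF sum, where N=0]) auto
    moreover have tel: "(\<Sum>i<n. w (Suc i) x - w i x) = w n x - w 0 x" for n
      by (induction n) auto
    ultimately have "convergent (\<lambda>n. w n x - w 0 x)"
      by (simp add: summable_iff_convergent tel)
    then have "convergent (\<lambda>n. (w n x - w 0 x) + w 0 x)"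
      by (intro convergent_add convergent_const)
    then show ?case by simp
  qed
  define u where "u x = lim (\<lambda>n. w n x)" for x
  have mu [measurable]: "u \<in> borel_measurable M"
    unfolding u_def by (rule borel_measurable_lim_metric) measurable
  have bound: "(\<integral>\<^sup>+x. ennreal ((norm (u x - w n x))\<^sup>2) \<partial>M) \<le> ennreal ((1/4)^n)" for n
  proof -
    have "(\<integral>\<^sup>+x. ennreal ((norm (u x - w n x))\<^sup>2) \<partial>M)
        = (\<integral>\<^sup>+x. liminf (\<lambda>m. ennreal ((norm (w m x - w n x))\<^sup>2)) \<partial>M)"
    proof (rule nn_integral_cong_AE)
      show "AE x in M. ennreal ((norm (u x - w n x))\<^sup>2) = liminf (\<lambda>m. ennreal ((norm (w m x - w n x))\<^sup>2))"
        using conv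
      proof eventually_elim
        case (elim x)
        then have "(\<lambda>m. w m x) \<longlonglongrightarrow> u x" by (simp add: u_def convergent_LIMSEQ_iff)
        then have "(\<lambda>m. ennreal ((norm (w m x - w n x))\<^sup>2)) \<longlonglongrightarrow> ennreal ((norm (u x - w n x))\<^sup>2)"
          by (intro tendsto_intros tendsto_ennrealI)
        then show ?case by (rule lim_imp_Liminf[symmetric, rotated]) simp
      qed
    qed
    also have "\<dots> \<le> liminf (\<lambda>m. \<integral>\<^sup>+x. ennreal ((norm (w m x - w n x))\<^sup>2) \<partial>M)"
      by (rule nn_integral_liminf) measurable
    also have "\<dots> \<le> ennreal ((1/4)^n)"
    proof (rule Liminf_le)
      show "\<forall>\<^sub>F m in sequentially. (\<integral>\<^sup>+x. ennreal ((norm (w m x - w n x))\<^sup>2) \<partial>M) \<le> ennreal ((1/4)^n)"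
        using eventually_ge_at_top[of n] by eventually_elim (rule nn)
    qed simp
    finally show ?thesis .
  qed
  have iu: "integrable M (\<lambda>x. (norm (u x - w n x))\<^sup>2)" for n
    using le_less_trans[OF bound[of n] ennreal_less_top] by (intro integrableI_bounded) auto
  have "integrable M (\<lambda>x. (norm ((u x - w 0 x) + 1 *\<^sub>R w 0 x))\<^sup>2)"
    by (rule integrable_combination_L2(1)) (use iu i in measurable)
  then have "integrable M (\<lambda>x. (norm (u x))\<^sup>2)" by simp
  moreover have "(\<integral>x. (norm (u x - w n x))\<^sup>2 \<partial>M) \<le> (1/4)^n" for n
    using bound[of n] iu by (subst (asm) nn_integral_eq_integral) (auto simp: ennreal_le_iff)
  ultimately show ?thesis using that mu iu by blast
qed

text \<open>Riesz representation relative to a family \<open>A\<close> of square integrable functions indexed by a set \<open>V\<close>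
that is closed under linear combinations. Indexing by \<open>V\<close> avoids having to show that the functional
depends on \<open>A v\<close> alone. The representing function is the limit of a minimising sequence of
\<open>\<parallel>A v\<parallel>\<^sup>2 - 2 l v\<close>, which is Cauchy by the parallelogram identity.\<close>

lemma L2_riesz:
  fixes A :: "'v \<Rightarrow> 'a \<Rightarrow> 'b::euclidean_space" and l :: "'v \<Rightarrow> real"
  assumes V: "V \<noteq> {}" and C: "0 \<le> C"
    and m: "\<And>v. v \<in> V \<Longrightarrow> A v \<in> borel_measurable M"
    and i: "\<And>v. v \<in> V \<Longrightarrow> integrable M (\<lambda>x. (norm (A v x))\<^sup>2)"
    and lin: "\<And>v w c. v \<in> V \<Longrightarrow> w \<in> V \<Longrightarrow>
       \<exists>z\<in>V. (\<forall>x. A z x = A v x + c *\<^sub>R A w x) \<and> l z = l v + c * l w"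
    and bound: "\<And>v. v \<in> V \<Longrightarrow> (l v)\<^sup>2 \<le> C * (\<integral>x. (norm (A v x))\<^sup>2 \<partial>M)"
  obtains u where "u \<in> borel_measurable M" "integrable M (\<lambda>x. (norm (u x))\<^sup>2)"
    "(\<integral>x. (norm (u x))\<^sup>2 \<partial>M) \<le> C" "\<And>v. v \<in> V \<Longrightarrow> (\<integral>x. u x \<bullet> A v x \<partial>M) = l v"
proof -
  define N where "N v = (\<integral>x. (norm (A v x))\<^sup>2 \<partial>M)" for v
  define P where "P v w = (\<integral>x. A v x \<bullet> A w x \<partial>M)" for v w
  define Q where "Q v = N v - 2 * l v" for v
  have N0: "0 \<le> N v" for v by (simp add: N_def)
  have Ncomb: "N z = N v + 2 * c * P v w + c\<^sup>2 * N w"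
    if "v \<in> V" "w \<in> V" "\<And>x. A z x = A v x + c *\<^sub>R A w x" for v w z c
    unfolding N_def P_def that(3) by (rule integrable_combination_L2(2)) (use that m i in auto)
  have low: "- C \<le> Q v" if "v \<in> V" for v
  proof -
    have "4 * (l v)\<^sup>2 \<le> 4 * (C * N v)" using bound[OF that] by (simp add: N_def)
    also have "\<dots> \<le> (C + N v)\<^sup>2"
      using zero_le_power2[of "C - N v"] by (simp add: power2_eq_square algebra_simps)
    finally have "(2 * l v)\<^sup>2 \<le> (C + N v)\<^sup>2" by (simp add: power_mult_distrib)
    then have "2 * l v \<le> C + N v" by (rule power2_le_imp_le) (use C N0[of v] in simp)
    then show ?thesis by (simp add: Q_def)
  qed
  have bdd: "bdd_below (Q ` V)" by (rule bdd_belowI2[OF low])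
  define d where "d = (INF v\<in>V. Q v)"
  have dle: "d \<le> Q v" if "v \<in> V" for v unfolding d_def using bdd that by (rule cINF_lower)
  have "\<exists>v\<in>V. Q v < d + (1/4)^n / 4" for n :: nat
    unfolding d_def by (rule iffD1[OF cINF_less_iff[OF V bdd]]) simp
  then obtain v where v: "\<And>n. v n \<in> V" "\<And>n. Q (v n) < d + (1/4)^n / 4" by metis
  \<comment> \<open>Parallelogram identity: compare with the midpoint, where the functional is at least \<open>d\<close>.\<close>
  have cauchy: "(\<integral>x. (norm (A (v k) x - A (v n) x))\<^sup>2 \<partial>M) \<le> (1/4)^n" if "n \<le> k" for n k
  proof -
    obtain s where s: "s \<in> V" "\<And>x. A s x = A (v k) x + 1 *\<^sub>R A (v n) x" "l s = l (v k) + 1 * l (v n)"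
      using lin[of "v k" "v n" 1] v(1) by blast
    obtain z where z: "z \<in> V" "\<And>x. A z x = A s x + (-1/2) *\<^sub>R A s x" "l z = l s + (-1/2) * l s"
      using lin[of s s "-1/2"] s(1) by blast
    have Ps: "P s s = N s" by (simp add: P_def N_def power2_norm_eq_inner)
    have "N z = N s / 4" using Ncomb[OF s(1) s(1) z(2)] Ps by (simp add: power2_eq_square)
    moreover have "N s = N (v k) + 2 * P (v k) (v n) + N (v n)"
      using Ncomb[OF v(1) v(1) s(2)] by simp
    moreover have "(\<integral>x. (norm (A (v k) x - A (v n) x))\<^sup>2 \<partial>M) = N (v k) - 2 * P (v k) (v n) + N (v n)"
      using integrable_combination_L2(2)[OF m[OF v(1)[of k]] m[OF v(1)[of n]] i[OF v(1)[of k]] i[OF v(1)[of n]], of "-1"]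
      by (simp add: N_def P_def)
    moreover have "d \<le> N z - 2 * l z" using dle[OF z(1)] by (simp add: Q_def)
    moreover have "2 * l z = l (v k) + l (v n)" unfolding z(3) s(3) by (simp add: field_simps)
    moreover have "N (v k) - 2 * l (v k) < d + (1/4)^k / 4" "N (v n) - 2 * l (v n) < d + (1/4)^n / 4"
      using v(2) unfolding Q_def by auto
    moreover have "(1/4::real)^k \<le> (1/4)^n" using that by (intro power_decreasing) auto
    ultimately show ?thesis by linarith
  qed
  obtain u where u: "u \<in> borel_measurable M" "integrable M (\<lambda>x. (norm (u x))\<^sup>2)"
    and iuw: "\<And>n. integrable M (\<lambda>x. (norm (u x - A (v n) x))\<^sup>2)"
    and uw: "\<And>n. (\<integral>x. (norm (u x - A (v n) x))\<^sup>2 \<partial>M) \<le> (1/4)^n"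
    using L2_complete[of "\<lambda>n. A (v n)" M, OF m[OF v(1)] i[OF v(1)] cauchy] by blast
  have p0: "(\<lambda>n. (1/4::real)^n) \<longlonglongrightarrow> 0" by (intro LIMSEQ_power_zero) auto
  have lim: "(\<lambda>n. \<integral>x. A (v n) x \<bullet> g x \<partial>M) \<longlonglongrightarrow> (\<integral>x. u x \<bullet> g x \<partial>M)"
    if g: "g \<in> borel_measurable M" "integrable M (\<lambda>x. (norm (g x))\<^sup>2)" for g
  proof -
    define G where "G = (\<integral>x. (norm (g x))\<^sup>2 \<partial>M)"
    have "((\<integral>x. A (v n) x \<bullet> g x \<partial>M) - (\<integral>x. u x \<bullet> g x \<partial>M))\<^sup>2 \<le> (1/4)^n * G" for n
    proof -
      have "(\<integral>x. u x \<bullet> g x \<partial>M) - (\<integral>x. A (v n) x \<bullet> g x \<partial>M) = (\<integral>x. (u x - A (v n) x) \<bullet> g x \<partial>M)"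
        using integrable_inner_L2[OF u(1) g(1) u(2) g(2)]
          integrable_inner_L2[OF m g(1) i g(2), OF v(1) v(1)]
        by (simp add: inner_diff_left)
      moreover have "(\<integral>x. (u x - A (v n) x) \<bullet> g x \<partial>M)\<^sup>2 \<le>
          (\<integral>x. (norm (u x - A (v n) x))\<^sup>2 \<partial>M) * G"
        unfolding G_def using u(1) m[OF v(1)] g iuw by (intro Cauchy_Schwarz_L2) auto
      moreover have "\<dots> \<le> (1/4)^n * G"
        by (intro mult_right_mono uw) (simp add: G_def)
      ultimately show ?thesis by (simp add: power2_commute)
    qed
    then have "(\<lambda>n. ((\<integral>x. A (v n) x \<bullet> g x \<partial>M) - (\<integral>x. u x \<bullet> g x \<partial>M))\<^sup>2) \<longlonglongrightarrow> 0"
      by (intro tendsto_sandwich[OF _ _ tendsto_const tendsto_mult_left_zero[OF p0, of G]]) auto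
    from tendsto_real_sqrt[OF this] show ?thesis
      by (simp add: tendsto_rabs_zero_iff LIM_zero_iff)
  qed
  have eq: "(\<integral>x. u x \<bullet> A w x \<partial>M) = l w" if w: "w \<in> V" for w
  proof -
    define b where "b = (\<integral>x. u x \<bullet> A w x \<partial>M) - l w"
    \<comment> \<open>First variation of the functional at the minimising sequence.\<close>
    have "0 \<le> 0 + 2 * t * b + t\<^sup>2 * N w" for t
    proof -
      have "- ((1/4)^n / 4) \<le> 2 * t * (P (v n) w - l w) + t\<^sup>2 * N w" for n
      proof -
        obtain z where z: "z \<in> V" "\<And>x. A z x = A (v n) x + t *\<^sub>R A w x" "l z = l (v n) + t * l w"
          using lin[of "v n" w t] v(1) w by blast
        have "d \<le> Q z" using dle z by simp
        also have "Q z = Q (v n) + 2 * t * (P (v n) w - l w) + t\<^sup>2 * N w"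
          unfolding Q_def Ncomb[OF v(1) w z(2)] z(3) by (simp add: algebra_simps)
        finally show ?thesis using v(2)[of n] by simp
      qed
      moreover have "(\<lambda>n. - ((1/4::real)^n / 4)) \<longlonglongrightarrow> 0"
        using tendsto_minus[OF tendsto_divide_zero[OF p0, of 4]] by simp
      moreover have "(\<lambda>n. 2 * t * (P (v n) w - l w) + t\<^sup>2 * N w) \<longlonglongrightarrow> 2 * t * b + t\<^sup>2 * N w"
        unfolding P_def b_def using lim[OF m[OF w] i[OF w]] by (intro tendsto_intros)
      ultimately have "0 \<le> 2 * t * b + t\<^sup>2 * N w" by (intro LIMSEQ_le) auto
      then show ?thesis by simp
    qed
    then have "b\<^sup>2 \<le> 0 * N w" by (rule quadratic_nonneg_imp) (auto simp: N0)
    then show ?thesis by (simp add: b_def)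
  qed
  define U where "U = (\<integral>x. (norm (u x))\<^sup>2 \<partial>M)"
  have "U \<le> C"
  proof -
    have l: "(\<lambda>n. l (v n)) \<longlonglongrightarrow> U"
      using lim[OF u] eq[OF v(1)] by (simp add: U_def power2_norm_eq_inner inner_commute)
    have "(\<lambda>n. (\<integral>x. (norm (u x - A (v n) x))\<^sup>2 \<partial>M)) \<longlonglongrightarrow> 0"
      using uw by (intro tendsto_sandwich[OF _ _ tendsto_const p0]) auto
    moreover have "(\<integral>x. (norm (u x - A (v n) x))\<^sup>2 \<partial>M) = U - 2 * l (v n) + N (v n)" for n
      using integrable_combination_L2(2)[OF u(1) m[OF v(1)[of n]] u(2) i[OF v(1)[of n]], of "-1"] eq[OF v(1)]
      by (simp add: N_def U_def)
    ultimately have "(\<lambda>n. (U - 2 * l (v n) + N (v n)) + 2 * l (v n) - U) \<longlonglongrightarrow> 0 + 2 * U - U"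
      using l by (intro tendsto_intros) auto
    then have "(\<lambda>n. C * N (v n)) \<longlonglongrightarrow> C * U" by (intro tendsto_intros) simp
    moreover have "(\<lambda>n. (l (v n))\<^sup>2) \<longlonglongrightarrow> U\<^sup>2" using l by (intro tendsto_intros)
    ultimately have "U\<^sup>2 \<le> C * U"
      using bound[OF v(1)] by (intro LIMSEQ_le) (auto simp: N_def)
    moreover have "U \<ge> 0" by (simp add: U_def)
    ultimately show ?thesis using C by (cases "U = 0") (auto simp: power2_eq_square)
  qed
  then show ?thesis using that u eq by (simp add: U_def)
qed

section \<open>Solutions from a priori estimates\<close>

lemma partial_deriv_combination:
  assumes "v differentiable_on UNIV" "w differentiable_on UNIV"
  shows "partial_deriv j (\<lambda>x. v x + c *\<^sub>R w x) = (\<lambda>x. partial_deriv j v x + c *\<^sub>R partial_deriv j w x)"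
proof
  fix x
  have "(v has_derivative frechet_derivative v (at x)) (at x)"
    "(w has_derivative frechet_derivative w (at x)) (at x)"
    using assms by (auto simp: differentiable_on_def frechet_derivative_works)
  then have "((\<lambda>x. v x + c *\<^sub>R w x) has_derivative
      (\<lambda>h. frechet_derivative v (at x) h + c *\<^sub>R frechet_derivative w (at x) h)) (at x)"
    by (intro has_derivative_add has_derivative_scaleR_right)
  from frechet_derivative_at[OF this, symmetric]
  show "partial_deriv j (\<lambda>x. v x + c *\<^sub>R w x) x = partial_deriv j v x + c *\<^sub>R partial_deriv j w x"
    by (simp add: partial_deriv_def)
qed

lemma C_diff_combination:
  "C_diff k v \<Longrightarrow> C_diff k w \<Longrightarrow> C_diff k (\<lambda>x. v x + c *\<^sub>R w x)"
proof (induction k arbitrary: v w)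
  case 0
  then show ?case by (auto intro!: continuous_intros)
next
  case (Suc k)
  then have d: "v differentiable_on UNIV" "w differentiable_on UNIV" by auto
  then have "(\<lambda>x. v x + c *\<^sub>R w x) differentiable_on UNIV"
    by (auto simp: differentiable_on_def intro!: derivative_intros)
  then show ?case using Suc by (simp add: partial_deriv_combination[OF d])
qed

lemma C_diff_const: "C_diff k (\<lambda>x::real^'n::finite. c)"
proof (induction k arbitrary: c)
  case (Suc k)
  have "partial_deriv j (\<lambda>x::real^'n. c) = (\<lambda>x. 0)" for j
    by (simp add: partial_deriv_def fun_eq_iff)
  then show ?case using Suc by simp
qed simp

lemma test_functionsI:
  assumes "\<And>k. C_diff k v" and K: "compact K" "K \<subseteq> \<Omega>" and v: "{x. v x \<noteq> 0} \<subseteq> K"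
  shows "v \<in> test_functions \<Omega>"
proof -
  have sub: "closure {x. v x \<noteq> 0} \<subseteq> K"
    by (rule closure_minimal[OF v compact_imp_closed[OF K(1)]])
  have "compact (K \<inter> closure {x. v x \<noteq> 0})" by (rule compact_Int_closed[OF K(1) closed_closure])
  then have "compact (closure {x. v x \<noteq> 0})" using sub by (simp only: Int_absorb1)
  then show ?thesis using assms(1) sub K(2) unfolding test_functions_def by blast
qed

lemma test_functions_combination:
  assumes v: "v \<in> test_functions \<Omega>" and w: "w \<in> test_functions \<Omega>"
  shows "(\<lambda>x. v x + c *\<^sub>R w x) \<in> test_functions \<Omega>"
proof -
  obtain K where K: "compact K" "K \<subseteq> \<Omega>" "\<And>x. x \<notin> K \<Longrightarrow> v x = 0"
    using test_functions_support[OF v] by metis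
  obtain L where L: "compact L" "L \<subseteq> \<Omega>" "\<And>x. x \<notin> L \<Longrightarrow> w x = 0"
    using test_functions_support[OF w] by metis
  have "C_diff k v" "C_diff k w" for k using v w unfolding test_functions_def by blast+
  moreover have "{x. v x + c *\<^sub>R w x \<noteq> 0} \<subseteq> K \<union> L"
  proof (rule subsetI, rule ccontr)
    fix x assume "x \<in> {x. v x + c *\<^sub>R w x \<noteq> 0}" "x \<notin> K \<union> L"
    then show False by (simp add: K(3) L(3))
  qed
  ultimately show ?thesis
    by (intro test_functionsI[OF _ compact_Un[OF K(1) L(1)] Un_least[OF K(2) L(2)]] C_diff_combination)
qed

lemma zero_test_function: "(\<lambda>x. 0) \<in> test_functions \<Omega>"
  by (rule test_functionsI[OF C_diff_const compact_empty]) auto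

lemma dirac_combination:
  assumes v: "v \<in> test_functions \<Omega>" and w: "w \<in> test_functions \<Omega>"
  shows "dirac (\<lambda>x. v x + c *\<^sub>R w x) x = dirac v x + c *\<^sub>R dirac w x"
proof -
  have "C_diff (Suc 0) v" "C_diff (Suc 0) w" using v w unfolding test_functions_def by blast+
  then have d: "v differentiable_on UNIV" "w differentiable_on UNIV" by auto
  show ?thesis
    unfolding dirac_def partial_deriv_combination[OF d]
    by (simp add: cl_gen_add cl_gen_scaleR sum.distrib scaleR_sum_right)
qed

lemma continuous_test_function:
  assumes "v \<in> test_functions \<Omega>"
  shows "continuous_on S v" "continuous_on S (partial_deriv j v)" "continuous_on S (dirac v)"
proof -
  note C = C1_partialsD(2,3)[OF test_functionsD(1)[OF assms]]
  show "continuous_on S v" "continuous_on S (partial_deriv j v)"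
    using C continuous_on_subset by blast+
  have "continuous_on UNIV (dirac v)"
    unfolding dirac_def
    by (intro continuous_on_sum bounded_linear.continuous_on[OF bounded_linear_cl_gen_mult] C)
  then show "continuous_on S (dirac v)" using continuous_on_subset by blast
qed

lemma dirac_eq_0: "(\<And>j. partial_deriv j v x = 0) \<Longrightarrow> dirac v x = 0"
  by (simp add: dirac_def linear_0[OF bounded_linear.linear[OF bounded_linear_cl_gen_mult]])

lemma weighted_norm_square:
  "(weighted_norm \<phi> \<Omega> u)\<^sup>2 = (\<integral>x. (norm (u x))\<^sup>2 * exp (- \<phi> x) \<partial>lebesgue_on \<Omega>)"
  unfolding weighted_norm_def by (rule real_sqrt_pow2) simp

text \<open>The functional \<open>v \<mapsto> \<integral>\<langle>f, v\<rangle>\<close> is bounded in terms of \<open>e\<^sup>\<phi>\<^sup>/\<^sup>2 Dv\<close>: split \<open>\<langle>f, v\<rangle>\<close> as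
\<open>\<langle>w\<^sup>-\<^sup>1\<^sup>/\<^sup>2 e\<^sup>-\<^sup>\<phi>\<^sup>/\<^sup>2 f, w\<^sup>1\<^sup>/\<^sup>2 e\<^sup>\<phi>\<^sup>/\<^sup>2 v\<rangle>\<close>, apply the Cauchy--Schwarz inequality and then the estimate.
The factors \<open>e\<^sup>\<phi>\<^sup>/\<^sup>2\<close> reduce everything to the unweighted space, where the functional is represented by
some \<open>U\<close>; the solution is \<open>e\<^sup>\<phi>\<^sup>/\<^sup>2 U\<close>.\<close>

theorem dirac_solution_of_estimate:
  fixes \<phi> w :: "'n::{finite,linorder} point \<Rightarrow> real"
  assumes \<Omega>: "open \<Omega>" and c\<phi>: "continuous_on \<Omega> \<phi>" and cw: "continuous_on \<Omega> w"
    and w: "\<And>x. x \<in> \<Omega> \<Longrightarrow> 0 < w x"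
    and est: "\<And>v. v \<in> test_functions \<Omega> \<Longrightarrow>
      (\<integral>x. w x * (norm (v x))\<^sup>2 * exp (\<phi> x) \<partial>lebesgue_on \<Omega>)
        \<le> (\<integral>x. (norm (dirac v x))\<^sup>2 * exp (\<phi> x) \<partial>lebesgue_on \<Omega>)"
    and f: "f \<in> weighted_L2 \<phi> \<Omega>"
    and fw: "integrable (lebesgue_on \<Omega>) (\<lambda>x. (norm (f x))\<^sup>2 / w x * exp (- \<phi> x))"
  shows "\<exists>u\<in>weighted_L2 \<phi> \<Omega>. dirac_eq \<Omega> u f \<and>
    (weighted_norm \<phi> \<Omega> u)\<^sup>2 \<le> (\<integral>x. (norm (f x))\<^sup>2 / w x * exp (- \<phi> x) \<partial>lebesgue_on \<Omega>)"
proof -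
  let ?M = "lebesgue_on \<Omega>"
  define C where "C = (\<integral>x. (norm (f x))\<^sup>2 / w x * exp (- \<phi> x) \<partial>?M)"
  have sets: "\<Omega> \<in> sets lebesgue" using \<Omega> by auto
  note meas = continuous_imp_measurable_on_sets_lebesgue[OF _ sets]
  define F where "F x = (exp (- \<phi> x / 2) / sqrt (w x)) *\<^sub>R f x" for x
  define H where "H v x = (sqrt (w x) * exp (\<phi> x / 2)) *\<^sub>R v x" for v :: "'n point \<Rightarrow> 'n clifford" and x
  define A where "A v x = exp (\<phi> x / 2) *\<^sub>R dirac v x" for v x
  define l where "l v = (\<integral>x. f x \<bullet> v x \<partial>?M)" for v
  have ex: "exp (t / 2) * exp (t / 2) = exp t" for t :: real by (simp add: exp_add[symmetric])
  have ex2: "(exp (t / 2))\<^sup>2 = exp t" for t :: real by (simp add: power2_eq_square ex)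
  have [measurable]: "f \<in> borel_measurable ?M" using f by (simp add: weighted_L2_def)
  have m\<phi> [measurable]: "\<phi> \<in> borel_measurable ?M" using c\<phi> by (rule meas)
  have [measurable]: "w \<in> borel_measurable ?M" using cw by (rule meas)
  have mF: "F \<in> borel_measurable ?M" unfolding F_def by measurable
  have nF: "(norm (F x))\<^sup>2 = (norm (f x))\<^sup>2 / w x * exp (- \<phi> x)" if "x \<in> \<Omega>" for x
    using w[OF that] by (simp add: F_def power_mult_distrib power_divide ex2[of "- \<phi> x", simplified] mult_ac)
  have iF: "integrable ?M (\<lambda>x. (norm (F x))\<^sup>2)"
    using fw by (rule iffD1[OF Bochner_Integration.integrable_cong, rotated -1]) (auto simp: nF)
  have CF: "C = (\<integral>x. (norm (F x))\<^sup>2 \<partial>?M)"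
    unfolding C_def by (rule Bochner_Integration.integral_cong) (auto simp: nF)
  have C0: "0 \<le> C" unfolding CF by simp
  have mA: "A v \<in> borel_measurable ?M" if "v \<in> test_functions \<Omega>" for v
    unfolding A_def by (intro meas continuous_intros c\<phi> continuous_test_function[OF that]) auto
  have nA: "(norm (A v x))\<^sup>2 = (norm (dirac v x))\<^sup>2 * exp (\<phi> x)" for v x
    by (simp add: A_def power_mult_distrib ex2)
  have iA: "integrable ?M (\<lambda>x. (norm (A v x))\<^sup>2)" if v: "v \<in> test_functions \<Omega>" for v
  proof -
    obtain K where K: "compact K" "K \<subseteq> \<Omega>" and 0: "\<And>x j. x \<notin> K \<Longrightarrow> partial_deriv j v x = 0"
      using test_functions_support[OF v] by metis
    show ?thesis unfolding nA
      by (rule integrable_compact_support[OF \<Omega> K])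
         (auto intro!: continuous_intros c\<phi> continuous_test_function[OF v] simp: dirac_eq_0 0)
  qed
  have mH: "H v \<in> borel_measurable ?M" if "v \<in> test_functions \<Omega>" for v
    unfolding H_def by (intro meas continuous_intros c\<phi> cw continuous_test_function[OF that]) auto
  have nH: "(norm (H v x))\<^sup>2 = w x * (norm (v x))\<^sup>2 * exp (\<phi> x)" if "x \<in> \<Omega>" for v x
    using w[OF that] by (simp add: H_def power_mult_distrib ex2)
  have iH: "integrable ?M (\<lambda>x. (norm (H v x))\<^sup>2)" if v: "v \<in> test_functions \<Omega>" for v
  proof -
    obtain K where K: "compact K" "K \<subseteq> \<Omega>" and 0: "\<And>x. x \<notin> K \<Longrightarrow> v x = 0"
      using test_functions_support[OF v] by metis
    show ?thesis
      by (rule integrable_compact_support[OF \<Omega> K])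
         (auto simp: H_def 0 intro!: continuous_intros c\<phi> cw continuous_test_function[OF v])
  qed
  have FH: "f x \<bullet> v x = F x \<bullet> H v x" if "x \<in> \<Omega>" for v x
    using w[OF that] by (simp add: F_def H_def exp_minus field_simps ex)
  have ifv: "integrable ?M (\<lambda>x. f x \<bullet> v x)" if v: "v \<in> test_functions \<Omega>" for v
    using integrable_inner_L2[OF mF mH[OF v] iF iH[OF v]]
    by (rule iffD1[OF Bochner_Integration.integrable_cong, rotated -1]) (auto simp: FH)
  have lin: "\<exists>z\<in>test_functions \<Omega>. (\<forall>x. A z x = A v x + c *\<^sub>R A w x) \<and> l z = l v + c * l w"
    if "v \<in> test_functions \<Omega>" "w \<in> test_functions \<Omega>" for v w c
    by (rule bexI[OF _ test_functions_combination[OF that, of c]])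
       (use ifv that in \<open>simp add: A_def l_def dirac_combination[OF that] algebra_simps\<close>)
  have bound: "(l v)\<^sup>2 \<le> C * (\<integral>x. (norm (A v x))\<^sup>2 \<partial>?M)" if v: "v \<in> test_functions \<Omega>" for v
  proof -
    have "l v = (\<integral>x. F x \<bullet> H v x \<partial>?M)"
      unfolding l_def by (rule Bochner_Integration.integral_cong) (auto simp: FH)
    then have "(l v)\<^sup>2 \<le> C * (\<integral>x. (norm (H v x))\<^sup>2 \<partial>?M)"
      unfolding CF using Cauchy_Schwarz_L2[OF mF mH[OF v] iF iH[OF v]] by simp
    also have "(\<integral>x. (norm (H v x))\<^sup>2 \<partial>?M) = (\<integral>x. w x * (norm (v x))\<^sup>2 * exp (\<phi> x) \<partial>?M)"
      by (rule Bochner_Integration.integral_cong) (auto simp: nH)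
    also have "C * \<dots> \<le> C * (\<integral>x. (norm (A v x))\<^sup>2 \<partial>?M)"
      unfolding nA by (rule mult_left_mono[OF est[OF v] C0])
    finally show ?thesis .
  qed
  have "test_functions \<Omega> \<noteq> ({} :: ('n point \<Rightarrow> 'n clifford) set)" using zero_test_function by blast
  from L2_riesz[OF this C0, of A ?M l, OF mA iA lin bound]
  obtain U where mU [measurable]: "U \<in> borel_measurable ?M" and iU: "integrable ?M (\<lambda>x. (norm (U x))\<^sup>2)"
    and U: "(\<integral>x. (norm (U x))\<^sup>2 \<partial>?M) \<le> C" "\<And>v. v \<in> test_functions \<Omega> \<Longrightarrow> (\<integral>x. U x \<bullet> A v x \<partial>?M) = l v"
    by blast
  define u where "u x = exp (\<phi> x / 2) *\<^sub>R U x" for x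
  have nu: "(norm (u x))\<^sup>2 * exp (- \<phi> x) = (norm (U x))\<^sup>2" for x
    by (simp add: u_def power_mult_distrib ex2 exp_minus)
  have "u \<in> weighted_L2 \<phi> \<Omega>"
  proof -
    have "u \<in> borel_measurable ?M" unfolding u_def by measurable
    then show ?thesis unfolding weighted_L2_def mem_Collect_eq nu using iU by blast
  qed
  moreover have "dirac_eq \<Omega> u f"
    unfolding dirac_eq_def using U(2) by (simp add: u_def A_def l_def)
  moreover have "(weighted_norm \<phi> \<Omega> u)\<^sup>2 \<le> C"
    unfolding weighted_norm_square nu by (rule U(1))
  ultimately show ?thesis unfolding C_def by blast
qed

section \<open>Estimates for radial weights and for weights of one coordinate\<close>

lemma integrable_test:
  fixes F :: "'n::{finite,linorder} point \<Rightarrow> real"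
  assumes v: "v \<in> test_functions \<Omega>" and \<Omega>: "open \<Omega>" and F: "continuous_on \<Omega> F"
    and 0: "\<And>x. v x = 0 \<Longrightarrow> (\<And>j. partial_deriv j v x = 0) \<Longrightarrow> F x = 0"
  shows "integrable (lebesgue_on \<Omega>) F"
proof -
  obtain K where K: "compact K" "K \<subseteq> \<Omega>" and "\<And>x. x \<notin> K \<Longrightarrow> v x = 0"
    "\<And>x j. x \<notin> K \<Longrightarrow> partial_deriv j v x = 0"
    using test_functions_support[OF v] by metis
  then show ?thesis using 0 by (intro integrable_compact_support[OF \<Omega> K F]) auto
qed

lemma continuous_on_vec_mult:
  assumes "\<And>j. continuous_on S (y j)" "continuous_on S w"
  shows "continuous_on S (\<lambda>x. vec_mult (\<lambda>j. y j x) (w x))"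
  unfolding vec_mult_def
  by (intro continuous_on_sum continuous_on_scaleR bounded_linear.continuous_on[OF bounded_linear_cl_gen_mult] assms)

lemma vec_mult_0: "vec_mult y 0 = 0"
  by (simp add: vec_mult_def linear_0[OF bounded_linear.linear[OF bounded_linear_cl_gen_mult]])

text \<open>The case of equal \<open>a\<^sub>j\<close>, in which the weighted identity has no error term.\<close>

lemma dirac_isotropic_identity:
  fixes v :: "'n::{finite,linorder} point \<Rightarrow> 'n clifford"
    and y :: "'n \<Rightarrow> 'n point \<Rightarrow> real" and a :: real
  assumes v: "v \<in> test_functions \<Omega>" and \<Omega>: "open \<Omega>"
    and y: "\<And>j. C1_partials \<Omega> (y j) (\<lambda>i x. if i = j then a else 0)"
    and g: "C1_partials \<Omega> g (\<lambda>i x. \<mu> x * y i x)"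
    and \<beta>: "C1_partials \<Omega> \<beta> b"
    and rel: "\<And>x. x \<in> \<Omega> \<Longrightarrow> g x * \<beta> x = \<mu> x * (\<Sum>j\<in>UNIV. (y j x)\<^sup>2) + g x * (real CARD('n) * a)"
  shows "(\<integral>x. g x * (\<Sum>j\<in>UNIV. (y j x)\<^sup>2) * (norm (dirac v x))\<^sup>2 \<partial>lebesgue_on \<Omega>) =
      (\<integral>x. g x * (norm (vec_mult (\<lambda>j. y j x) (dirac v x)
           + 2 *\<^sub>R (\<Sum>j\<in>UNIV. y j x *\<^sub>R partial_deriv j v x) + \<beta> x *\<^sub>R v x))\<^sup>2 \<partial>lebesgue_on \<Omega>)
      + (\<integral>x. g x * (\<Sum>j\<in>UNIV. b j x * y j x) * (norm (v x))\<^sup>2 \<partial>lebesgue_on \<Omega>)"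
    (is "integral\<^sup>L _ ?A = integral\<^sup>L _ ?Q + integral\<^sup>L _ ?B")
proof -
  note c = C1_partialsD(3)[OF y] C1_partialsD(3)[OF g] C1_partialsD(3)[OF \<beta>] C1_partialsD(2)[OF \<beta>]
    continuous_test_function[OF v]
  have A: "integrable (lebesgue_on \<Omega>) ?A"
    by (rule integrable_test[OF v \<Omega>]) (intro continuous_intros c, simp add: dirac_eq_0)
  have Q: "integrable (lebesgue_on \<Omega>) ?Q"
    by (rule integrable_test[OF v \<Omega>])
       (intro continuous_intros continuous_on_vec_mult c, simp add: dirac_eq_0 vec_mult_0)
  have B: "integrable (lebesgue_on \<Omega>) ?B"
    by (rule integrable_test[OF v \<Omega>]) (intro continuous_intros c, simp)
  have "has_bochner_integral (lebesgue_on \<Omega>) (\<lambda>x. ?A x - ?Q x - ?B x) 0"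
    using dirac_weighted_identity[OF v \<Omega> y g \<beta>] rel by simp
  then have "(\<integral>x. ?A x - ?Q x - ?B x \<partial>lebesgue_on \<Omega>) = 0"
    by (rule has_bochner_integral_integral_eq)
  then show ?thesis using A Q B by simp
qed

lemma C1_partials_norm_square: "C1_partials \<Omega> (\<lambda>x. (norm x)\<^sup>2) (\<lambda>j x::real^'n::finite. 2 * x $ j)"
proof -
  have "((\<lambda>x. (norm x)\<^sup>2) has_derivative (\<lambda>h. \<Sum>j\<in>UNIV. h $ j *\<^sub>R (2 * x $ j))) (at x)" for x :: "real^'n"
    unfolding power2_norm_eq_inner
    by (rule has_derivative_eq_rhs, (rule derivative_intros)+)
       (simp add: fun_eq_iff inner_vec_def sum_distrib_left sum.distrib[symmetric] algebra_simps)
  then show ?thesis by (auto simp: C1_partials_def intro!: continuous_intros)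
qed

lemma norm_square_eq_sum: "(norm x)\<^sup>2 = (\<Sum>j\<in>UNIV. (x $ j)\<^sup>2)" for x :: "real^'n::finite"
  by (simp only: power2_norm_eq_inner) (simp add: inner_vec_def power2_eq_square)

lemma norm_square_powr: "(norm x)\<^sup>2 powr (m / 2) = norm x powr m" for m :: real
proof (cases "x = 0")
  case False
  then have "(norm x)\<^sup>2 powr (m / 2) = (norm x powr 2) powr (m / 2)" by simp
  also have "\<dots> = norm x powr m" by (simp only: powr_powr) simp
  finally show ?thesis .
qed simp

text \<open>Stated as an equality, because sharpness depends on knowing exactly what the estimate loses. The
functions \<open>h\<close> and \<open>k\<close> in the proof are \<open>g = e\<^sup>\<phi>/|x|\<^sup>2\<close> and \<open>\<beta>\<close> as functions of \<open>t = |x|\<^sup>2\<close>.\<close>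

lemma radial_dirac_identity:
  fixes v :: "'n::{finite,linorder} point \<Rightarrow> 'n clifford" and m :: real
  assumes v: "v \<in> test_functions \<Omega>" and \<Omega>: "open \<Omega>" "\<Omega> \<subseteq> - {0}"
  shows "(\<integral>x. (norm (dirac v x))\<^sup>2 * exp (norm x powr m) \<partial>lebesgue_on \<Omega>) =
      (\<integral>x. exp (norm x powr m) / (norm x)\<^sup>2 * (norm (vec_mult (\<lambda>j. x $ j) (dirac v x)
           + 2 *\<^sub>R (\<Sum>j\<in>UNIV. x $ j *\<^sub>R partial_deriv j v x)
           + (m * norm x powr m + real CARD('n) - 2) *\<^sub>R v x))\<^sup>2 \<partial>lebesgue_on \<Omega>)
      + (\<integral>x. m\<^sup>2 * norm x powr (m - 2) * (norm (v x))\<^sup>2 * exp (norm x powr m) \<partial>lebesgue_on \<Omega>)"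
proof -
  let ?M = "lebesgue_on \<Omega>"
  define s where "s = m / 2"
  define h where "h t = exp (t powr s) / t" for t :: real
  define h' where "h' t = (exp (t powr s) * (s * t powr (s - 1)) * t - exp (t powr s)) / (t * t)" for t :: real
  define k where "k t = 2 * s * t powr s + (real CARD('n) - 2)" for t :: real
  define k' where "k' t = 2 * s * (s * t powr (s - 1))" for t :: real
  have pos: "(norm x)\<^sup>2 > 0" if "x \<in> \<Omega>" for x using that \<Omega>(2) by auto
  have dh: "(h has_real_derivative h' t) (at t)" if "t > 0" for t
    unfolding h_def h'_def using that
    by (auto intro!: derivative_eq_intros simp: powr_diff field_simps)
  have dk: "(k has_real_derivative k' t) (at t)" if "t > 0" for t
    unfolding k_def k'_def using that
    by (auto intro!: derivative_eq_intros simp: powr_diff field_simps)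
  have cn: "continuous_on \<Omega> (\<lambda>x. (norm x)\<^sup>2)" by (intro continuous_intros)
  have ch: "continuous_on {0<..} h'" "continuous_on {0<..} k'"
    unfolding h'_def k'_def by (auto intro!: continuous_intros)
  have cc: "continuous_on \<Omega> (\<lambda>x. h' ((norm x)\<^sup>2))" "continuous_on \<Omega> (\<lambda>x. k' ((norm x)\<^sup>2))"
    by (rule continuous_on_compose2[OF ch(1) cn], use pos in force)
       (rule continuous_on_compose2[OF ch(2) cn], use pos in force)
  have g: "C1_partials \<Omega> (\<lambda>x. h ((norm x)\<^sup>2)) (\<lambda>i x. (2 * h' ((norm x)\<^sup>2)) * x $ i)"
    using C1_partials_chain[OF C1_partials_norm_square, of \<Omega> h h'] dh pos cc by (simp add: mult_ac)
  have \<beta>: "C1_partials \<Omega> (\<lambda>x. k ((norm x)\<^sup>2)) (\<lambda>i x. k' ((norm x)\<^sup>2) * (2 * x $ i))"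
    using C1_partials_chain[OF C1_partials_norm_square, of \<Omega> k k'] dk pos cc by (simp add: mult_ac)
  have rel: "h t * k t = (2 * h' t) * t + h t * (real CARD('n) * 1)" if "t > 0" for t
  proof -
    have "t powr s = t powr (s - 1) * t" using that by (simp add: powr_diff)
    then show ?thesis unfolding h_def k_def h'_def using that by (simp add: field_simps)
  qed
  have y: "C1_partials \<Omega> (\<lambda>x. x $ j) (\<lambda>i x. if i = j then 1 else 0)" for j :: 'n
    by (rule C1_partials_coord)
  have kk: "k ((norm x)\<^sup>2) = m * norm x powr m + real CARD('n) - 2" for x :: "'n point"
    by (simp add: k_def s_def norm_square_powr)
  have 1: "h ((norm x)\<^sup>2) * (norm x)\<^sup>2 = exp (norm x powr m)" if "x \<in> \<Omega>" for x :: "'n point"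
    using pos[OF that] by (simp add: h_def s_def norm_square_powr)
  have quad: "(\<Sum>j\<in>UNIV. c * (2 * x $ j) * x $ j) = 2 * c * (norm x)\<^sup>2" for c and x :: "'n point"
    by (simp only: norm_square_eq_sum) (simp add: sum_distrib_left power2_eq_square mult_ac)
  have 2: "h ((norm x)\<^sup>2) * (\<Sum>j\<in>UNIV. k' ((norm x)\<^sup>2) * (2 * x $ j) * x $ j)
      = m\<^sup>2 * norm x powr (m - 2) * exp (norm x powr m)" if "x \<in> \<Omega>" for x :: "'n point"
  proof -
    have k'x: "k' ((norm x)\<^sup>2) = m\<^sup>2 / 2 * norm x powr (m - 2)"
      using norm_square_powr[of x "m - 2"] by (simp add: k'_def s_def power2_eq_square diff_divide_distrib)
    have "h ((norm x)\<^sup>2) * (2 * k' ((norm x)\<^sup>2) * (norm x)\<^sup>2)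
        = (h ((norm x)\<^sup>2) * (norm x)\<^sup>2) * (2 * k' ((norm x)\<^sup>2))" by simp
    then show ?thesis unfolding quad 1[OF that] k'x by simp
  qed
  have "(\<integral>x. (norm (dirac v x))\<^sup>2 * exp (norm x powr m) \<partial>?M)
      = (\<integral>x. h ((norm x)\<^sup>2) * (\<Sum>j\<in>UNIV. (x $ j)\<^sup>2) * (norm (dirac v x))\<^sup>2 \<partial>?M)"
    by (rule Bochner_Integration.integral_cong) (use 1 in \<open>simp_all add: norm_square_eq_sum[symmetric]\<close>)
  also have "\<dots> = (\<integral>x. h ((norm x)\<^sup>2) * (norm (vec_mult (\<lambda>j. x $ j) (dirac v x)
           + 2 *\<^sub>R (\<Sum>j\<in>UNIV. x $ j *\<^sub>R partial_deriv j v x) + k ((norm x)\<^sup>2) *\<^sub>R v x))\<^sup>2 \<partial>?M)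
      + (\<integral>x. h ((norm x)\<^sup>2) * (\<Sum>j\<in>UNIV. k' ((norm x)\<^sup>2) * (2 * x $ j) * x $ j) * (norm (v x))\<^sup>2 \<partial>?M)"
    by (rule dirac_isotropic_identity[OF v \<Omega>(1) y g \<beta>])
       (use rel pos in \<open>simp add: norm_square_eq_sum[symmetric]\<close>)
  also have "(\<integral>x. h ((norm x)\<^sup>2) * (\<Sum>j\<in>UNIV. k' ((norm x)\<^sup>2) * (2 * x $ j) * x $ j) * (norm (v x))\<^sup>2 \<partial>?M)
      = (\<integral>x. m\<^sup>2 * norm x powr (m - 2) * (norm (v x))\<^sup>2 * exp (norm x powr m) \<partial>?M)"
    by (rule Bochner_Integration.integral_cong) (use 2 in simp_all)
  finally show ?thesis unfolding kk by (simp add: h_def s_def norm_square_powr)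
qed

text \<open>The field \<open>y = e\<^sub>p\<close> is constant and vanishes nowhere, so \<open>g = e\<^sup>\<phi>\<close> is smooth and the estimate holds on
every open set.\<close>

lemma linear_dirac_estimate:
  fixes v :: "'n::{finite,linorder} point \<Rightarrow> 'n clifford" and p :: 'n
  assumes v: "v \<in> test_functions \<Omega>" and \<Omega>: "open \<Omega>"
  shows "(\<integral>x. 2 * (norm (v x))\<^sup>2 * exp ((x $ p)\<^sup>2) \<partial>lebesgue_on \<Omega>)
      \<le> (\<integral>x. (norm (dirac v x))\<^sup>2 * exp ((x $ p)\<^sup>2) \<partial>lebesgue_on \<Omega>)"
proof -
  let ?M = "lebesgue_on \<Omega>"
  define y where "y j x = (if j = p then 1 else 0 :: real)" for j and x :: "'n point"
  have y: "C1_partials \<Omega> (y j) (\<lambda>i x. if i = j then 0 else 0)" for j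
    unfolding y_def by (simp add: C1_partials_const)
  have g: "C1_partials \<Omega> (\<lambda>x. exp ((x $ p)\<^sup>2)) (\<lambda>i x. (exp ((x $ p)\<^sup>2) * (2 * x $ p)) * y i x)"
    unfolding y_def
    by (rule C1_partials_chain[OF C1_partials_coord, where h="\<lambda>t. exp (t\<^sup>2)" and h'="\<lambda>t. exp (t\<^sup>2) * (2 * t)"])
       (auto intro!: derivative_eq_intros continuous_intros)
  have \<beta>: "C1_partials \<Omega> (\<lambda>x. 2 * x $ p) (\<lambda>i x. 2 * y i x)"
    unfolding y_def by (rule C1_partials_linear[OF bounded_linear_mult_right C1_partials_coord])
  have s: "(\<Sum>j\<in>UNIV. (y j x)\<^sup>2) = 1" "(\<Sum>j\<in>UNIV. 2 * y j x * y j x) = 2" for x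
  proof -
    have "(y j x)\<^sup>2 = (if j = p then 1 else 0)" "2 * y j x * y j x = (if j = p then 2 else 0)" for j
      by (simp_all add: y_def)
    then show "(\<Sum>j\<in>UNIV. (y j x)\<^sup>2) = 1" "(\<Sum>j\<in>UNIV. 2 * y j x * y j x) = 2" by simp_all
  qed
  have "(\<integral>x. 2 * (norm (v x))\<^sup>2 * exp ((x $ p)\<^sup>2) \<partial>?M)
      = (\<integral>x. exp ((x $ p)\<^sup>2) * (\<Sum>j\<in>UNIV. 2 * y j x * y j x) * (norm (v x))\<^sup>2 \<partial>?M)"
    unfolding s by (simp add: mult_ac)
  also have "\<dots> \<le> (\<integral>x. exp ((x $ p)\<^sup>2) * (\<Sum>j\<in>UNIV. (y j x)\<^sup>2) * (norm (dirac v x))\<^sup>2 \<partial>?M)"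
    by (subst dirac_isotropic_identity[OF v \<Omega> y g \<beta>]) (simp_all add: s)
  also have "\<dots> = (\<integral>x. (norm (dirac v x))\<^sup>2 * exp ((x $ p)\<^sup>2) \<partial>?M)"
    unfolding s by (simp add: mult_ac)
  finally show ?thesis .
qed

section \<open>Estimate for nearly isotropic quadratic weights\<close>

lemma norm_dirac_square:
  "(norm (dirac v x))\<^sup>2 = (\<Sum>j\<in>UNIV. (norm (partial_deriv j v x))\<^sup>2)
    - (\<Sum>j\<in>UNIV. \<Sum>k\<in>-{j}. partial_deriv j v x \<bullet> (cl_pair j k (partial_deriv k v x)))"
proof -
  define d where "d j = partial_deriv j v x" for j
  have "(norm (dirac v x))\<^sup>2 = (\<Sum>j\<in>UNIV. \<Sum>k\<in>UNIV. - (d j \<bullet> (cl_pair j k (d k))))"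
    unfolding dirac_def power2_norm_eq_inner inner_sum_left inner_sum_right cl_gen_inner_cl_gen d_def
    by (rule sum.swap)
  also have "\<dots> = (\<Sum>j\<in>UNIV. (norm (d j))\<^sup>2 - (\<Sum>k\<in>-{j}. d j \<bullet> (cl_pair j k (d k))))"
  proof (rule sum.cong[OF refl])
    fix j
    show "(\<Sum>k\<in>UNIV. - (d j \<bullet> (cl_pair j k (d k))))
        = (norm (d j))\<^sup>2 - (\<Sum>k\<in>-{j}. d j \<bullet> (cl_pair j k (d k)))"
      by (simp add: sum.remove[of UNIV j] Compl_eq_Diff_UNIV cl_gen_square_mult power2_norm_eq_inner sum_negf)
  qed
  finally show ?thesis by (simp add: sum_subtractf d_def)
qed

text \<open>The Dirac operator controls the full gradient: \<open>|Dv|\<^sup>2\<close> and \<open>|\<nabla>v|\<^sup>2\<close> differ by terms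
\<open>\<langle>\<partial>\<^sub>j v, e\<^sub>j e\<^sub>k \<partial>\<^sub>k v\<rangle>\<close> with \<open>j \<noteq> k\<close>, which integrate by parts to terms of first order.\<close>

lemma gradient_dirac_identity:
  assumes v: "v \<in> test_functions \<Omega>" and \<Omega>: "open \<Omega>" and g: "C1_partials \<Omega> g \<gamma>"
  shows "has_bochner_integral (lebesgue_on \<Omega>) (\<lambda>x.
      2 * g x * ((\<Sum>j\<in>UNIV. (norm (partial_deriv j v x))\<^sup>2) - (norm (dirac v x))\<^sup>2)
      + (\<Sum>j\<in>UNIV. \<Sum>k\<in>-{j}. \<gamma> j x * (v x \<bullet> (cl_pair j k (partial_deriv k v x)))
          - \<gamma> k x * (v x \<bullet> (cl_pair j k (partial_deriv j v x))))) 0"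
    (is "has_bochner_integral _ ?R 0")
proof -
  define X where "X x = (\<Sum>j\<in>UNIV. \<Sum>k\<in>-{j}.
      2 * g x * (partial_deriv j v x \<bullet> (cl_pair j k (partial_deriv k v x)))
      + \<gamma> j x * (v x \<bullet> (cl_pair j k (partial_deriv k v x)))
      - \<gamma> k x * (v x \<bullet> (cl_pair j k (partial_deriv j v x))))" for x
  have "has_bochner_integral (lebesgue_on \<Omega>) X (\<Sum>j\<in>(UNIV::'a set). \<Sum>k\<in>-{j}. 0)"
    unfolding X_def by (intro has_bochner_integral_sum spin_pair_by_parts[OF v \<Omega> g]) auto
  then have "has_bochner_integral (lebesgue_on \<Omega>) X 0" by simp
  moreover have "X = ?R"
    unfolding X_def norm_dirac_square
    by (rule ext) (simp add: sum.distrib sum_subtractf sum_distrib_left algebra_simps)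
  ultimately show ?thesis by (simp only:)
qed

lemma abs_inner_cl_pair: "\<bar>v \<bullet> (cl_pair j k w)\<bar> \<le> norm v * norm w"
  using Cauchy_Schwarz_ineq2[of v "cl_pair j k w"] by (simp add: norm_cl_gen_mult)

lemma sum_prod_young:
  fixes y d :: "'n::finite \<Rightarrow> real"
  assumes "c > 0"
  shows "2 * (\<Sum>j\<in>UNIV. \<Sum>k\<in>UNIV. \<bar>y j\<bar> * \<bar>d k\<bar>)
    \<le> real CARD('n) * (c * (\<Sum>j\<in>UNIV. (y j)\<^sup>2) + (\<Sum>k\<in>UNIV. (d k)\<^sup>2) / c)"
proof -
  have "2 * (\<bar>s\<bar> * \<bar>t\<bar>) \<le> c * s\<^sup>2 + t\<^sup>2 / c" for s t
  proof -
    have "0 \<le> (sqrt c * \<bar>s\<bar> - \<bar>t\<bar> / sqrt c)\<^sup>2" by simp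
    also have "\<dots> = c * s\<^sup>2 + t\<^sup>2 / c - 2 * (\<bar>s\<bar> * \<bar>t\<bar>)"
      using assms by (simp add: power2_diff power_mult_distrib power_divide)
    finally show ?thesis by simp
  qed
  then have "2 * (\<Sum>j\<in>UNIV. \<Sum>k\<in>UNIV. \<bar>y j\<bar> * \<bar>d k\<bar>) \<le> (\<Sum>j\<in>UNIV. \<Sum>k\<in>UNIV. c * (y j)\<^sup>2 + (d k)\<^sup>2 / c)"
    unfolding sum_distrib_left by (intro sum_mono)
  also have "\<dots> = real CARD('n) * (c * (\<Sum>j\<in>UNIV. (y j)\<^sup>2) + (\<Sum>k\<in>UNIV. (d k)\<^sup>2) / c)"
    by (simp add: sum.distrib sum_distrib_left[symmetric] sum_divide_distrib[symmetric] algebra_simps)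
  finally show ?thesis .
qed


text \<open>At \<open>a = 1\<close> one has \<open>\<phi> = Y = Z\<close> and the last expression equals \<open>4\<close>. It is \<open>4q + 4(s\<^sup>2 - q)/\<phi>\<close> with
\<open>s = Y/\<phi>\<close> and \<open>q = Z/\<phi>\<close> both close to \<open>1\<close>; the lower bound for \<open>\<phi>\<close>, where the unit ball is avoided,
keeps the second summand small.\<close>

lemma quadratic_weight_bounds:
  fixes a x :: "'n::finite \<Rightarrow> real" and \<epsilon> :: real
  defines "\<phi> \<equiv> \<Sum>i\<in>UNIV. a i * (x i)\<^sup>2" and "Y \<equiv> \<Sum>i\<in>UNIV. (a i * x i)\<^sup>2"
    and "Z \<equiv> \<Sum>i\<in>UNIV. a i * (a i * x i)\<^sup>2"
  assumes e: "0 < \<epsilon>" "\<epsilon> \<le> 1/10" and a: "\<And>i. \<bar>a i - 1\<bar> \<le> \<epsilon>" and x: "1 \<le> (\<Sum>i\<in>UNIV. (x i)\<^sup>2)"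
  shows "1/2 \<le> \<phi>" and "Y \<le> (1 + \<epsilon>) * \<phi>"
    and "4 - 40 * \<epsilon> \<le> (4 * (1 - 1 / \<phi>) * Z + 4 * Y\<^sup>2 / \<phi>\<^sup>2) / \<phi>"
proof -
  have a': "1 - \<epsilon> \<le> a i" "a i \<le> 1 + \<epsilon>" for i using a[of i] by (auto simp: abs_le_iff)
  have "(1 - \<epsilon>) * (\<Sum>i\<in>UNIV. (x i)\<^sup>2) \<le> \<phi>"
    unfolding \<phi>_def sum_distrib_left by (intro sum_mono mult_right_mono a') auto
  moreover have "(1 - \<epsilon>) * 1 \<le> (1 - \<epsilon>) * (\<Sum>i\<in>UNIV. (x i)\<^sup>2)"
    using x e by (intro mult_left_mono) auto
  ultimately have \<phi>: "1 - \<epsilon> \<le> \<phi>" by simp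
  then show \<phi>2: "1/2 \<le> \<phi>" using e by simp
  then have pos: "0 < \<phi>" by simp
  have sq: "(a i * x i)\<^sup>2 = a i * (a i * (x i)\<^sup>2)" for i by (simp add: power2_eq_square)
  have ai: "0 \<le> a i" for i using a'(1)[of i] e by simp
  have Y: "(1 - \<epsilon>) * \<phi> \<le> Y" "Y \<le> (1 + \<epsilon>) * \<phi>"
    unfolding Y_def \<phi>_def sum_distrib_left sq using ai by (auto intro!: sum_mono mult_right_mono a')
  then show "Y \<le> (1 + \<epsilon>) * \<phi>" by simp
  have Z: "(1 - \<epsilon>) * Y \<le> Z" "Z \<le> (1 + \<epsilon>) * Y"
    unfolding Y_def Z_def sum_distrib_left by (auto intro!: sum_mono mult_right_mono a')
  define s where "s = Y / \<phi>"
  define q where "q = Z / \<phi>"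
  have s: "1 - \<epsilon> \<le> s" "s \<le> 1 + \<epsilon>" using Y pos by (simp_all add: s_def field_simps)
  have q: "(1 - \<epsilon>) * s \<le> q" "q \<le> (1 + \<epsilon>) * s" using divide_right_mono[OF Z(1), of \<phi>] divide_right_mono[OF Z(2), of \<phi>] pos by (simp_all add: s_def q_def)
  have s2: "(1 - \<epsilon>) * (1 - \<epsilon>) \<le> s * s" by (intro mult_mono s) (use s e in auto)
  have q2: "(1 - \<epsilon>) * (1 - \<epsilon>) \<le> q"
    by (rule order_trans[OF mult_left_mono[OF s(1)] q(1)]) (use e in simp)
  have q3: "q \<le> (1 + \<epsilon>) * (1 + \<epsilon>)"
    by (rule order_trans[OF q(2) mult_left_mono[OF s(2)]]) (use e in simp)
  have "(4 * (1 - 1 / \<phi>) * Z + 4 * Y\<^sup>2 / \<phi>\<^sup>2) / \<phi> = 4 * q + 4 * ((s * s - q) / \<phi>)"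
    using pos by (simp add: s_def q_def field_simps power2_eq_square)
  moreover have "- 4 * \<epsilon> \<le> s * s - q" using s2 q3 by (simp add: algebra_simps)
  then have "- 4 * \<epsilon> / \<phi> \<le> (s * s - q) / \<phi>" using pos by (intro divide_right_mono) auto
  moreover have "- 8 * \<epsilon> \<le> - 4 * \<epsilon> / \<phi>" using \<phi>2 pos e by (simp add: field_simps)
  moreover have "4 - 8 * \<epsilon> \<le> 4 * q"
  proof -
    have "1 - 2 * \<epsilon> \<le> (1 - \<epsilon>) * (1 - \<epsilon>)" by (simp add: algebra_simps)
    then show ?thesis using q2 by simp
  qed
  ultimately show "4 - 40 * \<epsilon> \<le> (4 * (1 - 1 / \<phi>) * Z + 4 * Y\<^sup>2 / \<phi>\<^sup>2) / \<phi>" by linarith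
qed

text \<open>Integrated pointwise inequality: \<open>R\<close> is the integrand of the weighted identity and \<open>N\<close> that of the
gradient identity, both with integral zero. The error term in \<open>R\<close> is at most
\<open>2 \<epsilon> n (2V + g|\<nabla>v|\<^sup>2)\<close>, and \<open>N\<close> is used to trade \<open>g|\<nabla>v|\<^sup>2\<close> for \<open>4I + 8n\<^sup>2V\<close>. This costs multiples of
\<open>\<epsilon> n\<^sup>3\<close> at most, whence the size of \<open>\<epsilon>\<close>.\<close>

lemma quadratic_dirac_estimate:
  fixes v :: "'n::{finite,linorder} point \<Rightarrow> 'n clifford" and a :: "'n \<Rightarrow> real"
  assumes v: "v \<in> test_functions \<Omega>" and \<Omega>: "open \<Omega>" "\<Omega> \<subseteq> - ball 0 1"
    and a: "\<And>i. \<bar>a i - 1\<bar> \<le> 1 / (200 * real CARD('n) ^ 3)"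
  defines "\<phi> \<equiv> (\<lambda>x::'n point. \<Sum>i\<in>UNIV. a i * (x $ i)\<^sup>2)"
  shows "(\<integral>x. 3 * (norm (v x))\<^sup>2 * exp (\<phi> x) \<partial>lebesgue_on \<Omega>)
      \<le> (\<integral>x. (norm (dirac v x))\<^sup>2 * exp (\<phi> x) \<partial>lebesgue_on \<Omega>)"
proof -
  let ?M = "lebesgue_on \<Omega>"
  define n where "n = real CARD('n)"
  define \<epsilon> where "\<epsilon> = 1 / (200 * n ^ 3)"
  have n1: "1 \<le> n" by (simp add: n_def Suc_leI)
  have n3: "\<epsilon> * n ^ 3 = 1/200" using n1 by (simp add: \<epsilon>_def)
  have e0: "0 < \<epsilon>" using n1 by (simp add: \<epsilon>_def)
  have en: "\<epsilon> \<le> 1/200" "\<epsilon> * n \<le> 1/200"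
  proof -
    have "\<epsilon> * 1 \<le> \<epsilon> * n ^ 3" "\<epsilon> * n \<le> \<epsilon> * n ^ 3"
      using e0 n1 self_le_power[OF n1, of 3] by (auto intro!: mult_left_mono)
    then show "\<epsilon> \<le> 1/200" "\<epsilon> * n \<le> 1/200" unfolding n3 by simp_all
  qed
  have a': "\<bar>a i - 1\<bar> \<le> \<epsilon>" for i using a by (simp add: \<epsilon>_def n_def)
  define y where "y j x = a j * x $ j" for j and x :: "'n point"
  define Y where "Y x = (\<Sum>j\<in>UNIV. (y j x)\<^sup>2)" for x
  define Z where "Z x = (\<Sum>j\<in>UNIV. a j * (y j x)\<^sup>2)" for x
  define T where "T = (\<Sum>j\<in>UNIV. a j)"
  define g where "g x = exp (\<phi> x) / \<phi> x" for x
  define \<mu> where "\<mu> x = 2 * (exp (\<phi> x) / \<phi> x - exp (\<phi> x) / (\<phi> x)\<^sup>2)" for x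
  define \<beta> where "\<beta> x = 2 * (1 - 1 / \<phi> x) * Y x + T" for x
  define b where "b i x = 2 * (1 - 1 / \<phi> x) * (2 * a i * y i x) + 2 * (2 * y i x / (\<phi> x)\<^sup>2) * Y x" for i x
  have x1: "1 \<le> (\<Sum>i\<in>UNIV. (x $ i)\<^sup>2)" if "x \<in> \<Omega>" for x
  proof -
    have "1 \<le> norm x" using that \<Omega>(2) by auto
    then show ?thesis by (simp add: norm_square_eq_sum[symmetric] one_le_power)
  qed
  note bounds = quadratic_weight_bounds[OF e0 _ a' x1]
  have \<phi>2: "1/2 \<le> \<phi> x" if "x \<in> \<Omega>" for x
    unfolding \<phi>_def by (rule bounds(1)) (use that en in auto)
  have Y2: "Y x \<le> (1 + \<epsilon>) * \<phi> x" if "x \<in> \<Omega>" for x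
    unfolding \<phi>_def Y_def y_def by (rule bounds(2)) (use that en in auto)
  have B2: "4 - 40 * \<epsilon> \<le> (4 * (1 - 1 / \<phi> x) * Z x + 4 * (Y x)\<^sup>2 / (\<phi> x)\<^sup>2) / \<phi> x" if "x \<in> \<Omega>" for x
    unfolding \<phi>_def Y_def Z_def y_def by (rule bounds(3)) (use that en in auto)
  have pos: "0 < \<phi> x" if "x \<in> \<Omega>" for x using \<phi>2[OF that] by simp
  have y: "C1_partials \<Omega> (y j) (\<lambda>i x. if i = j then a j else 0)" for j
    unfolding y_def
    using C1_partials_linear[OF bounded_linear_mult_right[of "a j"] C1_partials_coord[of \<Omega> j]]
    by (simp add: if_distrib cong: if_cong)
  have sum_C1: "C1_partials \<Omega> (\<lambda>x. \<Sum>i\<in>UNIV. c i * (x $ i)\<^sup>2) (\<lambda>j x. 2 * c j * x $ j)" for c :: "'n \<Rightarrow> real"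
  proof -
    have "((\<lambda>x. \<Sum>i\<in>UNIV. c i * (x $ i)\<^sup>2) has_derivative (\<lambda>h. \<Sum>j\<in>UNIV. h $ j *\<^sub>R (2 * c j * x $ j))) (at x)"
      for x :: "'n point"
      by (rule has_derivative_eq_rhs, (rule derivative_intros bounded_linear.has_derivative[OF bounded_linear_vec_nth])+)
         (simp add: fun_eq_iff mult_ac)
    then show ?thesis by (auto simp: C1_partials_def intro!: continuous_intros)
  qed
  have C\<phi>: "C1_partials \<Omega> \<phi> (\<lambda>i x. 2 * y i x)"
    unfolding \<phi>_def y_def using sum_C1[of a] by (simp add: mult_ac)
  have CY: "C1_partials \<Omega> Y (\<lambda>i x. 2 * a i * y i x)"
    unfolding Y_def y_def power_mult_distrib using sum_C1[of "\<lambda>i. (a i)\<^sup>2"] by (simp add: power2_eq_square mult_ac)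
  have c\<phi>: "continuous_on \<Omega> \<phi>" using C1_partialsD(3)[OF C\<phi>] .
  have ne: "\<phi> x \<noteq> 0" if "x \<in> \<Omega>" for x using pos[OF that] by simp
  have Cg: "C1_partials \<Omega> g (\<lambda>i x. \<mu> x * y i x)"
  proof -
    have "C1_partials \<Omega> (\<lambda>x. (\<lambda>t. exp t / t) (\<phi> x)) (\<lambda>i x. (\<lambda>t. exp t / t - exp t / t\<^sup>2) (\<phi> x) * (2 * y i x))"
      by (rule C1_partials_chain[OF C\<phi>])
         (use ne in \<open>auto intro!: derivative_eq_intros continuous_intros c\<phi> simp: field_simps power2_eq_square\<close>)
    then show ?thesis by (simp add: g_def[abs_def] \<mu>_def algebra_simps)
  qed
  have Cbe: "C1_partials \<Omega> \<beta> b"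
  proof -
    have 1: "C1_partials \<Omega> (\<lambda>x. (\<lambda>t. 2 * (1 - 1 / t)) (\<phi> x)) (\<lambda>i x. (\<lambda>t. 2 / t\<^sup>2) (\<phi> x) * (2 * y i x))"
      by (rule C1_partials_chain[OF C\<phi>])
         (use ne in \<open>auto intro!: derivative_eq_intros continuous_intros c\<phi> simp: field_simps power2_eq_square\<close>)
    show ?thesis
      by (rule C1_partials_cong[OF C1_partials_add[OF C1_partials_mult[OF 1 CY] C1_partials_const[of \<Omega> T]] \<Omega>(1)])
         (simp_all add: \<beta>_def b_def algebra_simps)
  qed
  have rel: "g x * \<beta> x = \<mu> x * (\<Sum>j\<in>UNIV. (y j x)\<^sup>2) + g x * (\<Sum>j\<in>UNIV. a j)" if "x \<in> \<Omega>" for x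
    using ne[OF that] by (simp add: g_def \<beta>_def \<mu>_def Y_def T_def field_simps power2_eq_square)
  have bsum: "(\<Sum>j\<in>UNIV. b j x * y j x) = 4 * (1 - 1 / \<phi> x) * Z x + 4 * (Y x)\<^sup>2 / (\<phi> x)\<^sup>2" for x
  proof -
    have "(\<Sum>j\<in>UNIV. b j x * y j x) = (\<Sum>j\<in>UNIV. 4 * (1 - 1 / \<phi> x) * (a j * (y j x)\<^sup>2)
        + 4 * Y x / (\<phi> x)\<^sup>2 * (y j x)\<^sup>2)"
      by (intro sum.cong refl) (simp add: b_def power2_eq_square algebra_simps)
    also have "\<dots> = 4 * (1 - 1 / \<phi> x) * Z x + 4 * Y x / (\<phi> x)\<^sup>2 * Y x"
      by (simp only: sum.distrib sum_distrib_left[symmetric] Z_def Y_def)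
    finally show ?thesis by (simp add: power2_eq_square)
  qed
  define R where "R x =
      g x * (\<Sum>j\<in>UNIV. (y j x)\<^sup>2) * (norm (dirac v x))\<^sup>2
      - g x * (norm (vec_mult (\<lambda>j. y j x) (dirac v x)
           + 2 *\<^sub>R (\<Sum>j\<in>UNIV. y j x *\<^sub>R partial_deriv j v x) + \<beta> x *\<^sub>R v x))\<^sup>2
      - g x * (\<Sum>j\<in>UNIV. b j x * y j x) * (norm (v x))\<^sup>2
      + 2 * g x * (\<Sum>j\<in>UNIV. \<Sum>k\<in>-{j}. (a k - a j) * y j x *
            (v x \<bullet> (cl_pair j k (partial_deriv k v x))))" for x
  define N where "N x = 2 * g x * ((\<Sum>j\<in>UNIV. (norm (partial_deriv j v x))\<^sup>2) - (norm (dirac v x))\<^sup>2)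
      + (\<Sum>j\<in>UNIV. \<Sum>k\<in>-{j}. (\<mu> x * y j x) * (v x \<bullet> (cl_pair j k (partial_deriv k v x)))
          - (\<mu> x * y k x) * (v x \<bullet> (cl_pair j k (partial_deriv j v x))))" for x
  have hR: "has_bochner_integral ?M R 0"
    unfolding R_def by (rule dirac_weighted_identity[OF v \<Omega>(1) y Cg Cbe rel])
  have hN: "has_bochner_integral ?M N 0"
    unfolding N_def by (rule gradient_dirac_identity[OF v \<Omega>(1) Cg])
  define I where "I x = (norm (dirac v x))\<^sup>2 * exp (\<phi> x)" for x
  define V where "V x = (norm (v x))\<^sup>2 * exp (\<phi> x)" for x
  have iI: "integrable ?M I" unfolding I_def
    by (rule integrable_test[OF v \<Omega>(1)])
       (intro continuous_intros c\<phi> continuous_test_function[OF v], simp add: dirac_eq_0)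
  have iV: "integrable ?M V" unfolding V_def
    by (rule integrable_test[OF v \<Omega>(1)])
       (intro continuous_intros c\<phi> continuous_test_function[OF v], simp)
  have main: "R x \<le> (1 + \<epsilon> + 8 * (\<epsilon> * n)) * I x - (4 - 40 * \<epsilon> - 4 * (\<epsilon> * n) - 16 * (\<epsilon> * n ^ 3)) * V x + 2 * (\<epsilon> * n) * N x"
    if x: "x \<in> \<Omega>" for x
  proof -
    define G where "G = (\<Sum>j\<in>UNIV. (norm (partial_deriv j v x))\<^sup>2)"
    define P where "P = (\<Sum>j\<in>UNIV. \<Sum>k\<in>UNIV. \<bar>y j x\<bar> * norm (v x) * norm (partial_deriv k v x))"
    have \<phi>0: "0 < \<phi> x" "1/2 \<le> \<phi> x" using pos[OF x] \<phi>2[OF x] by auto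
    have g0: "0 \<le> g x" using \<phi>0 by (simp add: g_def)
    have ge: "g x \<le> 2 * exp (\<phi> x)" using \<phi>0 by (simp add: g_def field_simps)
    have gY: "g x * Y x \<le> (1 + \<epsilon>) * exp (\<phi> x)"
    proof -
      have "Y x / \<phi> x \<le> 1 + \<epsilon>" using Y2[OF x] \<phi>0 by (simp add: pos_divide_le_eq)
      from mult_right_mono[OF this, of "exp (\<phi> x)"] show ?thesis by (simp add: g_def mult.commute)
    qed
    have gY2: "g x * Y x \<le> 2 * exp (\<phi> x)"
      by (rule order_trans[OF gY]) (use en in simp)
    have gB: "(4 - 40 * \<epsilon>) * exp (\<phi> x) \<le> g x * (\<Sum>j\<in>UNIV. b j x * y j x)"
      using mult_right_mono[OF B2[OF x], of "exp (\<phi> x)"] by (simp add: g_def bsum mult.commute)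
    have lamg: "\<bar>\<mu> x\<bar> \<le> 2 * g x"
    proof -
      have "\<mu> x = 2 * g x * (1 - 1 / \<phi> x)" using \<phi>0 by (simp add: \<mu>_def g_def field_simps power2_eq_square)
      moreover have "\<bar>1 - 1 / \<phi> x\<bar> \<le> 1" using \<phi>0 by (auto simp: abs_le_iff field_simps)
      ultimately show ?thesis using g0 mult_left_mono[of "\<bar>1 - 1 / \<phi> x\<bar>" 1 "2 * g x"] by (simp add: abs_mult)
    qed
    \<comment> \<open>The weight \<open>c\<close> is \<open>1\<close> for the error term and \<open>2n\<close> where \<open>G\<close> has to be absorbed.\<close>
    have young: "2 * P \<le> n * (c * (Y x * (norm (v x))\<^sup>2) + G / c)" if "c > 0" for c
    proof -
      have "P = (\<Sum>j\<in>UNIV. \<Sum>k\<in>UNIV. \<bar>y j x * norm (v x)\<bar> * \<bar>norm (partial_deriv k v x)\<bar>)"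
        by (simp add: P_def abs_mult)
      moreover have "(\<Sum>j\<in>UNIV. (y j x * norm (v x))\<^sup>2) = Y x * (norm (v x))\<^sup>2"
        by (simp add: power_mult_distrib Y_def sum_distrib_right)
      ultimately show ?thesis
        using sum_prod_young[OF that, of "\<lambda>j. y j x * norm (v x)" "\<lambda>k. norm (partial_deriv k v x)"]
        by (simp add: n_def G_def)
    qed
    have cross: "\<bar>\<Sum>j\<in>UNIV. \<Sum>k\<in>-{j}. c j k * y j x * (v x \<bullet> (cl_pair j k (partial_deriv k v x)))\<bar>
        \<le> M * P" if c: "\<And>j k. \<bar>c j k\<bar> \<le> M" and M: "0 \<le> M" for c :: "'n \<Rightarrow> 'n \<Rightarrow> real" and M
    proof -
      have "\<bar>\<Sum>j\<in>UNIV. \<Sum>k\<in>-{j}. c j k * y j x * (v x \<bullet> (cl_pair j k (partial_deriv k v x)))\<bar>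
        \<le> (\<Sum>j\<in>UNIV. \<Sum>k\<in>-{j}. \<bar>c j k * y j x * (v x \<bullet> (cl_pair j k (partial_deriv k v x)))\<bar>)"
        by (rule order_trans[OF sum_abs]) (intro sum_mono sum_abs)
      also have "\<dots> \<le> (\<Sum>j\<in>UNIV. \<Sum>k\<in>-{j}. M * (\<bar>y j x\<bar> * norm (v x) * norm (partial_deriv k v x)))"
        unfolding abs_mult mult.assoc
        by (intro sum_mono mult_mono c abs_inner_cl_pair order_refl) (auto intro: M)
      also have "\<dots> \<le> (\<Sum>j\<in>UNIV. \<Sum>k\<in>UNIV. M * (\<bar>y j x\<bar> * norm (v x) * norm (partial_deriv k v x)))"
        by (intro sum_mono sum_mono2) (auto intro!: mult_nonneg_nonneg M)
      finally show ?thesis by (simp add: P_def sum_distrib_left)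
    qed
    have P0: "0 \<le> P" unfolding P_def by (intro sum_nonneg mult_nonneg_nonneg) auto
    have G0: "0 \<le> G" unfolding G_def by (intro sum_nonneg) auto
    have grad: "g x * G \<le> 4 * I x + 8 * n\<^sup>2 * V x + N x"
    proof -
      define A1 where "A1 = (\<Sum>j\<in>UNIV. \<Sum>k\<in>-{j}. \<mu> x * y j x * (v x \<bullet> (cl_pair j k (partial_deriv k v x))))"
      define A2 where "A2 = (\<Sum>j\<in>UNIV. \<Sum>k\<in>-{j}. \<mu> x * y k x * (v x \<bullet> (cl_pair j k (partial_deriv j v x))))"
      have A1: "\<bar>A1\<bar> \<le> 2 * g x * P" unfolding A1_def by (rule cross) (use lamg g0 in auto)
      have "A2 = - A1"
      proof -
        have "A1 + A2 = (\<Sum>j\<in>UNIV. \<Sum>k\<in>-{j}. \<mu> x * y j x * (v x \<bullet> (cl_pair j k (partial_deriv k v x)))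
            + \<mu> x * y k x * (v x \<bullet> (cl_pair j k (partial_deriv j v x))))"
          by (simp add: A1_def A2_def sum.distrib)
        also have "\<dots> = 0"
        proof (rule sum_pair_antisym)
          fix j k :: 'n assume "j \<noteq> k"
          then show "\<mu> x * y j x * (v x \<bullet> (cl_pair j k (partial_deriv k v x)))
            + \<mu> x * y k x * (v x \<bullet> (cl_pair j k (partial_deriv j v x)))
            = - (\<mu> x * y k x * (v x \<bullet> (cl_pair k j (partial_deriv j v x)))
            + \<mu> x * y j x * (v x \<bullet> (cl_pair k j (partial_deriv k v x))))"
            using cl_gen_anticommute_mult[of j k "partial_deriv k v x"]
              cl_gen_anticommute_mult[of j k "partial_deriv j v x"] by simp
        qed
        finally show ?thesis by simp
      qed
      then have "N x = 2 * g x * (G - (norm (dirac v x))\<^sup>2) + 2 * A1"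
        by (simp add: N_def G_def A1_def A2_def sum_subtractf)
      then have 1: "2 * (g x * G) \<le> 2 * (g x * (norm (dirac v x))\<^sup>2) + N x + 2 * (g x * (2 * P))"
        using A1 by (simp add: algebra_simps abs_le_iff)
      have "2 * P \<le> n * (2 * n * (Y x * (norm (v x))\<^sup>2) + G / (2 * n))"
        by (rule young) (use n1 in simp)
      also have "\<dots> = 2 * n\<^sup>2 * (Y x * (norm (v x))\<^sup>2) + G / 2"
        using n1 by (simp add: field_simps power2_eq_square)
      finally have "g x * (2 * P) \<le> g x * (2 * n\<^sup>2 * (Y x * (norm (v x))\<^sup>2) + G / 2)"
        using g0 by (rule mult_left_mono)
      also have "\<dots> = 2 * n\<^sup>2 * (g x * Y x * (norm (v x))\<^sup>2) + g x * G / 2" by (simp add: algebra_simps)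
      also have "2 * n\<^sup>2 * (g x * Y x * (norm (v x))\<^sup>2) \<le> 2 * n\<^sup>2 * (2 * exp (\<phi> x) * (norm (v x))\<^sup>2)"
        by (intro mult_left_mono mult_right_mono gY2) auto
      finally have 2: "g x * (2 * P) \<le> 4 * n\<^sup>2 * V x + g x * G / 2" by (simp add: V_def algebra_simps)
      have 3: "g x * (norm (dirac v x))\<^sup>2 \<le> 2 * I x"
        using mult_right_mono[OF ge, of "(norm (dirac v x))\<^sup>2"] by (simp add: I_def mult_ac)
      show ?thesis using 1 2 3 by linarith
    qed
    have err: "2 * g x * (\<Sum>j\<in>UNIV. \<Sum>k\<in>-{j}. (a k - a j) * y j x *
            (v x \<bullet> (cl_pair j k (partial_deriv k v x))))
        \<le> 2 * (\<epsilon> * n) * (2 * V x + g x * G)"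
    proof -
      have "\<bar>a k - a j\<bar> \<le> 2 * \<epsilon>" for j k using a'[of j] a'[of k] by (simp add: abs_le_iff)
      then have "\<bar>\<Sum>j\<in>UNIV. \<Sum>k\<in>-{j}. (a k - a j) * y j x *
            (v x \<bullet> (cl_pair j k (partial_deriv k v x)))\<bar> \<le> 2 * \<epsilon> * P"
        using e0 by (intro cross) auto
      then have "(\<Sum>j\<in>UNIV. \<Sum>k\<in>-{j}. (a k - a j) * y j x *
            (v x \<bullet> (cl_pair j k (partial_deriv k v x)))) \<le> \<epsilon> * (2 * P)"
        by (simp add: abs_le_iff)
      also have "\<dots> \<le> \<epsilon> * (n * (1 * (Y x * (norm (v x))\<^sup>2) + G / 1))"
        by (intro mult_left_mono young) (use e0 in auto)
      finally have "2 * g x * (\<Sum>j\<in>UNIV. \<Sum>k\<in>-{j}. (a k - a j) * y j x *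
            (v x \<bullet> (cl_pair j k (partial_deriv k v x))))
          \<le> 2 * g x * (\<epsilon> * (n * (1 * (Y x * (norm (v x))\<^sup>2) + G / 1)))"
        using g0 by (intro mult_left_mono) auto
      also have "\<dots> = 2 * (\<epsilon> * n) * (g x * Y x * (norm (v x))\<^sup>2 + g x * G)" by (simp add: algebra_simps)
      also have "\<dots> \<le> 2 * (\<epsilon> * n) * (2 * V x + g x * G)"
        using mult_right_mono[OF gY2, of "(norm (v x))\<^sup>2"] e0 n1
        by (intro mult_left_mono) (auto simp: V_def mult_ac)
      finally show ?thesis .
    qed
    have D: "g x * Y x * (norm (dirac v x))\<^sup>2 \<le> (1 + \<epsilon>) * I x"
      using mult_right_mono[OF gY, of "(norm (dirac v x))\<^sup>2"] by (simp add: I_def mult_ac)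
    have W: "(4 - 40 * \<epsilon>) * V x \<le> g x * (\<Sum>j\<in>UNIV. b j x * y j x) * (norm (v x))\<^sup>2"
      using mult_right_mono[OF gB, of "(norm (v x))\<^sup>2"] by (simp add: V_def mult_ac)
    have Q: "0 \<le> g x * (norm (vec_mult (\<lambda>j. y j x) (dirac v x)
           + 2 *\<^sub>R (\<Sum>j\<in>UNIV. y j x *\<^sub>R partial_deriv j v x) + \<beta> x *\<^sub>R v x))\<^sup>2"
      using g0 by simp
    have "R x \<le> (1 + \<epsilon>) * I x - (4 - 40 * \<epsilon>) * V x + 2 * (\<epsilon> * n) * (2 * V x + g x * G)"
      using D W Q err unfolding R_def Y_def[symmetric] by linarith
    also have "2 * (\<epsilon> * n) * (2 * V x + g x * G) \<le> 2 * (\<epsilon> * n) * (2 * V x + (4 * I x + 8 * n\<^sup>2 * V x + N x))"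
      using e0 n1 grad by (intro mult_left_mono) auto
    finally show ?thesis by (simp add: algebra_simps power2_eq_square power3_eq_cube)
  qed
  have iR: "integrable ?M R" "(\<integral>x. R x \<partial>?M) = 0"
    using hR by (simp_all add: has_bochner_integral_iff)
  have iN: "integrable ?M N" "(\<integral>x. N x \<partial>?M) = 0"
    using hN by (simp_all add: has_bochner_integral_iff)
  \<comment> \<open>The terms in \<open>R\<close> and \<open>N\<close> disappear on integration; the rest compares \<open>I\<close> with \<open>V\<close>.\<close>
  have "(\<integral>x. R x \<partial>?M) \<le> (\<integral>x. (1 + \<epsilon> + 8 * (\<epsilon> * n)) * I x
      - (4 - 40 * \<epsilon> - 4 * (\<epsilon> * n) - 16 * (\<epsilon> * n ^ 3)) * V x + 2 * (\<epsilon> * n) * N x \<partial>?M)"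
    using iR iI iV iN main by (intro integral_mono) auto
  also have "\<dots> = (1 + \<epsilon> + 8 * (\<epsilon> * n)) * (\<integral>x. I x \<partial>?M)
      - (4 - 40 * \<epsilon> - 4 * (\<epsilon> * n) - 16 * (\<epsilon> * n ^ 3)) * (\<integral>x. V x \<partial>?M)"
    using iI iV iN by simp
  finally have "(4 - 40 * \<epsilon> - 4 * (\<epsilon> * n) - 16 * (\<epsilon> * n ^ 3)) * (\<integral>x. V x \<partial>?M)
      \<le> (1 + \<epsilon> + 8 * (\<epsilon> * n)) * (\<integral>x. I x \<partial>?M)"
    using iR by simp
  moreover have "36/10 * (\<integral>x. V x \<partial>?M) \<le> (4 - 40 * \<epsilon> - 4 * (\<epsilon> * n) - 16 * (\<epsilon> * n ^ 3)) * (\<integral>x. V x \<partial>?M)"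
    using en n3 by (intro mult_right_mono Bochner_Integration.integral_nonneg) (auto simp: V_def)
  moreover have "(1 + \<epsilon> + 8 * (\<epsilon> * n)) * (\<integral>x. I x \<partial>?M) \<le> 12/10 * (\<integral>x. I x \<partial>?M)"
    using en by (intro mult_right_mono Bochner_Integration.integral_nonneg) (auto simp: I_def)
  ultimately have "3 * (\<integral>x. V x \<partial>?M) \<le> (\<integral>x. I x \<partial>?M)" by linarith
  then show ?thesis by (simp add: V_def I_def mult.assoc)
qed

section \<open>Smooth cutoff functions\<close>

lemma partial_deriv_scaleR:
  fixes u :: "real^'n::finite \<Rightarrow> real"
  assumes "u differentiable_on UNIV" "w differentiable_on UNIV"
  shows "partial_deriv j (\<lambda>x. u x *\<^sub>R w x) = (\<lambda>x. partial_deriv j u x *\<^sub>R w x + 1 *\<^sub>R (u x *\<^sub>R partial_deriv j w x))"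
proof
  fix x
  have "(u has_derivative frechet_derivative u (at x)) (at x)"
    "(w has_derivative frechet_derivative w (at x)) (at x)"
    using assms by (auto simp: differentiable_on_def frechet_derivative_works)
  then have "((\<lambda>x. u x *\<^sub>R w x) has_derivative
      (\<lambda>h. u x *\<^sub>R frechet_derivative w (at x) h + frechet_derivative u (at x) h *\<^sub>R w x)) (at x)"
    by (intro has_derivative_scaleR)
  from frechet_derivative_at[OF this, symmetric]
  show "partial_deriv j (\<lambda>x. u x *\<^sub>R w x) x = partial_deriv j u x *\<^sub>R w x + 1 *\<^sub>R (u x *\<^sub>R partial_deriv j w x)"
    by (simp add: partial_deriv_def)
qed

lemma C_diff_scaleR:
  fixes u :: "real^'n::finite \<Rightarrow> real"
  shows "C_diff k u \<Longrightarrow> C_diff k w \<Longrightarrow> C_diff k (\<lambda>x. u x *\<^sub>R w x)"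
proof (induction k arbitrary: u w)
  case 0
  then show ?case by (auto intro!: continuous_intros)
next
  case (Suc k)
  have d: "u differentiable_on UNIV" "w differentiable_on UNIV" using Suc.prems by auto
  then have "(\<lambda>x. u x *\<^sub>R w x) differentiable_on UNIV"
    by (simp add: differentiable_on_def)
  moreover have "C_diff k (partial_deriv j (\<lambda>x. u x *\<^sub>R w x))" for j
    unfolding partial_deriv_scaleR[OF d]
    by (rule C_diff_combination; rule Suc.IH) (use Suc.prems C_diff_SucD in auto)
  ultimately show ?case by simp
qed

text \<open>A smooth function of one variable is given by the sequence \<open>F\<close> of its derivatives; quantifying over
the starting index \<open>i\<close> makes the induction on the order of differentiability work.\<close>

lemma C_diff_chain:
  fixes F :: "nat \<Rightarrow> real \<Rightarrow> real" and q :: "real^'n::finite \<Rightarrow> real"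
  assumes F: "\<And>i t. (F i has_real_derivative F (Suc i) t) (at t)"
  shows "C_diff k q \<Longrightarrow> C_diff k (\<lambda>x. F i (q x))"
proof (induction k arbitrary: i)
  case 0
  have "continuous_on UNIV (F i)"
    using F DERIV_isCont by (blast intro: continuous_at_imp_continuous_on)
  then show ?case using 0 by (auto intro: continuous_on_compose2[where t=UNIV])
next
  case (Suc k)
  have q: "q differentiable (at x)" for x using Suc.prems by (auto simp: differentiable_on_def)
  have d: "((\<lambda>x. F i (q x)) has_derivative (\<lambda>h. F (Suc i) (q x) * frechet_derivative q (at x) h)) (at x)" for x
    using has_derivative_compose[OF q[of x, unfolded frechet_derivative_works] F[of i "q x", unfolded has_field_derivative_def]]
    by (simp add: mult.commute)
  have "partial_deriv j (\<lambda>x. F i (q x)) = (\<lambda>x. F (Suc i) (q x) *\<^sub>R partial_deriv j q x)" for j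
    unfolding partial_deriv_def frechet_derivative_at[OF d, symmetric] by simp
  moreover have "C_diff k (\<lambda>x. F (Suc i) (q x) *\<^sub>R partial_deriv j q x)" for j
    using Suc.prems C_diff_SucD[OF Suc.prems] by (intro C_diff_scaleR Suc.IH) auto
  moreover have "(\<lambda>x. F i (q x)) differentiable_on UNIV"
    using d unfolding differentiable_on_def differentiable_def by auto
  ultimately show ?case by simp
qed

lemma C_diff_coord: "C_diff k (\<lambda>x::real^'n::finite. x $ i)"
proof (cases k)
  case (Suc k)
  have d: "((\<lambda>x::real^'n. x $ i) has_derivative (\<lambda>h. h $ i)) (at x)" for x
    by (rule bounded_linear_imp_has_derivative[OF bounded_linear_vec_nth])
  have "partial_deriv j (\<lambda>x::real^'n. x $ i) = (\<lambda>x. axis j 1 $ i)" for j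
    by (simp add: partial_deriv_def frechet_derivative_at[OF d, symmetric] fun_eq_iff)
  moreover have "(\<lambda>x::real^'n. x $ i) differentiable_on UNIV"
    using d unfolding differentiable_on_def differentiable_def by auto
  ultimately show ?thesis using Suc by (simp add: C_diff_const)
qed (auto intro!: continuous_intros)

lemma C_diff_sum:
  "finite A \<Longrightarrow> (\<And>i. i \<in> A \<Longrightarrow> C_diff k (f i)) \<Longrightarrow> C_diff k (\<lambda>x::real^'n::finite. \<Sum>i\<in>A. f i x)"
proof (induction A rule: finite_induct)
  case empty
  then show ?case by (simp add: C_diff_const)
next
  case (insert a A)
  then show ?case
    using C_diff_combination[of k "f a" "\<lambda>x. \<Sum>i\<in>A. f i x" 1] by simp
qed


text \<open>The functions \<open>p(1/t) e\<^sup>-\<^sup>1\<^sup>/\<^sup>t\<close>, extended by zero to \<open>t \<le> 0\<close>. They are closed under differentiation, so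
the smooth function \<open>e\<^sup>-\<^sup>1\<^sup>/\<^sup>t\<close> is handled together with all its derivatives.\<close>

definition flat :: "real poly \<Rightarrow> real \<Rightarrow> real" where
  "flat p t = (if t > 0 then poly p (1 / t) * exp (- (1 / t)) else 0)"

lemma poly_times_exp_neg_tendsto_0: "((\<lambda>u. poly p u * exp (- u)) \<longlongrightarrow> 0) at_top" for p :: "real poly"
proof -
  have "((\<lambda>u. \<Sum>i\<le>degree p. coeff p i * (u ^ i / exp u)) \<longlongrightarrow> (\<Sum>i\<le>degree p. coeff p i * 0)) at_top"
    by (intro tendsto_sum tendsto_mult_left tendsto_power_div_exp_0)
  then show ?thesis
    by (simp add: poly_altdef sum_distrib_right exp_minus divide_inverse mult.assoc)
qed

lemma flat_tendsto_0: "(flat p \<longlongrightarrow> 0) (at 0)"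
proof (rule filterlim_split_at_real)
  have "((\<lambda>t. poly p (inverse t) * exp (- inverse t)) \<longlongrightarrow> 0) (at_right 0)"
    by (rule filterlim_compose[OF poly_times_exp_neg_tendsto_0 filterlim_inverse_at_top_right])
  moreover have "\<forall>\<^sub>F t in at_right 0. poly p (inverse t) * exp (- inverse t) = flat p t"
    using eventually_at_right_less[of "0::real"] by eventually_elim (simp add: flat_def inverse_eq_divide)
  ultimately show "(flat p \<longlongrightarrow> 0) (at_right 0)" by (rule Lim_transform_eventually)
  have "\<forall>\<^sub>F t in at_left (0::real). 0 = flat p t"
    by (auto simp: eventually_at_filter flat_def)
  then show "(flat p \<longlongrightarrow> 0) (at_left 0)" by (rule Lim_transform_eventually[OF tendsto_const])
qed

lemma DERIV_flat: "(flat p has_real_derivative flat ([:0, 0, 1:] * (p - pderiv p)) t) (at t)"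
proof -
  consider "t > 0" | "t < 0" | "t = 0" by linarith
  then show ?thesis
  proof cases
    case 1
    have "((\<lambda>t. poly p (1 / t) * exp (- (1 / t))) has_real_derivative flat ([:0, 0, 1:] * (p - pderiv p)) t) (at t)"
      using 1 by (auto intro!: derivative_eq_intros simp: flat_def field_simps power2_eq_square)
    then show ?thesis
      by (rule has_field_derivative_transform_within_open[where S="{0<..}"]) (use 1 in \<open>auto simp: flat_def\<close>)
  next
    case 2
    have "((\<lambda>t. 0) has_real_derivative flat ([:0, 0, 1:] * (p - pderiv p)) t) (at t)"
      using 2 by (simp add: flat_def)
    then show ?thesis
      by (rule has_field_derivative_transform_within_open[where S="{..<0}"]) (use 2 in \<open>auto simp: flat_def\<close>)
  next
    case 3
    have "flat ([:0, 1:] * p) = (\<lambda>h. (flat p (0 + h) - flat p 0) / h)"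
      by (auto simp: flat_def fun_eq_iff)
    then have "((\<lambda>h. (flat p (0 + h) - flat p 0) / h) \<longlongrightarrow> 0) (at 0)"
      using flat_tendsto_0[of "[:0, 1:] * p"] by simp
    then show ?thesis unfolding 3 DERIV_def by (simp add: flat_def)
  qed
qed

primrec flat_poly :: "nat \<Rightarrow> real poly" where
  "flat_poly 0 = 1"
| "flat_poly (Suc i) = [:0, 0, 1:] * (flat_poly i - pderiv (flat_poly i))"

lemma C_diff_flat: "C_diff k q \<Longrightarrow> C_diff k (\<lambda>x::real^'n::finite. flat 1 (q x))"
  using C_diff_chain[of "\<lambda>i. flat (flat_poly i)" k q 0] DERIV_flat by simp

lemma C_diff_exp_neg:
  fixes q :: "real^'n::finite \<Rightarrow> real"
  assumes "C_diff k q"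
  shows "C_diff k (\<lambda>x. exp (- q x))"
proof -
  have "((\<lambda>t. (-1)^i * exp (- t)) has_real_derivative (-1)^Suc i * exp (- t)) (at t)" for i and t :: real
    by (auto intro!: derivative_eq_intros)
  from C_diff_chain[of "\<lambda>i t. (-1)^i * exp (- t)" k q 0, OF this assms] show ?thesis by simp
qed

definition flat' :: "real \<Rightarrow> real" where
  "flat' t = (if t > 0 then (1 / t)\<^sup>2 * exp (- (1 / t)) else 0)"

lemma DERIV_flat_1: "(flat 1 has_real_derivative flat' t) (at t)"
proof -
  have "flat ([:0, 0, 1:] * (1 - pderiv 1)) t = flat' t"
    by (simp add: flat_def flat'_def power2_eq_square)
  then show ?thesis using DERIV_flat[of 1 t] by simp
qed

lemma exp_neg_bounds:
  fixes u :: real assumes "u \<ge> 0"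
  shows "u * exp (- u) \<le> 1" "u\<^sup>2 * exp (- u) \<le> 2"
proof -
  have "1 + u + u\<^sup>2 / 2 \<le> exp u" by (rule exp_lower_Taylor_quadratic[OF assms])
  then have "u \<le> exp u" "u\<^sup>2 \<le> 2 * exp u" using assms zero_le_power2[of u] by linarith+
  then show "u * exp (- u) \<le> 1" "u\<^sup>2 * exp (- u) \<le> 2" by (simp_all add: exp_minus field_simps)
qed

text \<open>The factor \<open>t + 1\<close> arises from \<open>r|x|\<^sup>2 = t + 1\<close> at the argument \<open>t = r|x|\<^sup>2 - 1\<close> of the inner cutoff. That
\<open>(t + 1) flat' t\<close> is bounded and of order \<open>1/t\<close> makes the cutoffs scale invariantly small.\<close>

lemma flat_bounds:
  "0 \<le> flat 1 t" "flat 1 t \<le> 1" "0 \<le> flat' t" "flat' t \<le> 2" "(t + 1) * flat' t \<le> 3"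
  "t \<ge> 1 \<Longrightarrow> (t + 1) * flat' t \<le> 2 / t" "t \<ge> 1/4 \<Longrightarrow> exp (-4) \<le> flat 1 t"
proof -
  show "0 \<le> flat 1 t" "flat 1 t \<le> 1" "0 \<le> flat' t" by (auto simp: flat_def flat'_def)
  show "flat' t \<le> 2" using exp_neg_bounds(2)[of "1 / t"] by (auto simp: flat'_def)
  show "(t + 1) * flat' t \<le> 3"
  proof (cases "t > 0")
    case True
    then have "(t + 1) * flat' t = (1 / t) * exp (- (1 / t)) + (1 / t)\<^sup>2 * exp (- (1 / t))"
      by (simp add: flat'_def field_simps power2_eq_square)
    moreover have "0 \<le> 1 / t" using True by simp
    from exp_neg_bounds[OF this]
    have "(1 / t) * exp (- (1 / t)) \<le> 1" "(1 / t)\<^sup>2 * exp (- (1 / t)) \<le> 2" .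
    ultimately show ?thesis by linarith
  qed (simp add: flat'_def)
  show "(t + 1) * flat' t \<le> 2 / t" if t: "t \<ge> 1"
  proof -
    have "flat' t \<le> (1 / t)\<^sup>2" using t by (simp add: flat'_def mult_left_le)
    then have "(t + 1) * flat' t \<le> (2 * t) * (1 / t)\<^sup>2"
      using t by (intro mult_mono) (auto simp: flat'_def)
    then show ?thesis using t by (simp add: power2_eq_square)
  qed
  show "exp (-4) \<le> flat 1 t" if t: "t \<ge> 1/4"
    using t by (simp add: flat_def field_simps)
qed


lemma integrable_gaussian: "integrable lborel (\<lambda>x::real^'n::finite. exp (- (norm x)\<^sup>2))"
proof (rule integrableI_bounded)
  have fin: "(\<integral>\<^sup>+t. ennreal (exp (- (t::real)\<^sup>2)) \<partial>lborel) < \<infinity>"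
  proof -
    have "has_bochner_integral lborel (\<lambda>t::real. exp (- t\<^sup>2)) (2 *\<^sub>R (sqrt pi / 2))"
      by (rule has_bochner_integral_even_function[OF gaussian_moment_0]) simp
    then have "integrable lborel (\<lambda>t::real. exp (- t\<^sup>2))" by (simp add: has_bochner_integral_iff)
    then show ?thesis by (simp add: integrable_iff_bounded)
  qed
  have "(\<integral>\<^sup>+x. ennreal (norm (exp (- (norm (x::real^'n))\<^sup>2))) \<partial>lborel)
      = (\<integral>\<^sup>+x. (\<Prod>b\<in>(Basis::(real^'n) set). ennreal (exp (- (x \<bullet> b)\<^sup>2))) \<partial>lborel)"
  proof (rule nn_integral_cong)
    fix x :: "real^'n"
    have "(norm x)\<^sup>2 = (\<Sum>b\<in>Basis. (x \<bullet> b)\<^sup>2)"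
      unfolding power2_norm_eq_inner by (subst euclidean_inner) (simp only: power2_eq_square)
    then show "ennreal (norm (exp (- (norm x)\<^sup>2))) = (\<Prod>b\<in>Basis. ennreal (exp (- (x \<bullet> b)\<^sup>2)))"
      by (simp add: prod_ennreal exp_sum[symmetric] sum_negf[symmetric])
  qed
  also have "\<dots> = (\<Prod>b\<in>(Basis::(real^'n) set). (\<integral>\<^sup>+t. ennreal (exp (- (t::real)\<^sup>2)) \<partial>lborel))"
    by (rule nn_integral_lborel_prod) auto
  also have "\<dots> < \<infinity>" using fin by (simp add: power_less_top_ennreal)
  finally show "(\<integral>\<^sup>+x. ennreal (norm (exp (- (norm (x::real^'n))\<^sup>2))) \<partial>lborel) < \<infinity>" .
qed simp

section \<open>Extremal fields and sharpness of the Gaussian constant\<close>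

lemma vec_mult_skew: "vec_mult y w \<bullet> z = - (w \<bullet> vec_mult y z)"
  by (simp add: vec_mult_def inner_sum_left inner_sum_right cl_gen_skew sum_negf)

lemma vec_mult_linear: "linear (vec_mult y)"
  by (rule linearI) (simp_all add: vec_mult_def cl_gen_add cl_gen_scaleR scaleR_add_right sum.distrib
      scaleR_sum_right mult.commute)

text \<open>Polarisation of the norm identity, combined with skewness.\<close>

lemma vec_mult_square: "vec_mult y (vec_mult y w) = - ((\<Sum>j\<in>UNIV. (y j)\<^sup>2) *\<^sub>R w)"
proof (rule vector_eq_ldot[THEN iffD1, rule_format])
  fix z
  define q where "q = (\<Sum>j\<in>UNIV. (y j)\<^sup>2)"
  have "(norm (vec_mult y (z + w)))\<^sup>2 = q * (norm (z + w))\<^sup>2"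
    unfolding q_def by (rule norm_vec_mult)
  moreover have "vec_mult y z \<bullet> vec_mult y z = q * (z \<bullet> z)" "vec_mult y w \<bullet> vec_mult y w = q * (w \<bullet> w)"
    using norm_vec_mult[of y z] norm_vec_mult[of y w] by (simp_all only: power2_norm_eq_inner q_def)
  ultimately have "vec_mult y z \<bullet> vec_mult y w = q * (z \<bullet> w)"
    unfolding power2_norm_eq_inner linear_add[OF vec_mult_linear]
    by (simp add: inner_add_left inner_add_right inner_commute distrib_left)
  then have "z \<bullet> vec_mult y (vec_mult y w) = - (q * (z \<bullet> w))"
    using vec_mult_skew[of y z "vec_mult y w"] by simp
  then show "z \<bullet> vec_mult y (vec_mult y w) = z \<bullet> (- ((\<Sum>j\<in>UNIV. (y j)\<^sup>2) *\<^sub>R w))"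
    by (simp add: q_def)
qed

definition position :: "'n::{finite,linorder} point \<Rightarrow> 'n clifford" where
  "position x = vec_mult (\<lambda>j. x $ j) cl_one"

lemma position_eq_sum: "position x = (\<Sum>j\<in>UNIV. x $ j *\<^sub>R cl_gen j)"
  by (simp add: position_def vec_mult_def cl_mult_one_right)

lemma norm_cl_one: "norm (cl_one :: 'n::{finite,linorder} clifford) = 1"
  by (simp add: cl_one_def cl_basis_def)

lemma norm_position: "norm (position x) = norm x"
proof -
  have "(norm (position x))\<^sup>2 = (norm x)\<^sup>2"
    unfolding position_def norm_vec_mult by (simp add: norm_square_eq_sum norm_cl_one)
  then show ?thesis by simp
qed


text \<open>The fields \<open>K(|x|\<^sup>2) x\<close> satisfy \<open>Dv = -(2|x|\<^sup>2 K' + nK)\<close>, a scalar. The square in the radial identity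
for \<open>m = 2\<close> is therefore explicit, and it vanishes for \<open>K = e\<^sup>-\<^sup>t\<close>.\<close>

lemma radial_field:
  fixes K K' :: "real \<Rightarrow> real"
  defines "v \<equiv> (\<lambda>x::'n::{finite,linorder} point. K ((norm x)\<^sup>2) *\<^sub>R position x)"
  assumes K: "\<And>t. (K has_real_derivative K' t) (at t)"
  shows "vec_mult (\<lambda>j. x $ j) (dirac v x) + 2 *\<^sub>R (\<Sum>j\<in>UNIV. x $ j *\<^sub>R partial_deriv j v x)
      + (2 * (norm x)\<^sup>2 + real CARD('n) - 2) *\<^sub>R v x
    = (2 * (norm x)\<^sup>2 * (K' ((norm x)\<^sup>2) + K ((norm x)\<^sup>2))) *\<^sub>R position x"
proof -
  define q where "q = (norm x)\<^sup>2"
  have pd: "partial_deriv j v x = (2 * K' q * x $ j) *\<^sub>R position x + K q *\<^sub>R cl_gen j" for j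
  proof -
    have "((\<lambda>x. (norm x)\<^sup>2) has_derivative (\<lambda>h. \<Sum>j\<in>UNIV. h $ j *\<^sub>R (2 * x $ j))) (at x)"
      by (rule C1_partialsD(1)[OF C1_partials_norm_square UNIV_I])
    from has_derivative_compose[OF this K[unfolded has_field_derivative_def]]
    have 1: "((\<lambda>x. K ((norm x)\<^sup>2)) has_derivative (\<lambda>h. K' q * (\<Sum>j\<in>UNIV. h $ j *\<^sub>R (2 * x $ j)))) (at x)"
      by (simp add: q_def)
    have 2: "(position has_derivative position) (at x)"
    proof (rule bounded_linear_imp_has_derivative)
      have "linear (position :: 'n point \<Rightarrow> 'n clifford)"
        by (rule linearI) (simp_all add: position_eq_sum scaleR_add_left sum.distrib scaleR_sum_right)
      then show "bounded_linear (position :: 'n point \<Rightarrow> 'n clifford)" by (rule linear_conv_bounded_linear[THEN iffD1])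
    qed
    have "K q *\<^sub>R position h + (K' q * (\<Sum>j\<in>UNIV. h $ j *\<^sub>R (2 * x $ j))) *\<^sub>R position x
        = (\<Sum>j\<in>UNIV. h $ j *\<^sub>R ((2 * K' q * x $ j) *\<^sub>R position x + K q *\<^sub>R cl_gen j))" for h
    proof -
      have "(\<Sum>j\<in>UNIV. h $ j *\<^sub>R ((2 * K' q * x $ j) *\<^sub>R position x + K q *\<^sub>R cl_gen j))
          = (\<Sum>j\<in>UNIV. (K' q * (h $ j * (2 * x $ j))) *\<^sub>R position x) + (\<Sum>j\<in>UNIV. K q *\<^sub>R (h $ j *\<^sub>R cl_gen j))"
        unfolding sum.distrib[symmetric] by (intro sum.cong refl) (simp add: scaleR_add_right mult_ac)
      also have "\<dots> = (K' q * (\<Sum>j\<in>UNIV. h $ j *\<^sub>R (2 * x $ j))) *\<^sub>R position x + K q *\<^sub>R position h"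
        by (simp only: scaleR_sum_left[symmetric] sum_distrib_left[symmetric] scaleR_sum_right[symmetric]
            position_eq_sum[of h, symmetric] real_scaleR_def)
      finally show ?thesis by (simp only: add.commute)
    qed
    then have "(v has_derivative (\<lambda>h. \<Sum>j\<in>UNIV. h $ j *\<^sub>R ((2 * K' q * x $ j) *\<^sub>R position x + K q *\<^sub>R cl_gen j))) (at x)"
      unfolding v_def
      by (intro has_derivative_eq_rhs[OF has_derivative_scaleR[OF 1 2]]) (simp only: q_def[symmetric])
    then show ?thesis by (rule partial_deriv_unique)
  qed
  have P: "(\<Sum>j\<in>UNIV. x $ j *\<^sub>R (cl_gen j \<odot> position x)) = - (q *\<^sub>R cl_one)"
  proof -
    have "vec_mult (\<lambda>j. x $ j) (position x) = - (q *\<^sub>R cl_one)"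
      unfolding position_def q_def norm_square_eq_sum by (rule vec_mult_square)
    then show ?thesis by (simp only: vec_mult_def)
  qed
  have "dirac v x = (\<Sum>j\<in>UNIV. (2 * K' q) *\<^sub>R (x $ j *\<^sub>R (cl_gen j \<odot> position x)) + K q *\<^sub>R (- cl_one))"
    unfolding dirac_def pd
    by (intro sum.cong refl) (simp add: cl_gen_add cl_gen_scaleR cl_gen_square)
  also have "\<dots> = - ((2 * K' q * q + real CARD('n) * K q) *\<^sub>R cl_one)"
    unfolding sum.distrib scaleR_sum_right[symmetric] P sum_constant_scaleR by (simp add: algebra_simps)
  finally have dv: "dirac v x = - ((2 * K' q * q + real CARD('n) * K q) *\<^sub>R cl_one)" .
  have 1: "vec_mult (\<lambda>j. x $ j) (dirac v x) = - ((2 * K' q * q + real CARD('n) * K q) *\<^sub>R position x)"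
    unfolding dv linear_neg[OF vec_mult_linear] linear_scale[OF vec_mult_linear] position_def ..
  have 2: "(\<Sum>j\<in>UNIV. x $ j *\<^sub>R partial_deriv j v x) = (2 * K' q * q + K q) *\<^sub>R position x"
  proof -
    have "(\<Sum>j\<in>UNIV. x $ j *\<^sub>R partial_deriv j v x)
        = (\<Sum>j\<in>UNIV. (2 * K' q * (x $ j)\<^sup>2) *\<^sub>R position x) + (\<Sum>j\<in>UNIV. K q *\<^sub>R (x $ j *\<^sub>R cl_gen j))"
      unfolding pd sum.distrib[symmetric]
      by (intro sum.cong refl) (simp add: scaleR_add_right power2_eq_square mult_ac)
    then show ?thesis
      by (simp only: scaleR_sum_left[symmetric] sum_distrib_left[symmetric] scaleR_sum_right[symmetric]
          position_eq_sum[of x, symmetric] norm_square_eq_sum[symmetric] q_def[symmetric] scaleR_add_left)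
  qed
  have vx: "v x = K q *\<^sub>R position x" by (simp add: v_def q_def)
  show ?thesis
    unfolding 1 2 vx q_def[symmetric] scaleR_scaleR scaleR_minus_left[symmetric] scaleR_add_left[symmetric]
    by (rule arg_cong[where f="\<lambda>c. c *\<^sub>R position x"]) (simp add: algebra_simps)
qed


text \<open>Supported in \<open>1/r \<le> t \<le> r\<close>. The aim is a small value of \<open>t \<chi>'(t)\<close>, which dilating one fixed
profile at each end achieves; the product converges pointwise to \<open>e\<^sup>-\<^sup>1\<close> as \<open>r\<close> grows.\<close>

definition cutoff :: "real \<Rightarrow> real \<Rightarrow> real" where
  "cutoff r t = flat 1 (r * t - 1) * flat 1 (1 - t / r)"

definition cutoff' :: "real \<Rightarrow> real \<Rightarrow> real" where
  "cutoff' r t = r * flat' (r * t - 1) * flat 1 (1 - t / r) - flat 1 (r * t - 1) * flat' (1 - t / r) / r"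

lemma DERIV_cutoff:
  assumes "r \<noteq> 0"
  shows "(cutoff r has_real_derivative cutoff' r t) (at t)"
proof -
  have 1: "((\<lambda>t. flat 1 (r * t - 1)) has_real_derivative flat' (r * t - 1) * r) (at t)"
    by (rule DERIV_chain2[OF DERIV_flat_1]) (auto intro!: derivative_eq_intros)
  have 2: "((\<lambda>t. flat 1 (1 - t / r)) has_real_derivative flat' (1 - t / r) * (- 1 / r)) (at t)"
    by (rule DERIV_chain2[OF DERIV_flat_1]) (use assms in \<open>auto intro!: derivative_eq_intros\<close>)
  show ?thesis unfolding cutoff_def[abs_def] cutoff'_def
    by (rule DERIV_cong[OF DERIV_mult[OF 1 2]]) (simp add: algebra_simps)
qed

text \<open>Both factors are dilations, and \<open>t d/dt\<close> is invariant under dilation; hence the uniform bound. For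
fixed \<open>t\<close> the second bound tends to zero as \<open>r\<close> grows.\<close>

lemma cutoff'_bounds:
  assumes r: "r > 0" and t: "t \<ge> 0"
  shows "\<bar>t * cutoff' r t\<bar> \<le> 5" and "r * t \<ge> 2 \<Longrightarrow> \<bar>t * cutoff' r t\<bar> \<le> 2 / (r * t - 1) + 2 * t / r"
proof -
  define A where "A = (r * t - 1 + 1) * flat' (r * t - 1)"
  define B where "B = (t / r) * flat' (1 - t / r)"
  have A0: "0 \<le> A" unfolding A_def by (intro mult_nonneg_nonneg flat_bounds) (use r t in simp)
  have B0: "0 \<le> B" unfolding B_def by (intro mult_nonneg_nonneg flat_bounds) (use r t in simp)
  have "t * cutoff' r t = A * flat 1 (1 - t / r) - flat 1 (r * t - 1) * B"
    by (simp add: cutoff'_def A_def B_def algebra_simps)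
  moreover have "0 \<le> A * flat 1 (1 - t / r)" "A * flat 1 (1 - t / r) \<le> A"
    using A0 flat_bounds(1,2)[of "1 - t / r"] by (auto intro: mult_left_le)
  moreover have "0 \<le> flat 1 (r * t - 1) * B" "flat 1 (r * t - 1) * B \<le> B"
    using B0 flat_bounds(1,2)[of "r * t - 1"] by (auto intro: mult_left_le_one_le)
  ultimately have AB: "\<bar>t * cutoff' r t\<bar> \<le> A + B" using A0 B0 by linarith
  have "A \<le> 3" unfolding A_def by (rule flat_bounds(5))
  moreover have "B \<le> 2"
  proof (cases "t / r \<le> 1")
    case True
    then have "B \<le> 1 * 2" unfolding B_def
      using flat_bounds(3,4)[of "1 - t / r"] r t by (intro mult_mono) auto
    then show ?thesis by simp
  next
    case False
    then show ?thesis by (simp add: B_def flat'_def)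
  qed
  ultimately show "\<bar>t * cutoff' r t\<bar> \<le> 5" using AB by linarith
  show "\<bar>t * cutoff' r t\<bar> \<le> 2 / (r * t - 1) + 2 * t / r" if "r * t \<ge> 2"
  proof -
    have "A \<le> 2 / (r * t - 1)" unfolding A_def by (rule flat_bounds(6)) (use that in simp)
    moreover have "B \<le> (t / r) * 2" unfolding B_def
      using flat_bounds(4)[of "1 - t / r"] r t by (intro mult_left_mono) auto
    ultimately show ?thesis using AB by (simp add: mult.commute)
  qed
qed

definition extremal :: "real \<Rightarrow> 'n::{finite,linorder} point \<Rightarrow> 'n clifford" where
  "extremal r x = (cutoff r ((norm x)\<^sup>2) * exp (- (norm x)\<^sup>2)) *\<^sub>R position x"

lemma extremal_test_function:
  assumes r: "r > 0"
  shows "extremal r \<in> test_functions (- {0 :: 'n::{finite,linorder} point})"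
proof -
  have cq: "C_diff k (\<lambda>x::'n point. (norm x)\<^sup>2)" for k
  proof -
    have "C_diff k (\<lambda>x::'n point. \<Sum>j\<in>UNIV. x $ j *\<^sub>R x $ j)"
      by (intro C_diff_sum C_diff_scaleR C_diff_coord) simp
    then show ?thesis unfolding norm_square_eq_sum by (simp add: power2_eq_square)
  qed
  have aff: "C_diff k (\<lambda>x::'n point. a + b * (norm x)\<^sup>2)" for k a b
    using C_diff_combination[OF C_diff_const cq, of k a b] by simp
  have smooth: "C_diff k (extremal r :: 'n point \<Rightarrow> 'n clifford)" for k
  proof -
    have "C_diff k (\<lambda>x::'n point. flat 1 (-1 + r * (norm x)\<^sup>2))" "C_diff k (\<lambda>x::'n point. flat 1 (1 + (- 1 / r) * (norm x)\<^sup>2))"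
      by (intro C_diff_flat aff)+
    from C_diff_scaleR[OF C_diff_scaleR[OF this] C_diff_exp_neg[OF cq]]
    have "C_diff k (\<lambda>x::'n point. cutoff r ((norm x)\<^sup>2) * exp (- (norm x)\<^sup>2))"
      by (simp add: cutoff_def)
    moreover have "C_diff k (position :: 'n point \<Rightarrow> 'n clifford)"
      unfolding position_eq_sum[abs_def] by (intro C_diff_sum C_diff_scaleR C_diff_coord C_diff_const) simp
    ultimately show ?thesis unfolding extremal_def[abs_def] by (rule C_diff_scaleR)
  qed
  let ?K = "{x::'n point. 1 / r \<le> (norm x)\<^sup>2 \<and> (norm x)\<^sup>2 \<le> r}"
  have supp: "{x::'n point. extremal r x \<noteq> 0} \<subseteq> ?K"
  proof
    fix x :: "'n point" assume "x \<in> {x. extremal r x \<noteq> 0}"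
    then have "r * (norm x)\<^sup>2 - 1 > 0" "1 - (norm x)\<^sup>2 / r > 0"
      by (auto simp: extremal_def cutoff_def flat_def split: if_splits)
    then show "x \<in> ?K" using r by (simp add: field_simps)
  qed
  have "closed ?K"
    by (intro closed_Collect_conj closed_Collect_le continuous_intros)
  moreover have "bounded ?K"
    unfolding bounded_iff
  proof (intro exI ballI)
    fix x :: "'n point" assume "x \<in> ?K"
    then show "norm x \<le> sqrt r" by (simp add: real_le_rsqrt)
  qed
  ultimately have "compact ?K" by (simp add: compact_eq_bounded_closed)
  moreover have "?K \<subseteq> - {0}" using r by auto
  ultimately show ?thesis by (rule test_functionsI[OF smooth _ _ supp])
qed

text \<open>Since \<open>x exp(-|x|\<^sup>2)\<close> annihilates the square, only the derivative of the cutoff survives.\<close>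

lemma extremal_identity:
  fixes r :: real
  assumes r: "r > 0"
  defines "v \<equiv> (extremal r :: 'n::{finite,linorder} point \<Rightarrow> 'n clifford)"
  shows "(\<integral>x. (norm (dirac v x))\<^sup>2 * exp ((norm x)\<^sup>2) \<partial>lebesgue_on (- {0})) =
      (\<integral>x. (2 * ((norm (x::'n point))\<^sup>2 * cutoff' r ((norm x)\<^sup>2)))\<^sup>2 * exp (- (norm x)\<^sup>2) \<partial>lebesgue_on (- {0}))
      + 4 * (\<integral>x. (norm (v x))\<^sup>2 * exp ((norm x)\<^sup>2) \<partial>lebesgue_on (- {0}))"
proof -
  let ?M = "lebesgue_on (- {0 :: 'n point})"
  define K where "K t = cutoff r t * exp (- t)" for t
  define K' where "K' t = (cutoff' r t - cutoff r t) * exp (- t)" for t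
  have dK: "(K has_real_derivative K' t) (at t)" for t
    unfolding K_def K'_def using DERIV_cutoff[of r t] r
    by (auto intro!: derivative_eq_intros simp: algebra_simps)
  have vK: "v = (\<lambda>x. K ((norm x)\<^sup>2) *\<^sub>R position x)"
    by (simp add: v_def extremal_def[abs_def] K_def)
  define Q where "Q x = exp ((norm x)\<^sup>2) / (norm x)\<^sup>2 * (norm (vec_mult (\<lambda>j. x $ j) (dirac v x)
           + 2 *\<^sub>R (\<Sum>j\<in>UNIV. x $ j *\<^sub>R partial_deriv j v x)
           + (2 * (norm x)\<^sup>2 + real CARD('n) - 2) *\<^sub>R v x))\<^sup>2" for x
  have Q: "Q x
       = (2 * ((norm x)\<^sup>2 * cutoff' r ((norm x)\<^sup>2)))\<^sup>2 * exp (- (norm x)\<^sup>2)" if "x \<noteq> 0" for x :: "'n point"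
  proof -
    have "K' ((norm x)\<^sup>2) + K ((norm x)\<^sup>2) = cutoff' r ((norm x)\<^sup>2) * exp (- (norm x)\<^sup>2)"
      by (simp add: K_def K'_def algebra_simps)
    then have sq: "(norm ((2 * (norm x)\<^sup>2 * (K' ((norm x)\<^sup>2) + K ((norm x)\<^sup>2))) *\<^sub>R position x))\<^sup>2
        = (2 * (norm x)\<^sup>2 * (cutoff' r ((norm x)\<^sup>2) * exp (- (norm x)\<^sup>2)))\<^sup>2 * (norm x)\<^sup>2"
      by (simp only: norm_scaleR norm_position power_mult_distrib power2_abs)
    have "exp q / q * ((2 * q * (c * exp (- q)))\<^sup>2 * q) = (2 * (q * c))\<^sup>2 * exp (- q)" if "q > 0" for q c :: real
      using that by (simp add: power2_eq_square exp_minus field_simps)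
    from this[of "(norm x)\<^sup>2" "cutoff' r ((norm x)\<^sup>2)"] that
    show ?thesis unfolding Q_def vK radial_field[of K K', OF dK] sq by simp
  qed
  have v: "v \<in> test_functions (- {0})" unfolding v_def by (rule extremal_test_function[OF r])
  have p2: "norm x powr 2 = (norm x)\<^sup>2" for x :: "'n point" by (cases "x = 0") auto
  have "(\<integral>x. (norm (dirac v x))\<^sup>2 * exp ((norm x)\<^sup>2) \<partial>?M) =
      (\<integral>x. Q x \<partial>?M)
      + (\<integral>x. 2\<^sup>2 * norm x powr 0 * (norm (v x))\<^sup>2 * exp ((norm x)\<^sup>2) \<partial>?M)"
    using radial_dirac_identity[OF v open_Compl[OF closed_singleton] subset_refl, of 2] unfolding p2 Q_def by simp
  also have "(\<integral>x. 2\<^sup>2 * norm x powr 0 * (norm (v x))\<^sup>2 * exp ((norm x)\<^sup>2) \<partial>?M)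
      = (\<integral>x. 4 * ((norm (v x))\<^sup>2 * exp ((norm x)\<^sup>2)) \<partial>?M)"
    by (rule Bochner_Integration.integral_cong) auto
  also have "\<dots> = 4 * (\<integral>x. (norm (v x))\<^sup>2 * exp ((norm x)\<^sup>2) \<partial>?M)" by simp
  also have "(\<integral>x. Q x \<partial>?M)
      = (\<integral>x. (2 * ((norm (x::'n point))\<^sup>2 * cutoff' r ((norm x)\<^sup>2)))\<^sup>2 * exp (- (norm x)\<^sup>2) \<partial>?M)"
    by (rule Bochner_Integration.integral_cong) (use Q in auto)
  finally show ?thesis .
qed

text \<open>The masses stay away from zero because on a fixed small ball near the unit sphere all cutoffs with
\<open>r \<ge> 2\<close> are bounded below.\<close>

lemma extremal_mass_lower_bound:
  obtains c where "c > 0" "\<And>r. r \<ge> 2 \<Longrightarrow>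
    c \<le> (\<integral>x. (norm (extremal r (x :: 'n::{finite,linorder} point)))\<^sup>2 * exp ((norm x)\<^sup>2) \<partial>lebesgue_on (- {0}))"
proof -
  let ?M = "lebesgue_on (- {0 :: 'n point})"
  define p :: "'n point" where "p = (11/10) *\<^sub>R axis first_index 1"
  define B where "B = ball p (1/20)"
  have np: "norm p = 11/10" by (simp add: p_def)
  have nx: "21/20 \<le> norm x" "norm x \<le> 23/20" if "x \<in> B" for x
    using that norm_triangle_ineq2[of p x] norm_triangle_ineq2[of x p] np
    by (auto simp: B_def dist_norm norm_minus_commute)
  have sub: "B \<subseteq> - {0}" using nx by fastforce
  have qx: "1 \<le> (norm x)\<^sup>2" "(norm x)\<^sup>2 \<le> 3/2" if "x \<in> B" for x
    using power_mono[OF nx(1)[OF that], of 2] power_mono[OF nx(2)[OF that], of 2]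
    by (simp_all add: power2_eq_square)
  define m where "m = measure lebesgue B"
  have mB: "measure ?M B = m"
    unfolding m_def using sub by (intro measure_restrict_space) auto
  have m: "m > 0"
  proof -
    have "m = measure lborel B" unfolding m_def by (intro measure_completion) (simp add: B_def)
    then show ?thesis using content_ball_pos[of "1/20" p] by (simp add: B_def)
  qed
  have iB: "integrable ?M (indicator B :: 'n point \<Rightarrow> real)"
  proof -
    have "emeasure lebesgue B < \<infinity>" using emeasure_bounded_finite[of B] by (simp add: B_def)
    then have "emeasure ?M B < \<infinity>"
      by (subst emeasure_restrict_space) (use sub in auto)
    moreover have "B \<in> sets ?M"
      using sub by (subst sets_restrict_space_iff) (auto simp: B_def)
    ultimately show ?thesis by (intro integrable_real_indicator)
  qed
  define d where "d = exp (-16) * exp (- 3/2 :: real)"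
  have "d * m \<le> (\<integral>x. (norm (extremal r (x :: 'n point)))\<^sup>2 * exp ((norm x)\<^sup>2) \<partial>?M)"
    if r: "r \<ge> 2" for r
  proof -
    have int: "integrable ?M (\<lambda>x::'n point. (norm (extremal r x))\<^sup>2 * exp ((norm x)\<^sup>2))"
      by (rule integrable_test[OF extremal_test_function open_Compl[OF closed_singleton]])
         (use r in \<open>auto intro!: continuous_intros continuous_test_function[OF extremal_test_function]\<close>)
    have "d * indicator B x \<le> (norm (extremal r x))\<^sup>2 * exp ((norm x)\<^sup>2)" for x :: "'n point"
    proof (cases "x \<in> B")
      case True
      define q where "q = (norm x)\<^sup>2"
      have q: "1 \<le> q" "q \<le> 3/2" using qx[OF True] by (simp_all add: q_def)
      have "2 * 1 \<le> r * q" using r q by (intro mult_mono) auto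
      then have 1: "exp (-4) \<le> flat 1 (r * q - 1)" by (intro flat_bounds(7)) simp
      have "q / r \<le> (3/2) / 2" using r q by (intro frac_le) auto
      then have 2: "exp (-4) \<le> flat 1 (1 - q / r)" by (intro flat_bounds(7)) simp
      have "exp (-4) * exp (-4) \<le> cutoff r q"
        unfolding cutoff_def by (intro mult_mono 1 2 flat_bounds) auto
      then have "(exp (-4) * exp (-4))\<^sup>2 \<le> (cutoff r q)\<^sup>2" by (intro power_mono) auto
      then have c: "exp (-16) \<le> (cutoff r q)\<^sup>2" by (simp add: power2_eq_square mult_exp_exp)
      \<comment> \<open>The weight \<open>e\<^sup>q\<close> turns the squared Gaussian factor into \<open>e\<^sup>-\<^sup>q\<close>.\<close>
      have "(norm (extremal r x))\<^sup>2 * exp q = (cutoff r q)\<^sup>2 * (exp (- q) * q)"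
        by (simp add: extremal_def norm_position power_mult_distrib q_def[symmetric] exp_minus field_simps power2_eq_square[of "exp q"])
      moreover have "exp (- 3/2) * 1 \<le> exp (- q) * q" using q by (intro mult_mono) auto
      ultimately have "d \<le> (norm (extremal r x))\<^sup>2 * exp q"
        unfolding d_def using c by (auto intro!: mult_mono)
      then show ?thesis using True by (simp add: q_def)
    qed simp
    then have "(\<integral>x. d * indicator B x \<partial>?M)
        \<le> (\<integral>x. (norm (extremal r (x :: 'n point)))\<^sup>2 * exp ((norm x)\<^sup>2) \<partial>?M)"
      using iB int by (intro integral_mono) auto
    then show ?thesis using sub by (simp add: mB Int_absorb2)
  qed
  then show ?thesis using that[of "d * m"] m by (simp add: d_def)
qed

lemma extremal_defect_tendsto_0:
  "(\<lambda>k. \<integral>x. (2 * ((norm (x::'n::{finite,linorder} point))\<^sup>2 * cutoff' (real k + 2) ((norm x)\<^sup>2)))\<^sup>2 * exp (- (norm x)\<^sup>2)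
      \<partial>lebesgue_on (- {0})) \<longlonglongrightarrow> 0"
proof -
  let ?M = "lebesgue_on (- {0 :: 'n point})"
  define G where "G k x = (2 * ((norm x)\<^sup>2 * cutoff' (real k + 2) ((norm x)\<^sup>2)))\<^sup>2 * exp (- (norm x)\<^sup>2)"
    for k and x :: "'n point"
  have "(\<lambda>k. \<integral>x. G k x \<partial>?M) \<longlonglongrightarrow> (\<integral>x. 0 \<partial>?M)"
  proof (rule integral_dominated_convergence[where w="\<lambda>x. 100 * exp (- (norm x)\<^sup>2)"])
    show "(\<lambda>x. 0) \<in> borel_measurable ?M" by simp
    have "G k \<in> borel_measurable borel" for k
    proof -
      have f1: "flat 1 = (\<lambda>t. if t > 0 then exp (- (1 / t)) else 0)" by (simp add: flat_def fun_eq_iff)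
      show ?thesis unfolding G_def cutoff'_def f1 flat'_def by measurable
    qed
    then show "G k \<in> borel_measurable ?M" for k
      by (intro measurable_restrict_space1 measurable_completion) simp
    have "integrable lebesgue (\<lambda>x::'n point. 100 * exp (- (norm x)\<^sup>2))"
      using integrable_gaussian by (subst integrable_completion) auto
    moreover have "- {0 :: 'n point} \<in> sets lebesgue" by auto
    ultimately have "integrable lebesgue (\<lambda>x::'n point. indicator (- {0}) x *\<^sub>R (100 * exp (- (norm x)\<^sup>2)))"
      by (intro integrable_mult_indicator)
    then have "integrable lebesgue (\<lambda>x::'n point. if x \<in> - {0} then 100 * exp (- (norm x)\<^sup>2) else 0)"
      by (rule back_subst[of "integrable lebesgue"]) (auto simp: fun_eq_iff indicator_def)
    then show "integrable ?M (\<lambda>x. 100 * exp (- (norm x)\<^sup>2))"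
      by (subst (asm) Lebesgue_Measure.integrable_restrict_UNIV) auto
    show "AE x in ?M. norm (G k x) \<le> 100 * exp (- (norm x)\<^sup>2)" for k
    proof (rule AE_I2)
      fix x :: "'n point"
      have "\<bar>(norm x)\<^sup>2 * cutoff' (real k + 2) ((norm x)\<^sup>2)\<bar> \<le> 5" by (rule cutoff'_bounds(1)) auto
      then have "\<bar>2 * ((norm x)\<^sup>2 * cutoff' (real k + 2) ((norm x)\<^sup>2))\<bar> \<le> 10" by linarith
      then have "(2 * ((norm x)\<^sup>2 * cutoff' (real k + 2) ((norm x)\<^sup>2)))\<^sup>2 \<le> 10\<^sup>2"
        by (rule abs_le_square_iff[THEN iffD1, OF order_trans]) simp
      then show "norm (G k x) \<le> 100 * exp (- (norm x)\<^sup>2)" by (simp add: G_def abs_mult)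
    qed
    show "AE x in ?M. (\<lambda>k. G k x) \<longlonglongrightarrow> 0"
    proof (rule AE_I2)
      fix x assume "x \<in> space ?M"
      then have q: "(norm x)\<^sup>2 > 0" by simp
      define q where "q = (norm x)\<^sup>2"
      have q0: "q > 0" using q by (simp add: q_def)
      have r: "filterlim (\<lambda>k. real k + 2) at_top sequentially"
        by (intro filterlim_tendsto_add_at_top[OF tendsto_const, of _ _ 2, simplified add.commute] filterlim_real_sequentially)
      have rq: "filterlim (\<lambda>k. (real k + 2) * q - 1) at_top sequentially"
      proof -
        have "filterlim (\<lambda>k. -1 + q * (real k + 2)) at_top sequentially"
          by (intro filterlim_tendsto_add_at_top[OF tendsto_const] filterlim_tendsto_pos_mult_at_top[OF tendsto_const q0] r)
        then show ?thesis by (simp add: algebra_simps)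
      qed
      have "(\<lambda>k. 2 / ((real k + 2) * q - 1) + 2 * q / (real k + 2)) \<longlonglongrightarrow> 0 + 0"
        by (intro tendsto_add tendsto_divide_0[OF tendsto_const] filterlim_at_top_imp_at_infinity rq r)
      then have b: "(\<lambda>k. 2 / ((real k + 2) * q - 1) + 2 * q / (real k + 2)) \<longlonglongrightarrow> 0" by simp
      have "(\<lambda>k. q * cutoff' (real k + 2) q) \<longlonglongrightarrow> 0"
      proof (rule Lim_null_comparison[OF _ b])
        have "\<forall>\<^sub>F k in sequentially. (real k + 2) * q - 1 \<ge> 1"
          using rq unfolding filterlim_at_top by (rule spec)
        then show "\<forall>\<^sub>F k in sequentially. norm (q * cutoff' (real k + 2) q) \<le> 2 / ((real k + 2) * q - 1) + 2 * q / (real k + 2)"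
        proof eventually_elim
          case (elim k)
          show ?case unfolding real_norm_def
            by (rule cutoff'_bounds(2)) (use elim q0 in auto)
        qed
      qed
      then have "(\<lambda>k. (2 * (q * cutoff' (real k + 2) q))\<^sup>2 * exp (- q)) \<longlonglongrightarrow> (2 * 0)\<^sup>2 * exp (- q)"
        by (intro tendsto_intros)
      then show "(\<lambda>k. G k x) \<longlonglongrightarrow> 0" by (simp add: G_def q_def)
    qed
  qed
  then show ?thesis by (simp add: G_def)
qed

text \<open>Write \<open>V\<close> for the weighted mass of the extremal field \<open>v\<close>, \<open>I\<close> for the weighted mass of \<open>Dv\<close> and \<open>J\<close> for
the defect, so that \<open>I = J + 4V\<close>. A solution of \<open>Du = e\<^sup>\<phi> v\<close> with constant \<open>C\<close>, tested against \<open>v\<close>, gives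
\<open>V\<^sup>2 \<le> (C V) I\<close>, that is \<open>(1 - 4C) V \<le> C J\<close>. As \<open>J\<close> tends to zero and \<open>V\<close> does not, \<open>C < 1/4\<close> is absurd.\<close>

lemma gaussian_constant_sharp:
  assumes C: "C < 1/4"
    and sol: "\<forall>f \<in> weighted_L2 (\<lambda>x. (norm x)\<^sup>2) (- {0 :: 'n::{finite,linorder} point}).
      \<exists>u \<in> weighted_L2 (\<lambda>x. (norm x)\<^sup>2) (- {0}). dirac_eq (- {0}) u f \<and>
        (weighted_norm (\<lambda>x. (norm x)\<^sup>2) (- {0}) u)\<^sup>2 \<le> C * (weighted_norm (\<lambda>x. (norm x)\<^sup>2) (- {0}) f)\<^sup>2"
  shows False
proof -
  let ?L = "weighted_L2 (\<lambda>x. (norm x)\<^sup>2) (- {0 :: 'n point})"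
  let ?N = "weighted_norm (\<lambda>x. (norm x)\<^sup>2) (- {0 :: 'n point})"
  let ?M = "lebesgue_on (- {0 :: 'n point})"
  have o: "open (- {0 :: 'n point})" by (rule open_Compl) simp
  have sets: "- {0 :: 'n point} \<in> sets lebesgue" using o by auto
  note meas = continuous_imp_measurable_on_sets_lebesgue[OF _ sets]
  define V where "V r = (\<integral>x. (norm (extremal r (x :: 'n point)))\<^sup>2 * exp ((norm x)\<^sup>2) \<partial>?M)" for r
  define J where "J r = (\<integral>x. (2 * ((norm (x::'n point))\<^sup>2 * cutoff' r ((norm x)\<^sup>2)))\<^sup>2 * exp (- (norm x)\<^sup>2) \<partial>?M)" for r
  obtain c where c: "c > 0" "\<And>r. r \<ge> 2 \<Longrightarrow> c \<le> V r"
    using extremal_mass_lower_bound[where 'n='n] unfolding V_def by blast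
  have main: "(1 - 4 * C) * c \<le> C * J r" if r: "r \<ge> 2" for r
  proof -
    define v where "v = (extremal r :: 'n point \<Rightarrow> 'n clifford)"
    have v: "v \<in> test_functions (- {0})" unfolding v_def by (rule extremal_test_function) (use r in simp)
    define I where "I = (\<integral>x. (norm (dirac v x))\<^sup>2 * exp ((norm x)\<^sup>2) \<partial>?M)"
    have Vv: "V r = (\<integral>x. (norm (v x))\<^sup>2 * exp ((norm x)\<^sup>2) \<partial>?M)" by (simp add: V_def v_def)
    have I: "I = J r + 4 * V r"
      unfolding I_def J_def V_def v_def by (rule extremal_identity) (use r in simp)
    have iV: "integrable ?M (\<lambda>x. (norm (v x))\<^sup>2 * exp ((norm x)\<^sup>2))"
      by (rule integrable_test[OF v o]) (auto intro!: continuous_intros continuous_test_function[OF v])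
    have iI: "integrable ?M (\<lambda>x. (norm (dirac v x))\<^sup>2 * exp ((norm x)\<^sup>2))"
      by (rule integrable_test[OF v o]) (auto intro!: continuous_intros continuous_test_function[OF v] simp: dirac_eq_0)
    have ex: "(exp (t / 2))\<^sup>2 = exp t" for t :: real by (simp add: power2_eq_square exp_add[symmetric])
    define f where "f x = exp ((norm x)\<^sup>2) *\<^sub>R v x" for x
    have nf: "(norm (f x))\<^sup>2 * exp (- (norm x)\<^sup>2) = (norm (v x))\<^sup>2 * exp ((norm x)\<^sup>2)" for x
      by (simp add: f_def power_mult_distrib exp_minus power2_eq_square[of "exp _"] field_simps)
    have "f \<in> ?L"
      unfolding weighted_L2_def mem_Collect_eq nf
      using iV by (auto simp: f_def intro!: meas continuous_intros continuous_test_function[OF v])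
    with sol obtain u where u: "u \<in> ?L" "dirac_eq (- {0}) u f"
      "(?N u)\<^sup>2 \<le> C * (?N f)\<^sup>2"
      by blast
    define U where "U x = exp (- (norm x)\<^sup>2 / 2) *\<^sub>R u x" for x
    define W where "W x = exp ((norm x)\<^sup>2 / 2) *\<^sub>R dirac v x" for x
    have nU: "(norm (U x))\<^sup>2 = (norm (u x))\<^sup>2 * exp (- (norm x)\<^sup>2)" for x
      using ex[of "- (norm x)\<^sup>2"] by (simp add: U_def power_mult_distrib)
    have nW: "(norm (W x))\<^sup>2 = (norm (dirac v x))\<^sup>2 * exp ((norm x)\<^sup>2)" for x
      using ex[of "(norm x)\<^sup>2"] by (simp add: W_def power_mult_distrib)
    have UW: "U x \<bullet> W x = u x \<bullet> dirac v x" for x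
      by (simp add: U_def W_def mult_exp_exp)
    have [measurable]: "u \<in> borel_measurable ?M" using u(1) by (simp add: weighted_L2_def)
    have [measurable]: "(\<lambda>x. exp (- (norm x)\<^sup>2 / 2)) \<in> borel_measurable ?M"
      by (intro meas continuous_intros) auto
    have "V r = (\<integral>x. f x \<bullet> v x \<partial>?M)"
      unfolding Vv f_def by (simp add: power2_norm_eq_inner mult.commute)
    also have "\<dots> = (\<integral>x. U x \<bullet> W x \<partial>?M)"
      unfolding UW using u(2) v by (simp add: dirac_eq_def)
    finally have VUW: "V r = (\<integral>x. U x \<bullet> W x \<partial>?M)" .
    have "(V r)\<^sup>2 \<le> (\<integral>x. (norm (U x))\<^sup>2 \<partial>?M) * (\<integral>x. (norm (W x))\<^sup>2 \<partial>?M)"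
      unfolding VUW
    proof (rule Cauchy_Schwarz_L2)
      show "U \<in> borel_measurable ?M" unfolding U_def by measurable
      show "W \<in> borel_measurable ?M" unfolding W_def
        by (intro meas continuous_intros continuous_test_function[OF v]) auto
      show "integrable ?M (\<lambda>x. (norm (U x))\<^sup>2)" unfolding nU using u(1) by (simp add: weighted_L2_def)
      show "integrable ?M (\<lambda>x. (norm (W x))\<^sup>2)" unfolding nW by (rule iI)
    qed
    also have "(\<integral>x. (norm (W x))\<^sup>2 \<partial>?M) = I" by (simp add: nW I_def)
    also have "(\<integral>x. (norm (U x))\<^sup>2 \<partial>?M) \<le> C * V r"
      using u(3) unfolding weighted_norm_square nf nU Vv .
    finally have "(V r)\<^sup>2 \<le> (C * V r) * I" by (simp add: I_def mult_right_mono)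
    moreover have Vc: "c \<le> V r" using c(2)[OF r] .
    ultimately have "V r \<le> C * I" using c(1) by (simp add: power2_eq_square mult_ac)
    then have "(1 - 4 * C) * V r \<le> C * J r" unfolding I by (simp add: algebra_simps)
    moreover have "(1 - 4 * C) * c \<le> (1 - 4 * C) * V r" using C Vc by (intro mult_left_mono) auto
    ultimately show ?thesis by linarith
  qed
  have "(\<lambda>k. C * J (real k + 2)) \<longlonglongrightarrow> C * 0"
    unfolding J_def by (intro tendsto_intros extremal_defect_tendsto_0)
  then have "(1 - 4 * C) * c \<le> C * 0"
    by (rule LIMSEQ_le_const) (use main in auto)
  moreover have "0 < (1 - 4 * C) * c" using C c(1) by simp
  ultimately show False by simp
qed


lemma powr_weight_solution:
  fixes m :: real and f :: "'n::{finite,linorder} point \<Rightarrow> 'n clifford"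
  assumes \<Omega>: "open \<Omega>" "\<Omega> \<subseteq> - {0}" and m: "m \<noteq> 0"
    and f: "f \<in> weighted_L2 (\<lambda>x. norm x powr m) \<Omega>"
    and i: "integrable (lebesgue_on \<Omega>) (\<lambda>x. (norm (f x))\<^sup>2 / norm x powr (m - 2) * exp (- (norm x powr m)))"
  shows "\<exists>u\<in>weighted_L2 (\<lambda>x. norm x powr m) \<Omega>. dirac_eq \<Omega> u f \<and>
    (weighted_norm (\<lambda>x. norm x powr m) \<Omega> u)\<^sup>2 \<le>
      (\<integral>x. (norm (f x))\<^sup>2 / (m\<^sup>2 * norm x powr (m - 2)) * exp (- (norm x powr m)) \<partial>lebesgue_on \<Omega>)"
proof (rule dirac_solution_of_estimate[OF \<Omega>(1)])
  have ne: "x \<noteq> 0" if "x \<in> \<Omega>" for x using that \<Omega>(2) by auto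
  show "continuous_on \<Omega> (\<lambda>x. norm x powr m)" "continuous_on \<Omega> (\<lambda>x. m\<^sup>2 * norm x powr (m - 2))"
    using ne by (auto intro!: continuous_intros)
  show "0 < m\<^sup>2 * norm x powr (m - 2)" if "x \<in> \<Omega>" for x using ne[OF that] m by simp
  show "f \<in> weighted_L2 (\<lambda>x. norm x powr m) \<Omega>" by (rule f)
  have eq: "(norm (f x))\<^sup>2 / (m\<^sup>2 * norm x powr (m - 2)) * exp (- (norm x powr m))
      = (1 / m\<^sup>2) * ((norm (f x))\<^sup>2 / norm x powr (m - 2) * exp (- (norm x powr m)))" for x
    by simp
  show "integrable (lebesgue_on \<Omega>) (\<lambda>x. (norm (f x))\<^sup>2 / (m\<^sup>2 * norm x powr (m - 2)) * exp (- (norm x powr m)))"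
    unfolding eq by (rule integrable_mult_right[OF i])
  show "(\<integral>x. m\<^sup>2 * norm x powr (m - 2) * (norm (v x))\<^sup>2 * exp (norm x powr m) \<partial>lebesgue_on \<Omega>)
      \<le> (\<integral>x. (norm (dirac v x))\<^sup>2 * exp (norm x powr m) \<partial>lebesgue_on \<Omega>)" if "v \<in> test_functions \<Omega>" for v
    unfolding radial_dirac_identity[OF that \<Omega>] by simp
qed

text \<open>The special case of a constant weight \<open>w\<close>, in which integrability of \<open>|f|\<^sup>2 w\<^sup>-\<^sup>1 e\<^sup>-\<^sup>\<phi>\<close> is automatic.\<close>

lemma constant_estimate_solution:
  fixes \<phi> :: "'n::{finite,linorder} point \<Rightarrow> real"
  assumes \<Omega>: "open \<Omega>" and \<phi>: "continuous_on \<Omega> \<phi>" and c: "0 < c"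
    and est: "\<And>v. v \<in> test_functions \<Omega> \<Longrightarrow>
      (\<integral>x. c * (norm (v x))\<^sup>2 * exp (\<phi> x) \<partial>lebesgue_on \<Omega>)
        \<le> (\<integral>x. (norm (dirac v x))\<^sup>2 * exp (\<phi> x) \<partial>lebesgue_on \<Omega>)"
    and f: "f \<in> weighted_L2 \<phi> \<Omega>"
  shows "\<exists>u\<in>weighted_L2 \<phi> \<Omega>. dirac_eq \<Omega> u f \<and>
    (weighted_norm \<phi> \<Omega> u)\<^sup>2 \<le> 1 / c * (weighted_norm \<phi> \<Omega> f)\<^sup>2"
proof -
  have eq: "(norm (f x))\<^sup>2 / c * exp (- \<phi> x) = (1 / c) * ((norm (f x))\<^sup>2 * exp (- \<phi> x))" for x
    by simp
  have i: "integrable (lebesgue_on \<Omega>) (\<lambda>x. (norm (f x))\<^sup>2 / c * exp (- \<phi> x))"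
    using f unfolding eq weighted_L2_def by (auto intro: integrable_mult_right)
  have int: "(\<integral>x. (norm (f x))\<^sup>2 / c * exp (- \<phi> x) \<partial>lebesgue_on \<Omega>) = 1 / c * (weighted_norm \<phi> \<Omega> f)\<^sup>2"
    unfolding eq weighted_norm_square by (rule integral_mult_right_zero)
  show ?thesis
    using dirac_solution_of_estimate[OF \<Omega> \<phi> continuous_on_const c est f i] unfolding int .
qed

lemma gaussian_weight_solution:
  fixes f :: "'n::{finite,linorder} point \<Rightarrow> 'n clifford"
  assumes \<Omega>: "open \<Omega>" "\<Omega> \<subseteq> - {0}" and f: "f \<in> weighted_L2 (\<lambda>x. (norm x)\<^sup>2) \<Omega>"
  shows "\<exists>u \<in> weighted_L2 (\<lambda>x. (norm x)\<^sup>2) \<Omega>. dirac_eq \<Omega> u f \<and>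
    (weighted_norm (\<lambda>x. (norm x)\<^sup>2) \<Omega> u)\<^sup>2 \<le> 1 / 4 * (weighted_norm (\<lambda>x. (norm x)\<^sup>2) \<Omega> f)\<^sup>2"
proof (rule constant_estimate_solution[OF \<Omega>(1) _ _ _ f])
  fix v :: "'n point \<Rightarrow> 'n clifford" assume v: "v \<in> test_functions \<Omega>"
  have p2: "norm x powr 2 = (norm x)\<^sup>2" for x :: "'n point" by (cases "x = 0") auto
  have "(\<integral>x. 4 * (norm (v x))\<^sup>2 * exp ((norm x)\<^sup>2) \<partial>lebesgue_on \<Omega>)
      = (\<integral>x. 2\<^sup>2 * norm x powr (2 - 2) * (norm (v x))\<^sup>2 * exp (norm x powr 2) \<partial>lebesgue_on \<Omega>)"
    by (rule Bochner_Integration.integral_cong) (use \<Omega>(2) in \<open>auto simp: p2\<close>)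
  also have "\<dots> \<le> (\<integral>x. (norm (dirac v x))\<^sup>2 * exp (norm x powr 2) \<partial>lebesgue_on \<Omega>)"
    unfolding radial_dirac_identity[OF v \<Omega>] by simp
  finally show "(\<integral>x. 4 * (norm (v x))\<^sup>2 * exp ((norm x)\<^sup>2) \<partial>lebesgue_on \<Omega>)
      \<le> (\<integral>x. (norm (dirac v x))\<^sup>2 * exp ((norm x)\<^sup>2) \<partial>lebesgue_on \<Omega>)"
    unfolding p2 .
qed (auto intro!: continuous_intros)

section \<open>The theorem\<close>

theorem theorem1p3:
  assumes "CARD('n::{finite,linorder}) \<ge> 2"
  shows
    "(\<forall>\<Omega> :: 'n point set. is_domain \<Omega> \<longrightarrow>
        (\<Omega> \<subseteq> - {0} \<longrightarrow>
          (\<forall>m::real. m \<noteq> 0 \<longrightarrow>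
            (let \<phi> = (\<lambda>x. norm x powr m) in
              \<forall>f \<in> weighted_L2 \<phi> \<Omega>.
                integrable (lebesgue_on \<Omega>)
                  (\<lambda>x. (norm (f x))\<^sup>2 / norm x powr (m - 2) * exp (- \<phi> x)) \<longrightarrow>
                (\<exists>u \<in> weighted_L2 \<phi> \<Omega>. dirac_eq \<Omega> u f \<and>
                  (weighted_norm \<phi> \<Omega> u)\<^sup>2 \<le>
                    (\<integral>x. (norm (f x))\<^sup>2 / (m\<^sup>2 * norm x powr (m - 2)) * exp (- \<phi> x)
                      \<partial>lebesgue_on \<Omega>)))) \<and>
          (let \<phi> = (\<lambda>x. (norm x)\<^sup>2) in
            (\<forall>f \<in> weighted_L2 \<phi> \<Omega>. \<exists>u \<in> weighted_L2 \<phi> \<Omega>. dirac_eq \<Omega> u f \<and>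
              (weighted_norm \<phi> \<Omega> u)\<^sup>2 \<le> 1 / 4 * (weighted_norm \<phi> \<Omega> f)\<^sup>2) \<and>
            (\<Omega> = - {0} \<longrightarrow>
              \<not> (\<exists>C < 1 / 4. \<forall>f \<in> weighted_L2 \<phi> \<Omega>. \<exists>u \<in> weighted_L2 \<phi> \<Omega>. dirac_eq \<Omega> u f \<and>
                  (weighted_norm \<phi> \<Omega> u)\<^sup>2 \<le> C * (weighted_norm \<phi> \<Omega> f)\<^sup>2)))) \<and>
        (let \<phi> = (\<lambda>x. (x $ first_index)\<^sup>2) in
          \<forall>f \<in> weighted_L2 \<phi> \<Omega>. \<exists>u \<in> weighted_L2 \<phi> \<Omega>. dirac_eq \<Omega> u f \<and>
            (weighted_norm \<phi> \<Omega> u)\<^sup>2 \<le> 1 / 2 * (weighted_norm \<phi> \<Omega> f)\<^sup>2)) \<and>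
     (\<exists>\<epsilon>>0. \<forall>(\<Omega> :: 'n point set) (a :: 'n \<Rightarrow> real).
        is_domain \<Omega> \<longrightarrow> \<Omega> \<subseteq> - closure (ball 0 1) \<longrightarrow> (\<forall>i. \<bar>a i - 1\<bar> < \<epsilon>) \<longrightarrow>
        (let \<phi> = (\<lambda>x. \<Sum>i\<in>UNIV. a i * (x $ i)\<^sup>2) in
          \<forall>f \<in> weighted_L2 \<phi> \<Omega>. \<exists>u \<in> weighted_L2 \<phi> \<Omega>. dirac_eq \<Omega> u f \<and>
            (weighted_norm \<phi> \<Omega> u)\<^sup>2 \<le> 1 / 3 * (weighted_norm \<phi> \<Omega> f)\<^sup>2))"
proof (intro conjI allI impI, goal_cases)
  case (1 \<Omega> m)
  then show ?case
    unfolding Let_def is_domain_def using powr_weight_solution[of \<Omega> m] by blast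
next
  case (2 \<Omega>)
  then show ?case
    unfolding Let_def is_domain_def
    using gaussian_weight_solution[of \<Omega>] gaussian_constant_sharp by blast
next
  case (3 \<Omega>)
  then have \<Omega>: "open \<Omega>" by (simp add: is_domain_def)
  show ?case
    unfolding Let_def
    by (intro ballI constant_estimate_solution[OF \<Omega>] linear_dirac_estimate \<Omega>) (auto intro!: continuous_intros)
next
  case 4
  show ?case
  proof (intro exI[of _ "1 / (200 * real CARD('n) ^ 3)"] conjI allI impI, goal_cases)
    case (2 \<Omega> a)
    then have \<Omega>: "open \<Omega>" "\<Omega> \<subseteq> - ball 0 1"
      using closure_subset[of "ball (0::'n point) 1"] by (auto simp: is_domain_def)
    have a: "\<bar>a i - 1\<bar> \<le> 1 / (200 * real CARD('n) ^ 3)" for i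
      using 2(3) by (simp add: less_imp_le)
    show ?case
      unfolding Let_def
      by (intro ballI constant_estimate_solution[OF \<Omega>(1)] quadratic_dirac_estimate[OF _ \<Omega> a])
         (auto intro!: continuous_intros)
  qed simp
qed

end
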